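(* Let $S$ be an inverse semigroup with set of idempotents $E$, and regard $\ell^{1}(S)$ as a Banach $\ell^{1}(E)$-module with the trivial left action and the natural right action, i.e. $\delta_e.\delta_s=\delta_s$ and $\delta_s.\delta_e=\delta_{se}$ for $s\in S$, $e\in E$. Then for every $n\in\mathbb{N}$, $\ell^{1}(S)$ is $2n$-weakly module amenable as an $\ell^{1}(E)$-module; that is, $(\ell^{1}(S)/J)^{(2n)}$ is a commutative Banach $\ell^1(S)$-$\ell^1(E)$-module and every continuous module derivation $D:\ell^{1}(S)\to(\ell^{1}(S)/J)^{(2n)}$ is inner: there exists $\Phi\in(\ell^{1}(S)/J)^{(2n)}$ with $D(f)=f\Phi-\Phi f$ for all $f\in\ell^{1}(S)$.
   Context: An inverse semigroup is a semigroup $S$ such that for each $s\in S$ there is a unique $s^{*}\in S$ with $ss^{*}s=s$ and $s^{*}ss^{*}=s^{*}$; $E$ denotes its set of idempotents (every element of $E$ has the form $ss^*$, and $E$ is a commutative subsemigroup). $\ell^1(S)$ is the convolution algebra with $\delta_s*\delta_t=\delta_{st}$; $\ell^1(E)\subseteq\ell^1(S)$. The actions of $\ell^1(E)$ on $\ell^1(S)$ are the continuous bilinear extensions of $\delta_e.\delta_s=\delta_s$, $\delta_s.\delta_e=\delta_{se}$. $J$ is the closed ideal of $\ell^1(S)$ generated by elements $(a.\alpha)b-a(\alpha.b)$ ($a,b\in\ell^1(S)$, $\alpha\in\ell^1(E)$); here $J$ is the closed linear span of $\{\delta_{set}-\delta_{st}: s,t\in S, e\in E\}$. The quotient $\ell^1(S)/J$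 is a Banach algebra and an $\ell^1(E)$-bimodule via $\alpha.(a+J)=\alpha.a+J$, $(a+J).\alpha=a.\alpha+J$, and an $\ell^1(S)$-bimodule via $a(b+J)=ab+J$, $(b+J)a=ba+J$. For a Banach bimodule $X$, its dual $X^*$ carries the actions $\langle x,af\rangle=\langle xa,f\rangle$, $\langle x,fa\rangle=\langle ax,f\rangle$ (for both algebras); $X^{(0)}=X$, $X^{(n)}=(X^{(n-1)})^*$. A module $X$ over $\ell^1(E)$ is commutative if $\alpha.x=x.\alpha$ for all $\alpha,x$. A module derivation $D:\ell^1(S)\to X$ is a bounded map with $D(a\pm b)=D(a)\pm D(b)$, $D(ab)=aD(b)+D(a)b$, $D(\alpha.a)=\alpha.D(a)$, $D(a.\alpha)=D(a).\alpha$ for $a,b\in\ell^1(S)$, $\alpha\in\ell^1(E)$. $\ell^1(S)$ is called $n$-weakly module amenable if $(\ell^1(S)/J)^{(n)}$ is a commutative $\ell^1(E)$-module and every continuous module derivation $\ell^1(S)\to(\ell^1(S)/J)^{(n)}$ is inner, i.e. of the form $a\mapsto a\Phi-\Phi a$ for some $\Phi$. *)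

theory Defs
  imports "HOL-Analysis.Analysis"
begin

definition inverse_semigroup :: "'s::semigroup_mult itself \<Rightarrow> bool" where
  "inverse_semigroup _ \<longleftrightarrow> (\<forall>s::'s. \<exists>!t. s * t * s = s \<and> t * s * t = t)"

definition idems :: "'s::semigroup_mult set" where
  "idems = {e. e * e = e}"

definition delta :: "'s \<Rightarrow> 's \<Rightarrow> complex" where
  "delta s = (\<lambda>u. if u = s then 1 else 0)"

definition l1 :: "('s \<Rightarrow> complex) set" where
  "l1 = {f. (\<lambda>s. norm (f s)) summable_on UNIV}"

definition l1norm :: "('s \<Rightarrow> complex) \<Rightarrow> real" where
  "l1norm f = infsum (\<lambda>s. norm (f s)) UNIV"

definition conv :: "('s::semigroup_mult \<Rightarrow> complex) \<Rightarrow> ('s \<Rightarrow> complex) \<Rightarrow> 's \<Rightarrow> complex" where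
  "conv f g = (\<lambda>u. infsum (\<lambda>(s, t). f s * g t) {(s, t). s * t = u})"

definition l1E :: "('s::semigroup_mult \<Rightarrow> complex) set" where
  "l1E = {\<alpha> \<in> l1. \<forall>s. s \<notin> idems \<longrightarrow> \<alpha> s = 0}"

text \<open>Trivial left action (delta e . delta s = delta s) and natural right action
  (delta s . delta e = delta (s e)), extended bilinearly and continuously.\<close>
definition Eact_l :: "('s \<Rightarrow> complex) \<Rightarrow> ('s \<Rightarrow> complex) \<Rightarrow> 's \<Rightarrow> complex" where
  "Eact_l \<alpha> f = (\<lambda>u. infsum \<alpha> UNIV * f u)"

definition Eact_r :: "('s::semigroup_mult \<Rightarrow> complex) \<Rightarrow> ('s \<Rightarrow> complex) \<Rightarrow> 's \<Rightarrow> complex" where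
  "Eact_r f \<alpha> = conv f \<alpha>"

definition Jspan :: "('s::semigroup_mult \<Rightarrow> complex) set" where
  "Jspan = {f. \<exists>(m::nat) c s e t. (\<forall>i<m. e i \<in> idems) \<and>
      f = (\<lambda>u. \<Sum>i<m. c i * (delta (s i * e i * t i) u - delta (s i * t i) u))}"

definition Jideal :: "('s::semigroup_mult \<Rightarrow> complex) set" where
  "Jideal = {f \<in> l1. \<forall>\<epsilon>>0. \<exists>g\<in>Jspan. l1norm (\<lambda>u. f u - g u) < \<epsilon>}"

definition bfun :: "'v::ab_group_add set \<Rightarrow> (complex \<Rightarrow> 'v \<Rightarrow> 'v) \<Rightarrow> ('v \<Rightarrow> real)
    \<Rightarrow> ('v \<Rightarrow> complex) \<Rightarrow> bool" where
  "bfun X sm nv l \<longleftrightarrow>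
     (\<forall>x\<in>X. \<forall>y\<in>X. l (x + y) = l x + l y) \<and>
     (\<forall>c. \<forall>x\<in>X. l (sm c x) = c * l x) \<and>
     (\<exists>C. \<forall>x\<in>X. norm (l x) \<le> C * nv x)"

text \<open>dual_tower N q sm V pr nv: V 0 (with quotient map q, scalar multiplication sm and
  norm nv 0) is (an isometric copy of) the Banach space l1(S)/J with the quotient norm,
  and for k < N, V (Suc k) with the pairing pr k (pr k phi x = <x, phi>) and norm
  nv (Suc k) is (an isometric copy of) the dual of V k.  Thus V k realises X^(k).\<close>
definition dual_tower :: "nat \<Rightarrow> (('s::semigroup_mult \<Rightarrow> complex) \<Rightarrow> 'v::ab_group_add)
    \<Rightarrow> (complex \<Rightarrow> 'v \<Rightarrow> 'v) \<Rightarrow> (nat \<Rightarrow> 'v set) \<Rightarrow> (nat \<Rightarrow> 'v \<Rightarrow> 'v \<Rightarrow> complex)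
    \<Rightarrow> (nat \<Rightarrow> 'v \<Rightarrow> real) \<Rightarrow> bool" where
  "dual_tower N q sm V pr nv \<longleftrightarrow>
     (\<forall>f\<in>l1. q f \<in> V 0) \<and> (\<forall>x\<in>V 0. \<exists>f\<in>l1. q f = x) \<and>
     (\<forall>f\<in>l1. \<forall>g\<in>l1. q f = q g \<longleftrightarrow> (\<lambda>u. f u - g u) \<in> Jideal) \<and>
     (\<forall>f\<in>l1. \<forall>g\<in>l1. q (\<lambda>u. f u + g u) = q f + q g) \<and>
     (\<forall>c. \<forall>f\<in>l1. q (\<lambda>u. c * f u) = sm c (q f)) \<and>
     (\<forall>f\<in>l1. nv 0 (q f) = Inf {l1norm (\<lambda>u. f u + j u) | j. j \<in> Jideal}) \<and>
     (\<forall>k\<le>N. \<forall>x\<in>V k. \<forall>y\<in>V k. x + y \<in> V k \<and> (\<forall>c. sm c x \<in> V k)) \<and>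
     (\<forall>k<N.
        (\<forall>\<phi>\<in>V (Suc k). bfun (V k) sm (nv k) (pr k \<phi>)) \<and>
        (\<forall>l. bfun (V k) sm (nv k) l \<longrightarrow> (\<exists>!\<phi>. \<phi> \<in> V (Suc k) \<and> (\<forall>x\<in>V k. pr k \<phi> x = l x))) \<and>
        (\<forall>\<phi>\<in>V (Suc k). \<forall>\<psi>\<in>V (Suc k). \<forall>x\<in>V k. pr k (\<phi> + \<psi>) x = pr k \<phi> x + pr k \<psi> x) \<and>
        (\<forall>c. \<forall>\<phi>\<in>V (Suc k). \<forall>x\<in>V k. pr k (sm c \<phi>) x = c * pr k \<phi> x) \<and>
        (\<forall>\<phi>\<in>V (Suc k). nv (Suc k) \<phi> = Sup {norm (pr k \<phi> x) | x. x \<in> V k \<and> nv k x \<le> 1}))"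

text \<open>Module actions on the tower, given the actions L, R of an algebra on l1(S)
  (which descend to l1(S)/J).  On duals: <x, a phi> = <x a, phi>, <x, phi a> = <a x, phi>.\<close>
fun tact_l :: "('a \<Rightarrow> ('s \<Rightarrow> complex) \<Rightarrow> ('s \<Rightarrow> complex)) \<Rightarrow> (('s \<Rightarrow> complex) \<Rightarrow> 'a \<Rightarrow> ('s \<Rightarrow> complex))
    \<Rightarrow> (('s \<Rightarrow> complex) \<Rightarrow> 'v) \<Rightarrow> (nat \<Rightarrow> 'v set) \<Rightarrow> (nat \<Rightarrow> 'v \<Rightarrow> 'v \<Rightarrow> complex)
    \<Rightarrow> nat \<Rightarrow> 'a \<Rightarrow> 'v \<Rightarrow> 'v"
and tact_r :: "('a \<Rightarrow> ('s \<Rightarrow> complex) \<Rightarrow> ('s \<Rightarrow> complex)) \<Rightarrow> (('s \<Rightarrow> complex) \<Rightarrow> 'a \<Rightarrow> ('s \<Rightarrow> complex))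
    \<Rightarrow> (('s \<Rightarrow> complex) \<Rightarrow> 'v) \<Rightarrow> (nat \<Rightarrow> 'v set) \<Rightarrow> (nat \<Rightarrow> 'v \<Rightarrow> 'v \<Rightarrow> complex)
    \<Rightarrow> nat \<Rightarrow> 'v \<Rightarrow> 'a \<Rightarrow> 'v" where
  "tact_l L R q V pr 0 a x = q (L a (SOME b. b \<in> l1 \<and> q b = x))"
| "tact_l L R q V pr (Suc k) a \<phi> =
     (THE \<psi>. \<psi> \<in> V (Suc k) \<and> (\<forall>x\<in>V k. pr k \<psi> x = pr k \<phi> (tact_r L R q V pr k x a)))"
| "tact_r L R q V pr 0 x a = q (R (SOME b. b \<in> l1 \<and> q b = x) a)"
| "tact_r L R q V pr (Suc k) \<phi> a =
     (THE \<psi>. \<psi> \<in> V (Suc k) \<and> (\<forall>x\<in>V k. pr k \<psi> x = pr k \<phi> (tact_l L R q V pr k a x)))"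

abbreviation "Sl q V pr m \<equiv> tact_l conv conv q V pr m"
abbreviation "Sr q V pr m \<equiv> tact_r conv conv q V pr m"
abbreviation "El q V pr m \<equiv> tact_l Eact_l Eact_r q V pr m"
abbreviation "Er q V pr m \<equiv> tact_r Eact_l Eact_r q V pr m"

definition commutative_Emod :: "(('s::semigroup_mult \<Rightarrow> complex) \<Rightarrow> 'v) \<Rightarrow> (nat \<Rightarrow> 'v set)
    \<Rightarrow> (nat \<Rightarrow> 'v \<Rightarrow> 'v \<Rightarrow> complex) \<Rightarrow> nat \<Rightarrow> bool" where
  "commutative_Emod q V pr m \<longleftrightarrow>
     (\<forall>\<alpha>\<in>l1E. \<forall>x\<in>V m. El q V pr m \<alpha> x = Er q V pr m x \<alpha>)"

definition module_derivation :: "(('s::semigroup_mult \<Rightarrow> complex) \<Rightarrow> 'v::ab_group_add)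
    \<Rightarrow> (nat \<Rightarrow> 'v set) \<Rightarrow> (nat \<Rightarrow> 'v \<Rightarrow> 'v \<Rightarrow> complex) \<Rightarrow> (nat \<Rightarrow> 'v \<Rightarrow> real) \<Rightarrow> nat
    \<Rightarrow> (('s \<Rightarrow> complex) \<Rightarrow> 'v) \<Rightarrow> bool" where
  "module_derivation q V pr nv m D \<longleftrightarrow>
     (\<forall>a\<in>l1. D a \<in> V m) \<and>
     (\<forall>a\<in>l1. \<forall>b\<in>l1. D (\<lambda>u. a u + b u) = D a + D b \<and> D (\<lambda>u. a u - b u) = D a - D b) \<and>
     (\<forall>a\<in>l1. \<forall>b\<in>l1. D (conv a b) = Sl q V pr m a (D b) + Sr q V pr m (D a) b) \<and>
     (\<forall>\<alpha>\<in>l1E. \<forall>a\<in>l1. D (Eact_l \<alpha> a) = El q V pr m \<alpha> (D a) \<and>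
                        D (Eact_r a \<alpha>) = Er q V pr m (D a) \<alpha>) \<and>
     (\<exists>C. \<forall>a\<in>l1. nv m (D a) \<le> C * l1norm a)"

definition inner_derivation :: "(('s::semigroup_mult \<Rightarrow> complex) \<Rightarrow> 'v::ab_group_add)
    \<Rightarrow> (nat \<Rightarrow> 'v set) \<Rightarrow> (nat \<Rightarrow> 'v \<Rightarrow> 'v \<Rightarrow> complex) \<Rightarrow> nat
    \<Rightarrow> (('s \<Rightarrow> complex) \<Rightarrow> 'v) \<Rightarrow> bool" where
  "inner_derivation q V pr m D \<longleftrightarrow>
     (\<exists>\<Phi>\<in>V m. \<forall>f\<in>l1. D f = Sl q V pr m f \<Phi> - Sr q V pr m \<Phi> f)"

definition weakly_module_amenable :: "nat \<Rightarrow> (('s::semigroup_mult \<Rightarrow> complex) \<Rightarrow> 'v::ab_group_add)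
    \<Rightarrow> (nat \<Rightarrow> 'v set) \<Rightarrow> (nat \<Rightarrow> 'v \<Rightarrow> 'v \<Rightarrow> complex) \<Rightarrow> (nat \<Rightarrow> 'v \<Rightarrow> real) \<Rightarrow> bool" where
  "weakly_module_amenable m q V pr nv \<longleftrightarrow>
     commutative_Emod q V pr m \<and>
     (\<forall>D. module_derivation q V pr nv m D \<longrightarrow> inner_derivation q V pr m D)"

end

theory Submission
  imports Defs "HOL-Library.Function_Algebras"
begin

text \<open>
  The quotient \<open>\<ell>\<^sup>1(S)/J\<close> is the group algebra \<open>\<ell>\<^sup>1(G)\<close> of the maximal group image \<open>G\<close> of \<open>S\<close>, on which the
  idempotents act trivially.  A module derivation \<open>D\<close> yields the bounded cocycle
  \<open>c g = D(\<delta>\<^sub>g) \<cdot> \<delta>\<^sub>g\<^sub>*\<close> for the conjugation action on \<open>\<ell>\<^sup>1(G)\<^sup>(\<^sup>2\<^sup>n\<^sup>)\<close>, and \<open>D\<close> is inner iff the affine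
  isometries \<open>y \<mapsto> \<delta>\<^sub>g y \<delta>\<^sub>g\<^sub>* + c g\<close> have a common fixed point.

  On \<open>\<ell>\<^sup>1\<close> the norm distance is of negative type, \<open>\<parallel>x - y\<parallel>\<close> being the squared distance of the indicator
  functions of the subgraphs.  A finite family of orbit points almost maximising the mean mutual distance
  therefore has an almost invariant barycentre \<open>h\<close> among functions on \<open>G \<times> \<real>\<close>; applying \<open>3 h\<^sup>2 - 2 h\<^sup>3\<close>
  brings it back to an almost fixed element of \<open>\<ell>\<^sup>1\<close>, which is just the mean of the pointwise medians of all
  triples of the family.  The resulting estimate only involves norms of finitely many linear expressions, so by
  Helly's lemma and weak-* compactness it is inherited by biduals.  A last weak-* compactness argument turns
  almost fixed points into a fixed point.
\<close>

section \<open>Additive functionals below sublinear ones\<close>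

text \<open>The maximal group image may be far from amenable, so orbits cannot simply be averaged.
  The barycentre \<open>h\<close> is almost invariant only in the square norm, which by itself gives
  no control in the l1 norm. The cubic repairs this because its derivative vanishes at
  \<open>0\<close> and \<open>1\<close>: its change from \<open>h\<close> to \<open>h'\<close> is at
  most \<open>\<eta>\<close> times \<open>(h - h^2) + (h' - h'^2)\<close> plus
  \<open>6 / \<eta>\<close> times the squared difference. The integral of \<open>h - h^2\<close> is
  half the mean mutual distance, hence bounded, and \<open>\<eta>\<close> is at our disposal. The
  bound \<open>3 * R\<close> in \<open>approx_mean\<close> comes from estimating a median by the sum
  of three absolute values. The even duals have no coordinates, so only the inequality can be
  transferred to them. In it the distances \<open>N (x i - x j)\<close> have the coefficient
  \<open>\<eta> - 6 / \<eta>\<close>, negative since \<open>\<eta> \<le> 1\<close>: passing to a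
  bidual, they must be kept large while all other distances are kept small. The last compactness
  argument takes place in level \<open>2 * n\<close> as the dual of level \<open>2 * n - 1\<close>,
  so \<open>n\<close> has to be positive there.\<close>

primrec nmul :: "nat \<Rightarrow> 'a::ab_group_add \<Rightarrow> 'a" where
  "nmul 0 x = 0"
| "nmul (Suc n) x = x + nmul n x"

lemma nmul_add: "nmul (m + n) x = nmul m x + nmul n x"
  by (induction m) (simp_all add: algebra_simps)

text \<open>Positive homogeneity is only required for the factor \<open>2\<close>; thus the Hahn--Banach theorem
  below holds for subgroups of abelian groups, and no scalar multiplication is needed.\<close>

definition sublinear_on :: "'a::ab_group_add set \<Rightarrow> ('a \<Rightarrow> real) \<Rightarrow> bool" where
  "sublinear_on U p \<longleftrightarrow> 0 \<in> U \<and> (\<forall>x\<in>U. \<forall>y\<in>U. x + y \<in> U \<and> p (x + y) \<le> p x + p y) \<and>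
     (\<forall>x\<in>U. - x \<in> U \<and> p (x + x) = 2 * p x)"

definition additive_on :: "'a::ab_group_add set \<Rightarrow> ('a \<Rightarrow> real) \<Rightarrow> bool" where
  "additive_on U g \<longleftrightarrow> (\<forall>x\<in>U. \<forall>y\<in>U. g (x + y) = g x + g y)"

lemma sublinear_onD:
  assumes "sublinear_on U p"
  shows "0 \<in> U" "\<And>x y. x \<in> U \<Longrightarrow> y \<in> U \<Longrightarrow> x + y \<in> U"
    "\<And>x y. x \<in> U \<Longrightarrow> y \<in> U \<Longrightarrow> p (x + y) \<le> p x + p y"
    "\<And>x. x \<in> U \<Longrightarrow> - x \<in> U" "\<And>x. x \<in> U \<Longrightarrow> p (x + x) = 2 * p x" "p 0 = 0"
    "\<And>x. x \<in> U \<Longrightarrow> - p (- x) \<le> p x"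
proof -
  show *: "0 \<in> U" "\<And>x y. x \<in> U \<Longrightarrow> y \<in> U \<Longrightarrow> x + y \<in> U"
    "\<And>x y. x \<in> U \<Longrightarrow> y \<in> U \<Longrightarrow> p (x + y) \<le> p x + p y"
    "\<And>x. x \<in> U \<Longrightarrow> - x \<in> U" "\<And>x. x \<in> U \<Longrightarrow> p (x + x) = 2 * p x"
    using assms unfolding sublinear_on_def by auto
  show 0: "p 0 = 0" using *(5)[OF *(1)] by simp
  show "- p (- x) \<le> p x" if "x \<in> U" for x
    using *(3)[OF that *(4)[OF that]] 0 by simp
qed

lemma nmul_in: "sublinear_on U p \<Longrightarrow> y \<in> U \<Longrightarrow> nmul n y \<in> U"
  by (induction n) (auto simp: sublinear_onD)

text \<open>Doubling settles the powers of \<open>2\<close>. For other \<open>n\<close>,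
  subadditivity gives \<open>\<le>\<close>, and splitting \<open>2 ^ n\<close> into \<open>n\<close>
  and \<open>2 ^ n - n\<close> turns the equality at \<open>2 ^ n\<close> into the reverse
  inequality.\<close>

lemma sublinear_nmul:
  assumes p: "sublinear_on U p" and y: "y \<in> U"
  shows "p (nmul n y) = n * p y"
proof -
  have le: "p (nmul n y) \<le> n * p y" for n
  proof (induction n)
    case 0 show ?case using sublinear_onD(6)[OF p] by simp
  next
    case (Suc n)
    have "p (nmul (Suc n) y) \<le> p y + p (nmul n y)"
      using sublinear_onD(3)[OF p y nmul_in[OF p y]] by simp
    with Suc show ?case by (simp add: algebra_simps)
  qed
  have pow: "p (nmul (2 ^ m) y) = 2 ^ m * p y" for m
  proof (induction m)
    case (Suc m)
    have "nmul (2 ^ Suc m) y = nmul (2 ^ m) y + nmul (2 ^ m) y"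
      by (simp add: nmul_add mult_2)
    then show ?case using Suc sublinear_onD(5)[OF p nmul_in[OF p y]] by simp
  qed simp
  have "nmul (2 ^ n) y = nmul n y + nmul (2 ^ n - n) y"
    by (metis nmul_add le_add_diff_inverse less_exp order_less_imp_le)
  then have "p (nmul (2 ^ n) y) \<le> p (nmul n y) + p (nmul (2 ^ n - n) y)"
    using sublinear_onD(3)[OF p nmul_in[OF p y] nmul_in[OF p y]] by metis
  also have "\<dots> \<le> p (nmul n y) + (2 ^ n - n) * p y"
    using le[of "2 ^ n - n"] less_exp[of n] by (simp add: of_nat_diff order_less_imp_le)
  finally show ?thesis using le[of n] pow[of n] by (simp add: algebra_simps)
qed

text \<open>What keeps \<open>p\<close> from being additive is the gap between
  \<open>- p (- y)\<close> and \<open>p y\<close>. The infimum of \<open>p (x + t y) - t p y\<close>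
  over \<open>t \<ge> 0\<close> closes it for one \<open>y\<close>; here \<open>t\<close> runs
  through the naturals.\<close>

lemma sublinear_descend:
  assumes p: "sublinear_on U p" and y: "y \<in> U"
  obtains p' where "sublinear_on U p'" "\<And>x. x \<in> U \<Longrightarrow> p' x \<le> p x" "p' (- y) \<le> - p y"
proof -
  note D = sublinear_onD[OF p]
  note nin = nmul_in[OF p y]
  define f where "f x n = p (x + nmul n y) - real n * p y" for x n
  define p' where "p' x = (INF n. f x n)" for x
  have lb: "- p (- x) \<le> f x n" if x: "x \<in> U" for x n
  proof -
    have "p (nmul n y) \<le> p (x + nmul n y) + p (- x)"
      using D(3)[OF D(2)[OF x nin] D(4)[OF x], of n] by simp
    then show ?thesis using sublinear_nmul[OF p y, of n] by (simp add: f_def)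
  qed
  have bdd: "bdd_below (range (f x))" if "x \<in> U" for x
    using lb[OF that] by (auto intro!: bdd_belowI)
  have le: "p' x \<le> f x n" if "x \<in> U" for x n
    unfolding p'_def using bdd[OF that] by (rule cINF_lower) simp
  have sub: "p' (x + z) \<le> p' x + p' z" if x: "x \<in> U" and z: "z \<in> U" for x z
  proof -
    have "p' (x + z) \<le> f x m + f z n" for m n
    proof -
      have "p ((x + z) + nmul (m + n) y) \<le> p (x + nmul m y) + p (z + nmul n y)"
        using D(3)[OF D(2)[OF x nin] D(2)[OF z nin], of m n] by (simp add: nmul_add algebra_simps)
      then have "f (x + z) (m + n) \<le> f x m + f z n" by (simp add: f_def algebra_simps)
      with le[OF D(2)[OF x z], of "m + n"] show ?thesis by linarith
    qed
    then have "p' (x + z) - f z n \<le> p' x" for n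
      unfolding p'_def[of x] by (intro cINF_greatest) (auto simp: algebra_simps)
    then have "p' (x + z) - p' x \<le> p' z"
      unfolding p'_def[of z] by (intro cINF_greatest) (auto simp: algebra_simps)
    then show ?thesis by simp
  qed
  have dbl: "p' (x + x) = 2 * p' x" if x: "x \<in> U" for x
  proof -
    \<comment> \<open>\<open>2 * f x n\<close> is \<open>f (x + x) (2 * n)\<close>, and by
      subadditivity \<open>f\<close> decreases in its second argument.\<close>
    have "2 * p' x \<le> f (x + x) n" for n
    proof -
      have "2 * f x n = p ((x + nmul n y) + (x + nmul n y)) - 2 * n * p y"
        using D(5)[OF D(2)[OF x nin[of n]]] by (simp add: f_def algebra_simps)
      also have "(x + nmul n y) + (x + nmul n y) = ((x + x) + nmul n y) + nmul n y"
        by (simp add: algebra_simps)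
      also have "p \<dots> - 2 * n * p y \<le> p ((x + x) + nmul n y) + n * p y - 2 * n * p y"
        using D(3)[OF D(2)[OF D(2)[OF x x] nin] nin, of n n] sublinear_nmul[OF p y, of n] by simp
      also have "\<dots> = f (x + x) n" by (simp add: f_def)
      finally show ?thesis using le[OF x, of n] by linarith
    qed
    then have "2 * p' x \<le> p' (x + x)" unfolding p'_def[of "x + x"] by (intro cINF_greatest) auto
    with sub[OF x x] show ?thesis by linarith
  qed
  show ?thesis
  proof
    show "sublinear_on U p'"
      unfolding sublinear_on_def using D(1,2,4) sub dbl by auto
    show "p' x \<le> p x" if "x \<in> U" for x using le[OF that, of 0] by (simp add: f_def)
    show "p' (- y) \<le> - p y" using le[OF D(4)[OF y], of 1] D(6) by (simp add: f_def)
  qed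
qed

text \<open>A minimal sublinear functional below \<open>p\<close>, found by Zorn's lemma, cannot be
  lowered by \<open>sublinear_descend\<close>. Hence it is odd, and an odd subadditive function is
  additive.\<close>

lemma additive_below_sublinear:
  assumes p: "sublinear_on U p"
  obtains g where "additive_on U g" "\<And>x. x \<in> U \<Longrightarrow> g x \<le> p x"
proof -
  note D = sublinear_onD[OF p]
  \<comment> \<open>Members of \<open>\<A>\<close> vanish off \<open>U\<close>, so that agreement on
    \<open>U\<close> is equality and the order is antisymmetric.\<close>
  define \<A> where "\<A> = {q. sublinear_on U q \<and> (\<forall>x\<in>U. q x \<le> p x) \<and> (\<forall>x. x \<notin> U \<longrightarrow> q x = 0)}"
  define P where "P = (\<lambda>a b :: 'a \<Rightarrow> real. \<forall>x\<in>U. b x \<le> a x)"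
  let ?p0 = "\<lambda>x. if x \<in> U then p x else 0"
  have p0: "?p0 \<in> \<A>" using p by (auto simp: \<A>_def sublinear_on_def)
  have "\<exists>m\<in>\<A>. \<forall>a\<in>\<A>. P m a \<longrightarrow> a = m"
  proof (rule predicate_Zorn)
    show "partial_order_on \<A> (relation_of P \<A>)"
    proof (rule partial_order_on_relation_ofI)
      show "a = b" if "a \<in> \<A>" "b \<in> \<A>" "P a b" "P b a" for a b
      proof
        show "a x = b x" for x using that by (cases "x \<in> U") (auto simp: P_def \<A>_def intro!: antisym)
      qed
    qed (auto simp: P_def intro: order_trans)
    show "\<exists>u\<in>\<A>. \<forall>a\<in>C. P a u" if C: "C \<in> Chains (relation_of P \<A>)" for C
    proof (cases "C = {}")
      case True then show ?thesis using p0 by auto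
    next
      case False
      have CA: "q \<in> \<A>" if "q \<in> C" for q using C that by (auto simp: Chains_def relation_of_def)
      have tot: "P a b \<or> P b a" if "a \<in> C" "b \<in> C" for a b
        using C that by (auto simp: Chains_def relation_of_def)
      define u where "u x = (if x \<in> U then (INF q\<in>C. q x) else 0)" for x
      have lb: "- p (- x) \<le> q x" if "q \<in> C" "x \<in> U" for q x
      proof -
        have q: "sublinear_on U q" and "q (- x) \<le> p (- x)"
          using CA[OF that(1)] D(4)[OF that(2)] by (auto simp: \<A>_def)
        with sublinear_onD(7)[OF q that(2)] show ?thesis by linarith
      qed
      have le: "u x \<le> q x" if "q \<in> C" "x \<in> U" for q x
        unfolding u_def using that lb[OF _ that(2)] by (auto intro!: cINF_lower bdd_belowI2)
      have gr: "l \<le> u x" if "\<And>q. q \<in> C \<Longrightarrow> l \<le> q x" "x \<in> U" for l x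
        unfolding u_def using that False by (auto intro!: cINF_greatest)
      \<comment> \<open>An infimum of subadditive functions need not be subadditive. In a chain, the
        smaller of two members lies below each of them at both points, so one subadditive function
        serves \<open>x\<close> and \<open>y\<close>.\<close>
      have sub: "u (x + y) \<le> u x + u y" if x: "x \<in> U" and y: "y \<in> U" for x y
      proof -
        have "u (x + y) \<le> a x + b y" if ab: "a \<in> C" "b \<in> C" for a b
        proof -
          obtain q where q: "q \<in> C" "q x \<le> a x" "q y \<le> b y"
            using tot[OF ab] ab x y unfolding P_def by blast
          have "sublinear_on U q" using CA[OF q(1)] by (auto simp: \<A>_def)
          then have "q (x + y) \<le> q x + q y" using sublinear_onD(3) x y by blast
          with le[OF q(1) D(2)[OF x y]] q show ?thesis by linarith
        qed
        then have "u (x + y) - b y \<le> u x" if "b \<in> C" for b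
          using that by (intro gr[OF _ x]) (auto simp: algebra_simps)
        then have "u (x + y) - u x \<le> u y"
          by (intro gr[OF _ y]) (auto simp: algebra_simps)
        then show ?thesis by simp
      qed
      have dbl: "u (x + x) = 2 * u x" if x: "x \<in> U" for x
      proof -
        have "2 * u x \<le> u (x + x)"
        proof (rule gr[OF _ D(2)[OF x x]])
          fix q assume q: "q \<in> C"
          have "sublinear_on U q" using CA[OF q] by (auto simp: \<A>_def)
          then have "q (x + x) = 2 * q x" using sublinear_onD(5) x by blast
          with le[OF q x] show "2 * u x \<le> q (x + x)" by simp
        qed
        with sub[OF x x] show ?thesis by simp
      qed
      have "sublinear_on U u" unfolding sublinear_on_def using D(1,2,4) sub dbl by auto
      moreover have "u x \<le> p x" if "x \<in> U" for x
      proof -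
        obtain q where q: "q \<in> C" using False by auto
        then have "q x \<le> p x" using CA[OF q] that by (auto simp: \<A>_def)
        with le[OF q that] show ?thesis by simp
      qed
      ultimately have "u \<in> \<A>" by (auto simp: \<A>_def u_def)
      then show ?thesis using le by (auto simp: P_def)
    qed
  qed
  then obtain m where m: "m \<in> \<A>" and min: "\<And>a. a \<in> \<A> \<Longrightarrow> P m a \<Longrightarrow> a = m" by auto
  have ms: "sublinear_on U m" using m by (simp add: \<A>_def)
  have neg: "m (- y) \<le> - m y" if y: "y \<in> U" for y
  proof -
    obtain p' where p': "sublinear_on U p'" "\<And>x. x \<in> U \<Longrightarrow> p' x \<le> m x" "p' (- y) \<le> - m y"
      using sublinear_descend[OF ms y] by blast
    let ?q = "\<lambda>x. if x \<in> U then p' x else 0"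
    have "sublinear_on U ?q" using p'(1) by (auto simp: sublinear_on_def)
    moreover have "p' x \<le> p x" if "x \<in> U" for x using p'(2)[OF that] m that by (force simp: \<A>_def)
    ultimately have "?q \<in> \<A>" by (auto simp: \<A>_def)
    moreover have "P m ?q" using p'(2) by (auto simp: P_def)
    ultimately have "?q = m" using min by blast
    then have "m (- y) = p' (- y)" using fun_cong[of ?q m "- y"] D(4)[OF y] by simp
    then show ?thesis using p'(3) by simp
  qed
  show ?thesis
  proof
    show "m x \<le> p x" if "x \<in> U" for x using m that by (auto simp: \<A>_def)
    show "additive_on U m" unfolding additive_on_def
    proof (intro ballI)
      fix x y assume x: "x \<in> U" and y: "y \<in> U"
      have "m x = m ((x + y) + - y)" by simp
      also have "\<dots> \<le> m (x + y) + m (- y)"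
        by (rule sublinear_onD(3)[OF ms D(2)[OF x y] D(4)[OF y]])
      finally have "m x \<le> m (x + y) - m y" using neg[OF y] by simp
      with sublinear_onD(3)[OF ms x y] show "m (x + y) = m x + m y" by simp
    qed
  qed
qed

lemma additive_onD:
  assumes "additive_on U g" "0 \<in> U" "\<And>x. x \<in> U \<Longrightarrow> - x \<in> U"
  shows "g 0 = 0" "\<And>x. x \<in> U \<Longrightarrow> g (- x) = - g x"
    "\<And>x y. x \<in> U \<Longrightarrow> y \<in> U \<Longrightarrow> g (x + y) = g x + g y"
    "\<And>x y. x \<in> U \<Longrightarrow> y \<in> U \<Longrightarrow> g (x - y) = g x - g y"
proof -
  show add: "\<And>x y. x \<in> U \<Longrightarrow> y \<in> U \<Longrightarrow> g (x + y) = g x + g y"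
    using assms unfolding additive_on_def by auto
  show 0: "g 0 = 0" using add[OF assms(2,2)] by simp
  show neg: "g (- x) = - g x" if "x \<in> U" for x
    using add[OF that assms(3)[OF that]] 0 by simp
  show "g (x - y) = g x - g y" if "x \<in> U" "y \<in> U" for x y
    using add[OF that(1) assms(3)[OF that(2)]] neg[OF that(2)] by simp
qed

text \<open>Lowering \<open>p\<close> at \<open>y\<close> beforehand forces every additive
  \<open>g\<close> below the result to satisfy \<open>g (- y) \<le> - p y\<close>, that is
  \<open>p y \<le> g y\<close>.\<close>

lemma additive_below_sublinear_touching:
  assumes p: "sublinear_on U p" and y: "y \<in> U"
  obtains g where "additive_on U g" "\<And>x. x \<in> U \<Longrightarrow> g x \<le> p x" "g y = p y"
proof -
  obtain p' where p': "sublinear_on U p'" "\<And>x. x \<in> U \<Longrightarrow> p' x \<le> p x" "p' (- y) \<le> - p y"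
    using sublinear_descend[OF p y] by blast
  obtain g where g: "additive_on U g" "\<And>x. x \<in> U \<Longrightarrow> g x \<le> p' x"
    using additive_below_sublinear[OF p'(1)] by blast
  have le: "g x \<le> p x" if "x \<in> U" for x using g(2)[OF that] p'(2)[OF that] by simp
  have "g (- y) = - g y"
    using additive_onD(2)[OF g(1) _ _ y] sublinear_onD(1,4)[OF p] by blast
  with g(2)[OF sublinear_onD(4)[OF p y]] p'(3) le[OF y] have "g y = p y" by simp
  with g(1) le show ?thesis using that by blast
qed

text \<open>The deviation \<open>h\<close> from linearity vanishes on the integers, so it is
  periodic and bounded, whereas \<open>h (n * t) = n * h t\<close> grows unless
  \<open>h t = 0\<close>. Oddness makes the one-sided bound two-sided.\<close>

lemma additive_bounded_real_linear:
  fixes f :: "real \<Rightarrow> real"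
  assumes add: "\<And>s t. f (s + t) = f s + f t" and bd: "\<And>t. f t \<le> K * \<bar>t\<bar>"
  shows "f t = t * f 1"
proof -
  have f0: "f 0 = 0" using add[of 0 0] by simp
  have neg: "f (- t) = - f t" for t using add[of t "- t"] f0 by simp
  define h where "h t = f t - t * f 1" for t
  have hadd: "h (s + t) = h s + h t" for s t using add by (simp add: h_def algebra_simps)
  have hneg: "h (- t) = - h t" for t using neg by (simp add: h_def)
  have hnat: "h (real n * t) = real n * h t" for n t
  proof (induction n)
    case 0 show ?case using f0 by (simp add: h_def)
  next
    case (Suc n) then show ?case using hadd[of t "real n * t"] by (simp add: algebra_simps)
  qed
  have hint: "h (of_int m) = 0" for m
  proof -
    have "h (real n) = 0" for n using hnat[of n 1] by (simp add: h_def)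
    then show ?thesis using hneg by (cases m rule: int_cases2) auto
  qed
  have bd': "\<bar>h s\<bar> \<le> \<bar>K\<bar> + \<bar>f 1\<bar>" if s: "0 \<le> s" "s \<le> 1" for s
  proof -
    have 1: "\<bar>f s\<bar> \<le> K * \<bar>s\<bar>" using bd[of s] bd[of "- s"] neg[of s] by simp
    have 2: "K * \<bar>s\<bar> \<le> \<bar>K\<bar> * 1" using s by (intro mult_mono) auto
    have 3: "\<bar>s * f 1\<bar> \<le> 1 * \<bar>f 1\<bar>" unfolding abs_mult using s by (intro mult_right_mono) auto
    show ?thesis using 1 2 3 unfolding h_def by linarith
  qed
  have "real n * \<bar>h t\<bar> \<le> \<bar>K\<bar> + \<bar>f 1\<bar>" for n
  proof -
    have "real n * h t = h (of_int \<lfloor>real n * t\<rfloor> + frac (real n * t))"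
      unfolding hnat[symmetric] frac_def by simp
    also have "\<dots> = h (frac (real n * t))" using hadd hint by simp
    finally have "\<bar>real n * h t\<bar> \<le> \<bar>K\<bar> + \<bar>f 1\<bar>"
      using bd'[of "frac (real n * t)"] frac_lt_1[of "real n * t"] by simp
    then show ?thesis by (simp add: abs_mult)
  qed
  then have "\<bar>h t\<bar> \<le> 0"
    by (metis abs_ge_zero linorder_not_less order_antisym_conv reals_Archimedean3)
  then show ?thesis by (simp add: h_def)
qed

section \<open>Seminormed groups and dual pairs\<close>

lemma sum_fun_apply: "(\<Sum>a\<in>A. h a) x = (\<Sum>a\<in>A. h a x :: 'b::ab_group_add)"
  by (induction A rule: infinite_finite_induct) auto

lemma additive_on_sum:
  assumes g: "additive_on U g" and U: "0 \<in> U" "\<And>x y. x \<in> U \<Longrightarrow> y \<in> U \<Longrightarrow> x + y \<in> U"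
    and h: "\<And>a. a \<in> A \<Longrightarrow> h a \<in> U"
  shows "(\<Sum>a\<in>A. h a) \<in> U \<and> g (\<Sum>a\<in>A. h a) = (\<Sum>a\<in>A. g (h a))"
proof -
  have "g 0 = 0" using g U(1) by (force simp: additive_on_def)
  with h show ?thesis
  proof (induction A rule: infinite_finite_induct)
    case (insert a A)
    then show ?case using U g by (auto simp: additive_on_def)
  qed (use U in auto)
qed

text \<open>All levels of the dual tower are subsets of one type, which is why spaces are carriers
  with an explicit real scaling here.\<close>

locale nspace =
  fixes V :: "'v::ab_group_add set" and sc :: "real \<Rightarrow> 'v \<Rightarrow> 'v" and N :: "'v \<Rightarrow> real"
  assumes zero_in: "0 \<in> V"
    and add_in: "x \<in> V \<Longrightarrow> y \<in> V \<Longrightarrow> x + y \<in> V"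
    and sc_in: "x \<in> V \<Longrightarrow> sc c x \<in> V"
    and sc_add: "x \<in> V \<Longrightarrow> sc (a + b) x = sc a x + sc b x"
    and sc_one: "x \<in> V \<Longrightarrow> sc 1 x = x"
    and N_sc: "x \<in> V \<Longrightarrow> N (sc c x) = \<bar>c\<bar> * N x"
    and N_add: "x \<in> V \<Longrightarrow> y \<in> V \<Longrightarrow> N (x + y) \<le> N x + N y"
begin

lemma sc_zero: "x \<in> V \<Longrightarrow> sc 0 x = 0"
  using sc_add[of x 0 0] by simp

lemma sc_minus_one: "x \<in> V \<Longrightarrow> sc (- 1) x = - x"
  using sc_add[of x 1 "- 1"] by (simp add: sc_zero sc_one add_eq_0_iff)

lemma minus_in: "x \<in> V \<Longrightarrow> - x \<in> V"
  using sc_in[of x "- 1"] by (simp add: sc_minus_one)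

lemma diff_in: "x \<in> V \<Longrightarrow> y \<in> V \<Longrightarrow> x - y \<in> V"
  using add_in[of x "- y"] minus_in by simp

lemma sum_in: "(\<And>a. a \<in> A \<Longrightarrow> h a \<in> V) \<Longrightarrow> (\<Sum>a\<in>A. h a) \<in> V"
  by (induction A rule: infinite_finite_induct) (auto intro: zero_in add_in)

lemma half: "x \<in> V \<Longrightarrow> sc (1/2) x + sc (1/2) x = x"
  using sc_add[of x "1/2" "1/2"] by (simp add: sc_one)

lemma N_zero: "N 0 = 0"
  using N_sc[OF zero_in, of 0] sc_zero[OF zero_in] by simp

lemma N_minus: "x \<in> V \<Longrightarrow> N (- x) = N x"
  using N_sc[of x "- 1"] by (simp add: sc_minus_one)

lemma N_diff: "x \<in> V \<Longrightarrow> y \<in> V \<Longrightarrow> N (x - y) \<le> N x + N y"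
  using N_add[of x "- y"] minus_in N_minus by simp

lemma N_nonneg: "x \<in> V \<Longrightarrow> 0 \<le> N x"
  using N_diff[of x x] N_zero by simp

lemma N_double: "x \<in> V \<Longrightarrow> N (x + x) = 2 * N x"
  using N_sc[of x 2] sc_add[of x 1 1] by (simp add: sc_one)

lemma additiveD:
  assumes "additive_on V g"
  shows "g 0 = 0" "\<And>x. x \<in> V \<Longrightarrow> g (- x) = - g x"
    "\<And>x y. x \<in> V \<Longrightarrow> y \<in> V \<Longrightarrow> g (x + y) = g x + g y"
    "\<And>x y. x \<in> V \<Longrightarrow> y \<in> V \<Longrightarrow> g (x - y) = g x - g y"
    "\<And>h A. (\<And>a. a \<in> A \<Longrightarrow> h a \<in> V) \<Longrightarrow> g (\<Sum>a\<in>A. h a) = (\<Sum>a\<in>A. g (h a))"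
  using additive_onD[OF assms zero_in minus_in] additive_on_sum[OF assms zero_in add_in] by blast+

text \<open>Banach--Alaoglu in the form of a finite intersection property, obtained as a
  Mazur--Orlicz theorem: the functional is found below the infimum of the upper bounds that
  the constraints impose.\<close>

lemma finite_intersection:
  fixes T :: "'g \<Rightarrow> 'v \<Rightarrow> 'v" and \<beta> :: "'g \<Rightarrow> 'v \<Rightarrow> real" and e :: "'g \<Rightarrow> real"
  assumes T: "\<And>g x. g \<in> G \<Longrightarrow> x \<in> V \<Longrightarrow> T g x \<in> V"
    and T_add: "\<And>g x y. g \<in> G \<Longrightarrow> x \<in> V \<Longrightarrow> y \<in> V \<Longrightarrow> T g (x + y) = T g x + T g y"
    and \<beta>: "\<And>g. g \<in> G \<Longrightarrow> additive_on V (\<beta> g)"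
    and e: "\<And>g. g \<in> G \<Longrightarrow> 0 \<le> e g" and R: "0 \<le> R"
    and fin: "\<And>F \<phi> \<epsilon>. finite F \<Longrightarrow> F \<subseteq> G \<Longrightarrow> (\<And>g. \<phi> g \<in> V) \<Longrightarrow> 0 < \<epsilon> \<Longrightarrow>
        \<exists>l. additive_on V l \<and> (\<forall>x\<in>V. l x \<le> R * N x) \<and>
          (\<forall>g\<in>F. l (T g (\<phi> g)) + \<beta> g (\<phi> g) \<le> e g * N (\<phi> g) + \<epsilon>)"
  obtains l where "additive_on V l" "\<And>x. x \<in> V \<Longrightarrow> l x \<le> R * N x"
    "\<And>g x. g \<in> G \<Longrightarrow> x \<in> V \<Longrightarrow> l (T g x) + \<beta> g x \<le> e g * N x"
proof -
  define ok where "ok F \<phi> \<longleftrightarrow> finite F \<and> F \<subseteq> G \<and> (\<forall>g. \<phi> g \<in> V) \<and> (\<forall>g. g \<notin> F \<longrightarrow> \<phi> g = 0)"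
    for F and \<phi> :: "'g \<Rightarrow> 'v"
  \<comment> \<open>\<open>val F \<phi> x\<close> is the bound on \<open>l x\<close> that results
    from \<open>x = (x - s) + s\<close>, with \<open>s\<close> the sum of the
    \<open>T g (\<phi> g)\<close>: the norm bound is applied to the first summand and the
    constraints, each tested at the single vector \<open>\<phi> g\<close>, to the second.\<close>
  define val where "val F \<phi> x = R * N (x - (\<Sum>g\<in>F. T g (\<phi> g)))
      + (\<Sum>g\<in>F. e g * N (\<phi> g) - \<beta> g (\<phi> g))" for F \<phi> x
  define S where "S x = {val F \<phi> x | F \<phi>. ok F \<phi>}" for x
  define p where "p x = Inf (S x)" for x
  have T0: "T g 0 = 0" if "g \<in> G" for g using T_add[OF that zero_in zero_in] by simp
  \<comment> \<open>This allows families with different supports to be added over the union of their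
    index sets.\<close>
  have ext: "val F' \<phi> x = val F \<phi> x" if "ok F \<phi>" "F \<subseteq> F'" "finite F'" "F' \<subseteq> G" for F F' \<phi> x
  proof -
    have z: "\<phi> g = 0" "T g (\<phi> g) = 0" "\<beta> g (\<phi> g) = 0" if "g \<in> F' - F" for g
      using that \<open>ok F \<phi>\<close> \<open>F' \<subseteq> G\<close> T0 additiveD(1)[OF \<beta>] by (auto simp: ok_def)
    have "(\<Sum>g\<in>F. T g (\<phi> g)) = (\<Sum>g\<in>F'. T g (\<phi> g))"
      using that z by (intro sum.mono_neutral_left) auto
    moreover have "(\<Sum>g\<in>F. e g * N (\<phi> g) - \<beta> g (\<phi> g)) = (\<Sum>g\<in>F'. e g * N (\<phi> g) - \<beta> g (\<phi> g))"
      using that z by (intro sum.mono_neutral_left) (auto simp: N_zero)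
    ultimately show ?thesis by (simp add: val_def)
  qed
  have sumT: "(\<Sum>g\<in>F. T g (\<phi> g)) \<in> V" if "ok F \<phi>" for F \<phi>
    using that T by (intro sum_in) (auto simp: ok_def)
  \<comment> \<open>A functional that meets the constraints at the given \<open>\<phi> g\<close> up
    to \<open>\<epsilon>\<close> shows that the bound cannot fall below \<open>- R * N x\<close>; so
    the infimum \<open>p\<close> is finite.\<close>
  have lb: "- R * N x \<le> val F \<phi> x" if ok: "ok F \<phi>" and x: "x \<in> V" for F \<phi> x
  proof (rule field_le_epsilon)
    fix \<delta> :: real assume \<delta>: "0 < \<delta>"
    define \<epsilon> where "\<epsilon> = \<delta> / (1 + card F)"
    have \<epsilon>: "0 < \<epsilon>" using \<delta> by (simp add: \<epsilon>_def)
    obtain l where l: "additive_on V l" "\<And>x. x \<in> V \<Longrightarrow> l x \<le> R * N x"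
      "\<And>g. g \<in> F \<Longrightarrow> l (T g (\<phi> g)) + \<beta> g (\<phi> g) \<le> e g * N (\<phi> g) + \<epsilon>"
      using fin[of F \<phi> \<epsilon>] ok \<epsilon> unfolding ok_def by blast
    note lD = additiveD[OF l(1)]
    have "- R * N x \<le> l x" using l(2)[OF minus_in[OF x]] lD(2)[OF x] N_minus[OF x] by simp
    also have "l x = l (x - (\<Sum>g\<in>F. T g (\<phi> g))) + (\<Sum>g\<in>F. l (T g (\<phi> g)))"
    proof -
      have "l (\<Sum>g\<in>F. T g (\<phi> g)) = (\<Sum>g\<in>F. l (T g (\<phi> g)))"
        using ok T by (intro lD(5)) (auto simp: ok_def)
      then show ?thesis using lD(4)[OF x sumT[OF ok]] by simp
    qed
    also have "\<dots> \<le> R * N (x - (\<Sum>g\<in>F. T g (\<phi> g)))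
        + (\<Sum>g\<in>F. e g * N (\<phi> g) - \<beta> g (\<phi> g) + \<epsilon>)"
      using l(3) by (intro add_mono l(2) diff_in x sumT ok sum_mono) (auto simp: algebra_simps)
    also have "\<dots> = val F \<phi> x + card F * \<epsilon>"
      by (simp add: val_def sum.distrib)
    also have "card F * \<epsilon> \<le> \<delta>" using \<delta> by (simp add: \<epsilon>_def field_simps)
    finally show "- R * N x \<le> val F \<phi> x + \<delta>" by simp
  qed
  have ok0: "ok {} (\<lambda>_. 0)" by (simp add: ok_def zero_in)
  have ne: "S x \<noteq> {}" for x using ok0 by (auto simp: S_def)
  have le: "p x \<le> val F \<phi> x" if "ok F \<phi>" "x \<in> V" for F \<phi> x
    unfolding p_def using that lb[OF _ that(2)]
    by (intro cInf_lower) (auto simp: S_def intro!: bdd_belowI[of _ "- R * N x"])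
  have ge: "c \<le> p x" if "\<And>F \<phi>. ok F \<phi> \<Longrightarrow> c \<le> val F \<phi> x" for c x
    unfolding p_def by (rule cInf_greatest[OF ne]) (auto simp: S_def that)
  have sub: "p (x + y) \<le> p x + p y" if x: "x \<in> V" and y: "y \<in> V" for x y
  proof -
    have "p (x + y) \<le> val F1 \<phi>1 x + val F2 \<phi>2 y" if ok1: "ok F1 \<phi>1" and ok2: "ok F2 \<phi>2" for F1 F2 \<phi>1 \<phi>2
    proof -
      let ?F = "F1 \<union> F2" and ?\<phi> = "\<lambda>g. \<phi>1 g + \<phi>2 g"
      have F: "finite ?F" "?F \<subseteq> G" using ok1 ok2 by (auto simp: ok_def)
      have in': "\<phi>1 g \<in> V" "\<phi>2 g \<in> V" for g using ok1 ok2 by (auto simp: ok_def)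
      have ok: "ok ?F ?\<phi>" using ok1 ok2 by (auto simp: ok_def intro: add_in)
      have ok': "ok ?F \<phi>1" "ok ?F \<phi>2" using ok1 ok2 by (auto simp: ok_def)
      have s1: "(\<Sum>g\<in>?F. T g (?\<phi> g)) = (\<Sum>g\<in>?F. T g (\<phi>1 g)) + (\<Sum>g\<in>?F. T g (\<phi>2 g))"
        using T_add in' F by (subst sum.distrib[symmetric]) (auto intro!: sum.cong)
      have s2: "(\<Sum>g\<in>?F. e g * N (?\<phi> g) - \<beta> g (?\<phi> g)) \<le>
          (\<Sum>g\<in>?F. e g * N (\<phi>1 g) - \<beta> g (\<phi>1 g)) + (\<Sum>g\<in>?F. e g * N (\<phi>2 g) - \<beta> g (\<phi>2 g))"
      proof (subst sum.distrib[symmetric], intro sum_mono)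
        fix g assume "g \<in> ?F"
        then have g: "g \<in> G" using F by auto
        have "e g * N (?\<phi> g) \<le> e g * (N (\<phi>1 g) + N (\<phi>2 g))"
          using e[OF g] N_add in' by (intro mult_left_mono) auto
        then show "e g * N (?\<phi> g) - \<beta> g (?\<phi> g) \<le>
            e g * N (\<phi>1 g) - \<beta> g (\<phi>1 g) + (e g * N (\<phi>2 g) - \<beta> g (\<phi>2 g))"
          using additiveD(3)[OF \<beta>[OF g] in'] by (simp add: algebra_simps)
      qed
      have "N (x + y - (\<Sum>g\<in>?F. T g (?\<phi> g))) \<le>
          N (x - (\<Sum>g\<in>?F. T g (\<phi>1 g))) + N (y - (\<Sum>g\<in>?F. T g (\<phi>2 g)))"
        using N_add[OF diff_in[OF x sumT[OF ok'(1)]] diff_in[OF y sumT[OF ok'(2)]]]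
        unfolding s1 by (simp add: algebra_simps)
      from mult_left_mono[OF this R] s2
      have "val ?F ?\<phi> (x + y) \<le> val ?F \<phi>1 x + val ?F \<phi>2 y"
        by (simp add: val_def algebra_simps)
      also have "val ?F \<phi>1 x = val F1 \<phi>1 x" using ext[OF ok1 _ F] by simp
      also have "val ?F \<phi>2 y = val F2 \<phi>2 y" using ext[OF ok2 _ F] by simp
      finally show ?thesis using le[OF ok add_in[OF x y]] by linarith
    qed
    then have "p (x + y) - val F2 \<phi>2 y \<le> p x" if "ok F2 \<phi>2" for F2 \<phi>2
      using that by (intro ge) (auto simp: algebra_simps)
    then have "p (x + y) - p x \<le> p y"
      by (intro ge) (auto simp: algebra_simps)
    then show ?thesis by simp
  qed
  have dbl: "p (x + x) = 2 * p x" if x: "x \<in> V" for x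
  proof -
    have "2 * p x \<le> p (x + x)"
    proof (rule ge)
      fix F \<phi> assume ok: "ok F \<phi>"
      let ?\<phi> = "\<lambda>g. if g \<in> F then sc (1/2) (\<phi> g) else 0"
      have ok': "ok F ?\<phi>" using ok by (auto simp: ok_def sc_in zero_in)
      have G: "g \<in> G" "\<phi> g \<in> V" "sc (1/2) (\<phi> g) \<in> V" if "g \<in> F" for g
        using ok that by (auto simp: ok_def sc_in)
      have s1: "(\<Sum>g\<in>F. T g (\<phi> g)) = (\<Sum>g\<in>F. T g (?\<phi> g)) + (\<Sum>g\<in>F. T g (?\<phi> g))"
        unfolding sum.distrib[symmetric]
      proof (rule sum.cong[OF refl])
        fix g assume g: "g \<in> F"
        show "T g (\<phi> g) = T g (?\<phi> g) + T g (?\<phi> g)"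
          using T_add[OF G(1)[OF g] G(3)[OF g] G(3)[OF g]] half[OF G(2)[OF g]] g by simp
      qed
      have s2: "(\<Sum>g\<in>F. e g * N (\<phi> g) - \<beta> g (\<phi> g)) = 2 * (\<Sum>g\<in>F. e g * N (?\<phi> g) - \<beta> g (?\<phi> g))"
        unfolding sum_distrib_left
      proof (rule sum.cong[OF refl])
        fix g assume g: "g \<in> F"
        show "e g * N (\<phi> g) - \<beta> g (\<phi> g) = 2 * (e g * N (?\<phi> g) - \<beta> g (?\<phi> g))"
          using additiveD(3)[OF \<beta>[OF G(1)[OF g]] G(3)[OF g] G(3)[OF g]] half[OF G(2)[OF g]]
            N_double[OF G(3)[OF g]] g by (simp add: algebra_simps)
      qed
      let ?s = "(\<Sum>g\<in>F. T g (?\<phi> g))"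
      have eq: "x + x - (?s + ?s) = (x - ?s) + (x - ?s)" by (simp only: algebra_simps)
      have NN: "N (x + x - (\<Sum>g\<in>F. T g (\<phi> g))) = 2 * N (x - ?s)"
        unfolding s1 eq by (rule N_double[OF diff_in[OF x sumT[OF ok']]])
      have "val F \<phi> (x + x) = 2 * val F ?\<phi> x"
        unfolding val_def s2 NN by (simp only: distrib_left mult.left_commute)
      then show "2 * p x \<le> val F \<phi> (x + x)" using le[OF ok' x] by simp
    qed
    with sub[OF x x] show ?thesis by simp
  qed
  have "sublinear_on V p"
    unfolding sublinear_on_def using zero_in add_in minus_in sub dbl by auto
  then obtain l where l: "additive_on V l" "\<And>x. x \<in> V \<Longrightarrow> l x \<le> p x"
    using additive_below_sublinear by blast
  show ?thesis
  proof
    show "additive_on V l" by fact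
    show "l x \<le> R * N x" if x: "x \<in> V" for x
      using le[OF ok0 x] l(2)[OF x] by (simp add: val_def)
    show "l (T g x) + \<beta> g x \<le> e g * N x" if g: "g \<in> G" and x: "x \<in> V" for g x
    proof -
      \<comment> \<open>With this test vector the norm term of \<open>val\<close> at
        \<open>T g x\<close> is \<open>N 0\<close>, and only the constraint remains.\<close>
      let ?\<phi> = "\<lambda>h. if h = g then x else 0"
      have "ok {g} ?\<phi>" using g x by (auto simp: ok_def zero_in)
      from le[OF this T[OF g x]] l(2)[OF T[OF g x]] show ?thesis
        by (simp add: val_def N_zero)
    qed
  qed
qed

end

text \<open>Real duality, with \<open>W\<close> the whole dual of \<open>V\<close> and
  \<open>M\<close> the dual norm. Bounds are one-sided because \<open>x\<close> may be replaced by
  \<open>- x\<close>; in \<open>represent\<close>, additivity together with such a bound already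
  entails real linearity.\<close>

locale dual_pair = Z: nspace V sc N + W: nspace W sc M
  for V :: "'v::ab_group_add set" and sc and N and W :: "'v set" and M +
  fixes pr :: "'v \<Rightarrow> 'v \<Rightarrow> real"
  assumes pr_add_left: "\<phi> \<in> W \<Longrightarrow> \<psi> \<in> W \<Longrightarrow> x \<in> V \<Longrightarrow> pr (\<phi> + \<psi>) x = pr \<phi> x + pr \<psi> x"
    and pr_add_right: "\<phi> \<in> W \<Longrightarrow> x \<in> V \<Longrightarrow> y \<in> V \<Longrightarrow> pr \<phi> (x + y) = pr \<phi> x + pr \<phi> y"
    and pr_sc_left: "\<phi> \<in> W \<Longrightarrow> x \<in> V \<Longrightarrow> pr (sc c \<phi>) x = c * pr \<phi> x"
    and pr_sc_right: "\<phi> \<in> W \<Longrightarrow> x \<in> V \<Longrightarrow> pr \<phi> (sc c x) = c * pr \<phi> x"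
    and pr_le: "\<phi> \<in> W \<Longrightarrow> x \<in> V \<Longrightarrow> pr \<phi> x \<le> M \<phi> * N x"
    and norm_least: "\<phi> \<in> W \<Longrightarrow> 0 \<le> C \<Longrightarrow> (\<And>x. x \<in> V \<Longrightarrow> pr \<phi> x \<le> C * N x) \<Longrightarrow> M \<phi> \<le> C"
    and represent: "additive_on V l \<Longrightarrow> (\<And>x. x \<in> V \<Longrightarrow> l x \<le> C * N x) \<Longrightarrow> \<exists>\<phi>\<in>W. \<forall>x\<in>V. pr \<phi> x = l x"
    and pr_ext: "\<phi> \<in> W \<Longrightarrow> \<psi> \<in> W \<Longrightarrow> (\<And>x. x \<in> V \<Longrightarrow> pr \<phi> x = pr \<psi> x) \<Longrightarrow> \<phi> = \<psi>"
begin

lemma additive_right: "\<phi> \<in> W \<Longrightarrow> additive_on V (pr \<phi>)"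
  by (simp add: additive_on_def pr_add_right)

lemma additive_left: "x \<in> V \<Longrightarrow> additive_on W (\<lambda>\<phi>. pr \<phi> x)"
  by (simp add: additive_on_def pr_add_left)

text \<open>The gap between \<open>c\<close> and \<open>b\<close> makes up for norms that are not
  attained: unless it is zero, \<open>c / b * M \<phi>\<close> lies strictly below
  \<open>M \<phi>\<close>, so by \<open>norm_least\<close> some vector exceeds it, and scaling
  brings its norm to \<open>b\<close>.\<close>

lemma almost_norming:
  assumes \<phi>: "\<phi> \<in> W" and c: "0 \<le> c" "c < b"
  obtains x where "x \<in> V" "N x \<le> b" "c * M \<phi> \<le> pr \<phi> x"
proof (cases "c * M \<phi> = 0")
  case True
  then show ?thesis using that[of 0] Z.zero_in Z.N_zero Z.additiveD(1)[OF additive_right[OF \<phi>]] c True by simp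
next
  case False
  then have M: "0 < M \<phi>" using W.N_nonneg[OF \<phi>] by (cases "M \<phi> = 0") auto
  have b: "0 < b" using c by simp
  have "c / b * M \<phi> < 1 * M \<phi>" using c M by (intro mult_strict_right_mono) (auto simp: field_simps)
  then have "\<not> M \<phi> \<le> c / b * M \<phi>" by simp
  then obtain x where x: "x \<in> V" "c / b * M \<phi> * N x < pr \<phi> x"
    using norm_least[OF \<phi>, of "c / b * M \<phi>"] c M b
    by (meson divide_nonneg_pos less_eq_real_def mult_nonneg_nonneg not_le)
  have Nx: "0 < N x"
  proof (rule ccontr)
    assume "\<not> ?thesis"
    then have "N x = 0" using Z.N_nonneg[OF x(1)] by simp
    with pr_le[OF \<phi> x(1)] x(2) show False by simp
  qed
  show ?thesis
  proof (rule that)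
    show "sc (b / N x) x \<in> V" using x by (simp add: Z.sc_in)
    show "N (sc (b / N x) x) \<le> b" using Z.N_sc[OF x(1)] Nx b by simp
    have "c * M \<phi> = b / N x * (c / b * M \<phi> * N x)" using Nx b by (simp add: field_simps)
    also have "\<dots> \<le> b / N x * pr \<phi> x" using x(2) Nx b by (intro mult_left_mono) auto
    finally show "c * M \<phi> \<le> pr \<phi> (sc (b / N x) x)" using pr_sc_right[OF \<phi> x(1)] by simp
  qed
qed

lemma norm_eq_0D:
  assumes \<phi>: "\<phi> \<in> W" and "M \<phi> \<le> 0"
  shows "\<phi> = 0"
proof (rule pr_ext[OF \<phi> W.zero_in])
  have "M \<phi> = 0" using assms(2) W.N_nonneg[OF \<phi>] by simp
  then have le: "pr \<phi> x \<le> 0" if "x \<in> V" for x using pr_le[OF \<phi> that] by simp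
  fix x assume x: "x \<in> V"
  show "pr \<phi> x = pr 0 x"
    using le[OF x] le[OF Z.minus_in[OF x]] Z.additiveD(2)[OF additive_right[OF \<phi>] x]
      W.additiveD(1)[OF additive_left[OF x]] by simp
qed

end

section \<open>Approximation of tuples in the bidual\<close>

locale bidual_pair = P1: dual_pair V sc N W M pr + P2: dual_pair W sc M U K pr'
  for V :: "'v::ab_group_add set" and sc N W M pr U K pr'
begin

text \<open>If no such tuple existed, a functional separating the point from the range of the expressions
  would violate the bounds that hold in the bidual.\<close>

lemma Helly_tuple:
  fixes T :: "'m \<Rightarrow> 'i \<Rightarrow> 'v \<Rightarrow> 'v" and d :: "'m \<Rightarrow> real" and w :: "'i \<Rightarrow> 'v"
  assumes fin: "finite I" "finite Q" "finite J" and J: "\<And>i \<phi>. (i, \<phi>) \<in> J \<Longrightarrow> i \<in> I \<and> \<phi> \<in> W"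
    and w: "\<And>i. i \<in> I \<Longrightarrow> w i \<in> U"
    and T: "\<And>m i x. m \<in> Q \<Longrightarrow> i \<in> I \<Longrightarrow> x \<in> V \<Longrightarrow> T m i x \<in> V"
    and T_add: "\<And>m i x y. m \<in> Q \<Longrightarrow> i \<in> I \<Longrightarrow> x \<in> V \<Longrightarrow> y \<in> V \<Longrightarrow> T m i (x + y) = T m i x + T m i y"
    and T': "\<And>m i \<phi>. m \<in> Q \<Longrightarrow> i \<in> I \<Longrightarrow> \<phi> \<in> W \<Longrightarrow> T' m i \<phi> \<in> W"
    and adj: "\<And>m i \<phi> x. m \<in> Q \<Longrightarrow> i \<in> I \<Longrightarrow> \<phi> \<in> W \<Longrightarrow> x \<in> V \<Longrightarrow> pr \<phi> (T m i x) = pr (T' m i \<phi>) x"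
    and d: "\<And>m. m \<in> Q \<Longrightarrow> 0 \<le> d m"
    and bd: "\<And>m \<phi>. m \<in> Q \<Longrightarrow> \<phi> \<in> W \<Longrightarrow> (\<Sum>i\<in>I. pr' (w i) (T' m i \<phi>)) \<le> d m * M \<phi>"
    and \<epsilon>: "0 < \<epsilon>"
  obtains v where "\<And>i. v i \<in> V" "\<And>m. m \<in> Q \<Longrightarrow> N (\<Sum>i\<in>I. T m i (v i)) \<le> d m + \<epsilon>"
    "\<And>i \<phi>. (i, \<phi>) \<in> J \<Longrightarrow> \<bar>pr \<phi> (v i) - pr' (w i) \<phi>\<bar> \<le> \<epsilon>"
proof (rule ccontr)
  assume "\<not> thesis"
  with that have none: "\<not> (\<exists>v. (\<forall>i. v i \<in> V) \<and> (\<forall>m\<in>Q. N (\<Sum>i\<in>I. T m i (v i)) \<le> d m + \<epsilon>) \<and>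
      (\<forall>(i, \<phi>)\<in>J. \<bar>pr \<phi> (v i) - pr' (w i) \<phi>\<bar> \<le> \<epsilon>))"
    by blast
  note Z = P1.Z.zero_in P1.Z.add_in P1.Z.diff_in P1.Z.minus_in P1.Z.sc_in
  define L where "L v m = (if m \<in> Q then \<Sum>i\<in>I. T m i (v i) else 0)" for v m
  define f where "f v j = (if j \<in> J then pr (snd j) (v (fst j)) else 0)" for v j
  \<comment> \<open>A point of \<open>E\<close> prescribes values for the expressions indexed by
    \<open>Q\<close> and for the pairings indexed by \<open>J\<close>. The function \<open>p\<close>
    below is the gauge on \<open>E\<close>, modulo the range of \<open>(L, f)\<close>, of the box
    with half-widths \<open>d m + \<epsilon>\<close> and \<open>\<epsilon>\<close>.\<close>
  define E where "E = {e :: ('m \<Rightarrow> 'v) \<times> ('i \<times> 'v \<Rightarrow> real). (\<forall>m. fst e m \<in> V) \<and>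
      (\<forall>m. m \<notin> Q \<longrightarrow> fst e m = 0) \<and> (\<forall>j. j \<notin> J \<longrightarrow> snd e j = 0)}"
  define S where "S e = {r. 0 \<le> r \<and> (\<exists>v. (\<forall>i. v i \<in> V) \<and> (\<forall>m\<in>Q. N (fst e m - L v m) \<le> r * (d m + \<epsilon>)) \<and>
      (\<forall>j\<in>J. \<bar>snd e j - f v j\<bar> \<le> r * \<epsilon>))}" for e :: "('m \<Rightarrow> 'v) \<times> ('i \<times> 'v \<Rightarrow> real)"
  define p where "p e = Inf (S e)" for e
  have E_add: "x + y \<in> E" if "x \<in> E" "y \<in> E" for x y using that by (auto simp: E_def intro: Z)
  have E_minus: "- x \<in> E" if "x \<in> E" for x using that by (auto simp: E_def intro: Z)
  have E_zero: "0 \<in> E" by (auto simp: E_def intro: Z)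
  have T0: "T m i 0 = 0" if "m \<in> Q" "i \<in> I" for m i
    using T_add[OF that Z(1) Z(1)] by simp
  have pr0: "pr \<phi> 0 = 0" if "\<phi> \<in> W" for \<phi>
    using P1.Z.additiveD(1)[OF P1.additive_right[OF that]] .
  have L_in: "L v m \<in> V" if "\<And>i. v i \<in> V" for v m
    unfolding L_def using that T by (auto intro!: P1.Z.sum_in Z)
  have L_add: "L (\<lambda>i. v i + v' i) m = L v m + L v' m" if "\<And>i. v i \<in> V" "\<And>i. v' i \<in> V" for v v' m
    unfolding L_def using that T_add by (auto simp: sum.distrib[symmetric] intro!: sum.cong)
  have f_add: "f (\<lambda>i. v i + v' i) j = f v j + f v' j" if "\<And>i. v i \<in> V" "\<And>i. v' i \<in> V" for v v' j
    unfolding f_def using that J P1.pr_add_right by (cases j) auto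
  have L_zero: "L (\<lambda>_. 0) m = 0" for m unfolding L_def using T0 by auto
  have f_zero: "f (\<lambda>_. 0) j = 0" for j unfolding f_def using J pr0 by (cases j) auto
  have pos: "0 < d m + \<epsilon>" if "m \<in> Q" for m using d[OF that] \<epsilon> by simp
  have S_le: "p e \<le> r" if "r \<in> S e" for e r
    unfolding p_def using that by (intro cInf_lower) (auto simp: S_def intro!: bdd_belowI[of _ 0])
  have ne: "S e \<noteq> {}" if e: "e \<in> E" for e
  proof -
    define r where "r = (\<Sum>m\<in>Q. N (fst e m) / (d m + \<epsilon>)) + (\<Sum>j\<in>J. \<bar>snd e j\<bar> / \<epsilon>)"
    have nn: "0 \<le> N (fst e m)" for m using e by (auto simp: E_def intro: P1.Z.N_nonneg)
    have nn1: "0 \<le> (\<Sum>m\<in>Q. N (fst e m) / (d m + \<epsilon>))"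
      using nn pos by (intro sum_nonneg) (auto intro!: divide_nonneg_pos)
    have nn2: "0 \<le> (\<Sum>j\<in>J. \<bar>snd e j\<bar> / \<epsilon>)" using \<epsilon> by (intro sum_nonneg) auto
    have "N (fst e m) / (d m + \<epsilon>) \<le> r" if m: "m \<in> Q" for m
    proof -
      have "N (fst e m) / (d m + \<epsilon>) \<le> (\<Sum>m\<in>Q. N (fst e m) / (d m + \<epsilon>))"
        by (rule member_le_sum[OF m _ fin(2)]) (use nn pos in \<open>auto intro!: divide_nonneg_pos\<close>)
      then show ?thesis using nn2 by (simp add: r_def)
    qed
    then have 1: "N (fst e m) \<le> r * (d m + \<epsilon>)" if "m \<in> Q" for m
      using that pos_divide_le_eq[OF pos[OF that]] by blast
    have "\<bar>snd e j\<bar> / \<epsilon> \<le> r" if j: "j \<in> J" for j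
    proof -
      have "\<bar>snd e j\<bar> / \<epsilon> \<le> (\<Sum>j\<in>J. \<bar>snd e j\<bar> / \<epsilon>)"
        by (rule member_le_sum[OF j _ fin(3)]) (use \<epsilon> in auto)
      then show ?thesis using nn1 by (simp add: r_def)
    qed
    then have 2: "\<bar>snd e j\<bar> \<le> r * \<epsilon>" if "j \<in> J" for j
      using that \<epsilon> by (simp add: field_simps)
    have "r \<in> S e" unfolding S_def
      using 1 2 nn1 nn2 Z(1) by (auto intro!: exI[of _ "\<lambda>_. 0"] simp: L_zero f_zero r_def)
    then show ?thesis by auto
  qed
  have ge: "c \<le> p e" if "e \<in> E" "\<And>r. r \<in> S e \<Longrightarrow> c \<le> r" for c e
    unfolding p_def using that ne by (intro cInf_greatest) auto
  have sub: "p (x + y) \<le> p x + p y" if x: "x \<in> E" and y: "y \<in> E" for x y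
  proof -
    have "p (x + y) \<le> r + s" if r: "r \<in> S x" and s: "s \<in> S y" for r s
    proof (rule S_le)
      obtain v where v: "\<And>i. v i \<in> V" "\<And>m. m \<in> Q \<Longrightarrow> N (fst x m - L v m) \<le> r * (d m + \<epsilon>)"
        "\<And>j. j \<in> J \<Longrightarrow> \<bar>snd x j - f v j\<bar> \<le> r * \<epsilon>" using r by (auto simp: S_def)
      obtain v' where v': "\<And>i. v' i \<in> V" "\<And>m. m \<in> Q \<Longrightarrow> N (fst y m - L v' m) \<le> s * (d m + \<epsilon>)"
        "\<And>j. j \<in> J \<Longrightarrow> \<bar>snd y j - f v' j\<bar> \<le> s * \<epsilon>" using s by (auto simp: S_def)
      have "N (fst (x + y) m - L (\<lambda>i. v i + v' i) m) \<le> (r + s) * (d m + \<epsilon>)" if m: "m \<in> Q" for m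
      proof -
        have "fst x m - L v m \<in> V" "fst y m - L v' m \<in> V"
          using x y v(1) v'(1) by (auto simp: E_def intro!: Z L_in)
        from P1.Z.N_add[OF this] v(2)[OF m] v'(2)[OF m] show ?thesis
          unfolding L_add[of v v', OF v(1) v'(1)] by (simp add: algebra_simps)
      qed
      moreover have "\<bar>snd (x + y) j - f (\<lambda>i. v i + v' i) j\<bar> \<le> (r + s) * \<epsilon>" if j: "j \<in> J" for j
        using v(3)[OF j] v'(3)[OF j] unfolding f_add[of v v', OF v(1) v'(1)] by (simp add: algebra_simps)
      ultimately show "r + s \<in> S (x + y)"
        using r s v(1) v'(1) by (auto simp: S_def intro!: exI[of _ "\<lambda>i. v i + v' i"] Z)
    qed
    then have "p (x + y) - s \<le> p x" if "s \<in> S y" for s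
      using that by (intro ge x) (auto simp: algebra_simps)
    then have "p (x + y) - p x \<le> p y" by (intro ge y) (auto simp: algebra_simps)
    then show ?thesis by simp
  qed
  have dbl: "p (x + x) = 2 * p x" if x: "x \<in> E" for x
  proof -
    have "2 * p x \<le> p (x + x)"
    proof (rule ge[OF E_add[OF x x]])
      fix r assume "r \<in> S (x + x)"
      then obtain v where r: "0 \<le> r" and v: "\<And>i. v i \<in> V"
        "\<And>m. m \<in> Q \<Longrightarrow> N (fst (x + x) m - L v m) \<le> r * (d m + \<epsilon>)"
        "\<And>j. j \<in> J \<Longrightarrow> \<bar>snd (x + x) j - f v j\<bar> \<le> r * \<epsilon>" by (auto simp: S_def)
      define h where "h i = sc (1/2) (v i)" for i
      have h: "h i \<in> V" for i using v by (simp add: h_def Z)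
      have hh: "(\<lambda>i. h i + h i) = v" using v by (simp add: h_def P1.Z.half)
      have "N (fst x m - L h m) \<le> r / 2 * (d m + \<epsilon>)" if m: "m \<in> Q" for m
      proof -
        have inV: "fst x m - L h m \<in> V" using x h by (auto simp: E_def intro!: Z L_in)
        have eq: "fst (x + x) m - L v m = (fst x m - L h m) + (fst x m - L h m)"
          using L_add[of h h, OF h h] unfolding hh by (simp add: algebra_simps)
        show ?thesis using v(2)[OF m] P1.Z.N_double[OF inV] unfolding eq by simp
      qed
      moreover have "\<bar>snd x j - f h j\<bar> \<le> r / 2 * \<epsilon>" if j: "j \<in> J" for j
      proof -
        have "snd (x + x) j - f v j = 2 * (snd x j - f h j)"
          using f_add[of h h, OF h h, of j] unfolding hh by simp
        then show ?thesis using v(3)[OF j] by (simp only: abs_mult) simp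
      qed
      ultimately have "r / 2 \<in> S x" using r h by (auto simp: S_def intro!: exI[of _ h])
      from S_le[OF this] show "2 * p x \<le> r" by simp
    qed
    with sub[OF x x] show ?thesis by simp
  qed
  have psub: "sublinear_on E p"
    unfolding sublinear_on_def using E_zero E_add E_minus sub dbl by auto
  \<comment> \<open>Expressions zero, pairings as in the bidual: a tuple whose values differ from
    \<open>e0\<close> by an element of the box is what the lemma asks for, so the absence of such a
    tuple means \<open>1 \<le> p e0\<close>.\<close>
  define e0 :: "('m \<Rightarrow> 'v) \<times> ('i \<times> 'v \<Rightarrow> real)"
    where "e0 = (\<lambda>_. 0, \<lambda>j. if j \<in> J then pr' (w (fst j)) (snd j) else 0)"
  have e0: "e0 \<in> E" by (auto simp: e0_def E_def Z)
  have "1 \<le> p e0"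
  proof (rule ge[OF e0], rule ccontr)
    fix r assume r: "r \<in> S e0" "\<not> 1 \<le> r"
    obtain v where v: "\<And>i. v i \<in> V" "\<And>m. m \<in> Q \<Longrightarrow> N (fst e0 m - L v m) \<le> r * (d m + \<epsilon>)"
        "\<And>j. j \<in> J \<Longrightarrow> \<bar>snd e0 j - f v j\<bar> \<le> r * \<epsilon>" using r by (auto simp: S_def)
    have "N (\<Sum>i\<in>I. T m i (v i)) \<le> d m + \<epsilon>" if m: "m \<in> Q" for m
    proof -
      have "N (\<Sum>i\<in>I. T m i (v i)) = N (fst e0 m - L v m)"
        using P1.Z.N_minus[OF L_in[of v m, OF v(1)]] m by (simp add: e0_def L_def)
      also have "\<dots> \<le> 1 * (d m + \<epsilon>)"
        using v(2)[OF m] mult_right_mono[of r 1 "d m + \<epsilon>"] pos[OF m] r(2) by linarith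
      finally show ?thesis by simp
    qed
    moreover have "\<bar>pr \<phi> (v i) - pr' (w i) \<phi>\<bar> \<le> \<epsilon>" if j: "(i, \<phi>) \<in> J" for i \<phi>
    proof -
      have "\<bar>pr \<phi> (v i) - pr' (w i) \<phi>\<bar> \<le> r * \<epsilon>"
        using v(3)[OF j] j by (simp add: e0_def f_def abs_minus_commute)
      also have "\<dots> \<le> 1 * \<epsilon>" using r(2) \<epsilon> by (intro mult_right_mono) auto
      finally show ?thesis by simp
    qed
    ultimately show False using none v(1) by blast
  qed
  with additive_below_sublinear_touching[OF psub e0] obtain g
    where g: "additive_on E g" "\<And>e. e \<in> E \<Longrightarrow> g e \<le> p e" and g1: "1 \<le> g e0" by metis
  have gD: "\<And>x. x \<in> E \<Longrightarrow> g (- x) = - g x" "\<And>x y. x \<in> E \<Longrightarrow> y \<in> E \<Longrightarrow> g (x + y) = g x + g y"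
    using additive_onD[OF g(1) E_zero E_minus] by blast+
  define s1 :: "'m \<Rightarrow> 'v \<Rightarrow> ('m \<Rightarrow> 'v) \<times> ('i \<times> 'v \<Rightarrow> real)"
    where "s1 m x = ((\<lambda>m'. if m' = m then x else 0), (\<lambda>_. 0))" for m x
  define s2 :: "'i \<times> 'v \<Rightarrow> real \<Rightarrow> ('m \<Rightarrow> 'v) \<times> ('i \<times> 'v \<Rightarrow> real)"
    where "s2 j t = ((\<lambda>_. 0), (\<lambda>j'. if j' = j then t else 0))" for j t
  have s1E: "s1 m x \<in> E" if "m \<in> Q" "x \<in> V" for m x
    using that by (auto simp: s1_def E_def Z)
  have s2E: "s2 j t \<in> E" if "j \<in> J" for j t
    using that by (auto simp: s2_def E_def Z)
  \<comment> \<open>On a \<open>Q\<close>-coordinate \<open>g\<close> is bounded by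
    \<open>N x / (d m + \<epsilon>)\<close> and is therefore an element of \<open>W\<close>; on a
    \<open>J\<close>-coordinate it is multiplication by a real number.\<close>
  have "\<exists>\<phi>\<in>W. \<forall>x\<in>V. pr \<phi> x = g (s1 m x)" if m: "m \<in> Q" for m
  proof (rule P1.represent)
    have "s1 m (x + y) = s1 m x + s1 m y" for x y by (auto simp: s1_def fun_eq_iff)
    then show "additive_on V (\<lambda>x. g (s1 m x))"
      unfolding additive_on_def using gD(2) s1E[OF m] by simp
    show "g (s1 m x) \<le> 1 / (d m + \<epsilon>) * N x" if x: "x \<in> V" for x
    proof -
      have "N x / (d m + \<epsilon>) \<in> S (s1 m x)"
        unfolding S_def using pos d \<epsilon> m P1.Z.N_nonneg[OF x]
        by (auto intro!: exI[of _ "\<lambda>_. 0"] Z mult_nonneg_nonneg divide_nonneg_pos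
            simp: s1_def L_zero f_zero P1.Z.N_zero less_imp_neq[symmetric] add_nonneg_pos)
      from S_le[OF this] g(2)[OF s1E[OF m x]] show ?thesis by simp
    qed
  qed
  then obtain \<Phi> where \<Phi>: "\<And>m. m \<in> Q \<Longrightarrow> \<Phi> m \<in> W" "\<And>m x. m \<in> Q \<Longrightarrow> x \<in> V \<Longrightarrow> pr (\<Phi> m) x = g (s1 m x)"
    by metis
  define a where "a j = g (s2 j 1)" for j
  have a: "g (s2 j t) = t * a j" if j: "j \<in> J" for j t
    unfolding a_def
  proof (rule additive_bounded_real_linear)
    have "s2 j (x + y) = s2 j x + s2 j y" for x y by (auto simp: s2_def fun_eq_iff)
    then show "g (s2 j (x + y)) = g (s2 j x) + g (s2 j y)" for x y
      using gD(2) s2E[OF j] by simp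
    show "g (s2 j t) \<le> 1 / \<epsilon> * \<bar>t\<bar>" for t
    proof -
      have "\<bar>t\<bar> / \<epsilon> \<in> S (s2 j t)"
        unfolding S_def using d \<epsilon>
        by (auto intro!: exI[of _ "\<lambda>_. 0"] Z mult_nonneg_nonneg divide_nonneg_pos
            simp: s2_def L_zero f_zero P1.Z.N_zero)
      from S_le[OF this] g(2)[OF s2E[OF j, of t]] show ?thesis by simp
    qed
  qed
  have g_eq: "g e = (\<Sum>m\<in>Q. pr (\<Phi> m) (fst e m)) + (\<Sum>j\<in>J. snd e j * a j)" if e: "e \<in> E" for e
  proof -
    have eV: "fst e m \<in> V" for m using e by (simp add: E_def)
    have A: "(\<Sum>m\<in>Q. s1 m (fst e m)) \<in> E \<and> g (\<Sum>m\<in>Q. s1 m (fst e m)) = (\<Sum>m\<in>Q. g (s1 m (fst e m)))"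
      using eV by (intro additive_on_sum[OF g(1) E_zero E_add] s1E)
    have B: "(\<Sum>j\<in>J. s2 j (snd e j)) \<in> E \<and> g (\<Sum>j\<in>J. s2 j (snd e j)) = (\<Sum>j\<in>J. g (s2 j (snd e j)))"
      by (intro additive_on_sum[OF g(1) E_zero E_add] s2E)
    have "e = (\<Sum>m\<in>Q. s1 m (fst e m)) + (\<Sum>j\<in>J. s2 j (snd e j))"
    proof (rule prod_eqI)
      show "fst e = fst ((\<Sum>m\<in>Q. s1 m (fst e m)) + (\<Sum>j\<in>J. s2 j (snd e j)))"
        using e fin by (auto simp: fun_eq_iff fst_sum s1_def s2_def sum_fun_apply E_def)
      show "snd e = snd ((\<Sum>m\<in>Q. s1 m (fst e m)) + (\<Sum>j\<in>J. s2 j (snd e j)))"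
        using e fin by (auto simp: fun_eq_iff snd_sum s1_def s2_def sum_fun_apply E_def)
    qed
    then have "g e = (\<Sum>m\<in>Q. g (s1 m (fst e m))) + (\<Sum>j\<in>J. g (s2 j (snd e j)))"
      using gD(2) A B by metis
    also have "\<dots> = (\<Sum>m\<in>Q. pr (\<Phi> m) (fst e m)) + (\<Sum>j\<in>J. snd e j * a j)"
      using \<Phi>(2) eV a by simp
    finally show ?thesis .
  qed
  \<comment> \<open>Elements of the range of \<open>(L, f)\<close> and their negatives have gauge
    zero, so \<open>g\<close> vanishes on them.\<close>
  have van: "(\<Sum>m\<in>Q. pr (\<Phi> m) (L v m)) + (\<Sum>j\<in>J. f v j * a j) = 0" if v: "\<And>i. v i \<in> V" for v
  proof -
    have "(L v, f v) \<in> E" using L_in[of v, OF v] by (auto simp: E_def L_def f_def)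
    moreover have "g (L v, f v) = 0"
    proof -
      have "0 \<in> S (L v, f v)" using v by (auto simp: S_def P1.Z.N_zero intro!: exI[of _ v])
      moreover have "0 \<in> S (- (L v, f v))"
      proof -
        have "L (\<lambda>i. - v i + v i) m = L (\<lambda>i. - v i) m + L v m" for m
          using v by (intro L_add) (auto intro: Z)
        then have "L (\<lambda>i. - v i) m = - L v m" for m using L_zero by (simp add: eq_neg_iff_add_eq_0)
        moreover have "f (\<lambda>i. - v i + v i) m = f (\<lambda>i. - v i) m + f v m" for m
          using v by (intro f_add) (auto intro: Z)
        then have "f (\<lambda>i. - v i) m = - f v m" for m using f_zero by (simp add: eq_neg_iff_add_eq_0)
        ultimately show ?thesis using v by (auto simp: S_def P1.Z.N_zero intro!: exI[of _ "\<lambda>i. - v i"] Z)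
      qed
      ultimately have "p (L v, f v) \<le> 0" "p (- (L v, f v)) \<le> 0" using S_le by blast+
      then show ?thesis
        using g(2)[OF \<open>(L v, f v) \<in> E\<close>] g(2)[OF E_minus[OF \<open>(L v, f v) \<in> E\<close>]]
          gD(1)[OF \<open>(L v, f v) \<in> E\<close>] by simp
    qed
    ultimately show ?thesis using g_eq[of "(L v, f v)"] by simp
  qed
  \<comment> \<open>Tuples with a single nonzero entry, moved to the dual side by adjointness, turn
    the vanishing of \<open>g\<close> into one identity in \<open>W\<close> for each
    \<open>i\<close>. In this form it can be evaluated at the bidual element
    \<open>w i\<close>.\<close>
  have key: "(\<Sum>m\<in>Q. T' m i (\<Phi> m)) + (\<Sum>j\<in>{j\<in>J. fst j = i}. sc (a j) (snd j)) = 0" if i: "i \<in> I" for i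
  proof (rule P1.pr_ext)
    have in1: "T' m i (\<Phi> m) \<in> W" if "m \<in> Q" for m using that T' \<Phi> i by blast
    have in2: "sc (a j) (snd j) \<in> W" if "j \<in> {j\<in>J. fst j = i}" for j
      using that J by (cases j) (auto intro: P1.W.sc_in)
    show "(\<Sum>m\<in>Q. T' m i (\<Phi> m)) + (\<Sum>j\<in>{j\<in>J. fst j = i}. sc (a j) (snd j)) \<in> W"
      using in1 in2 by (intro P1.W.add_in P1.W.sum_in)
    show "0 \<in> W" by (rule P1.W.zero_in)
    fix x assume x: "x \<in> V"
    let ?v = "\<lambda>i'. if i' = i then x else 0"
    have v: "?v i' \<in> V" for i' using x Z by auto
    have "L ?v m = T m i x" if m: "m \<in> Q" for m
    proof -
      have "(\<Sum>i'\<in>I. T m i' (?v i')) = (\<Sum>i'\<in>I. if i' = i then T m i x else 0)"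
        using T0[OF m] by (intro sum.cong) auto
      then show ?thesis using m i fin by (simp add: L_def)
    qed
    then have A: "(\<Sum>m\<in>Q. pr (\<Phi> m) (L ?v m)) = (\<Sum>m\<in>Q. pr (T' m i (\<Phi> m)) x)"
      using adj \<Phi> i x by (intro sum.cong) auto
    have B: "(\<Sum>j\<in>J. f ?v j * a j) = (\<Sum>j\<in>{j\<in>J. fst j = i}. pr (sc (a j) (snd j)) x)"
    proof -
      have "(\<Sum>j\<in>J. f ?v j * a j) = (\<Sum>j\<in>J. if fst j = i then pr (sc (a j) (snd j)) x else 0)"
      proof (rule sum.cong[OF refl])
        fix j assume j: "j \<in> J"
        then have "snd j \<in> W" using J by (cases j) auto
        then show "f ?v j * a j = (if fst j = i then pr (sc (a j) (snd j)) x else 0)"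
          using j x by (simp add: f_def pr0 P1.pr_sc_left)
      qed
      then show ?thesis using fin by (simp add: sum.inter_filter)
    qed
    note ad = P1.W.additiveD[OF P1.additive_left[OF x]]
    show "pr ((\<Sum>m\<in>Q. T' m i (\<Phi> m)) + (\<Sum>j\<in>{j\<in>J. fst j = i}. sc (a j) (snd j))) x = pr 0 x"
      using van[of ?v, OF v] A B ad(1) ad(3)[of "\<Sum>m\<in>Q. T' m i (\<Phi> m)" "\<Sum>j\<in>{j\<in>J. fst j = i}. sc (a j) (snd j)"]
        ad(5)[of Q "\<lambda>m. T' m i (\<Phi> m)"] ad(5)[of "{j\<in>J. fst j = i}" "\<lambda>j. sc (a j) (snd j)"]
        P1.W.sum_in[of Q "\<lambda>m. T' m i (\<Phi> m)"] P1.W.sum_in[of "{j\<in>J. fst j = i}" "\<lambda>j. sc (a j) (snd j)"] in1 in2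
      by simp
  qed
  have w_eq: "(\<Sum>m\<in>Q. pr' (w i) (T' m i (\<Phi> m))) + (\<Sum>j\<in>{j\<in>J. fst j = i}. a j * pr' (w i) (snd j)) = 0"
    if i: "i \<in> I" for i
  proof -
    note ad = P1.W.additiveD[OF P2.additive_right[OF w[OF i]]]
    have in1: "T' m i (\<Phi> m) \<in> W" if "m \<in> Q" for m using that T' \<Phi> i by blast
    have in2: "sc (a j) (snd j) \<in> W" "pr' (w i) (sc (a j) (snd j)) = a j * pr' (w i) (snd j)"
      if "j \<in> {j\<in>J. fst j = i}" for j
      using that J w[OF i] by (cases j; auto intro: P1.W.sc_in P2.pr_sc_right)+
    have "pr' (w i) ((\<Sum>m\<in>Q. T' m i (\<Phi> m)) + (\<Sum>j\<in>{j\<in>J. fst j = i}. sc (a j) (snd j))) =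
        (\<Sum>m\<in>Q. pr' (w i) (T' m i (\<Phi> m))) + (\<Sum>j\<in>{j\<in>J. fst j = i}. pr' (w i) (sc (a j) (snd j)))"
      using ad(3)[of "\<Sum>m\<in>Q. T' m i (\<Phi> m)" "\<Sum>j\<in>{j\<in>J. fst j = i}. sc (a j) (snd j)"]
        ad(5)[of Q "\<lambda>m. T' m i (\<Phi> m)"] ad(5)[of "{j\<in>J. fst j = i}" "\<lambda>j. sc (a j) (snd j)"]
        P1.W.sum_in[of Q "\<lambda>m. T' m i (\<Phi> m)"] P1.W.sum_in[of "{j\<in>J. fst j = i}" "\<lambda>j. sc (a j) (snd j)"] in1 in2(1)
      by simp
    then show ?thesis using key[OF i] ad(1) in2(2) by simp
  qed
  have "g e0 = (\<Sum>j\<in>J. pr' (w (fst j)) (snd j) * a j)"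
    unfolding g_eq[OF e0] using \<Phi> pr0 by (simp add: e0_def)
  also have "\<dots> = (\<Sum>i\<in>I. \<Sum>j\<in>{j\<in>J. fst j = i}. pr' (w (fst j)) (snd j) * a j)"
    using J by (intro sum.group[symmetric] fin) auto
  also have "\<dots> = (\<Sum>i\<in>I. - (\<Sum>m\<in>Q. pr' (w i) (T' m i (\<Phi> m))))"
  proof (rule sum.cong[OF refl])
    fix i assume "i \<in> I"
    have "(\<Sum>j\<in>{j\<in>J. fst j = i}. pr' (w (fst j)) (snd j) * a j) =
        (\<Sum>j\<in>{j\<in>J. fst j = i}. a j * pr' (w i) (snd j))"
      by (intro sum.cong) auto
    with w_eq[OF \<open>i \<in> I\<close>]
    show "(\<Sum>j\<in>{j\<in>J. fst j = i}. pr' (w (fst j)) (snd j) * a j) = - (\<Sum>m\<in>Q. pr' (w i) (T' m i (\<Phi> m)))"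
      by simp
  qed
  also have "\<dots> = (\<Sum>m\<in>Q. - (\<Sum>i\<in>I. pr' (w i) (T' m i (\<Phi> m))))"
    by (simp add: sum_negf sum.swap[of _ Q I])
  also have "\<dots> \<le> (\<Sum>m\<in>Q. d m * M (\<Phi> m))"
  proof (rule sum_mono)
    fix m assume m: "m \<in> Q"
    \<comment> \<open>\<open>bd\<close> is one-sided, so the minus sign has to move inside
      \<open>T'\<close>; adjointness supplies the oddness of \<open>T'\<close>.\<close>
    have "pr' (w i) (T' m i (- \<Phi> m)) = - pr' (w i) (T' m i (\<Phi> m))" if i: "i \<in> I" for i
    proof -
      have "T' m i (- \<Phi> m) = - T' m i (\<Phi> m)"
      proof (rule P1.pr_ext)
        show "T' m i (- \<Phi> m) \<in> W" "- T' m i (\<Phi> m) \<in> W"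
          using T' m i \<Phi>(1)[OF m] P1.W.minus_in by auto
        fix x assume x: "x \<in> V"
        note ad = P1.W.additiveD[OF P1.additive_left]
        show "pr (T' m i (- \<Phi> m)) x = pr (- T' m i (\<Phi> m)) x"
          using adj[OF m i P1.W.minus_in[OF \<Phi>(1)[OF m]] x] adj[OF m i \<Phi>(1)[OF m] x]
            ad(2)[OF T[OF m i x] \<Phi>(1)[OF m]] ad(2)[OF x T'[OF m i \<Phi>(1)[OF m]]] by simp
      qed
      then show ?thesis
        using P1.W.additiveD(2)[OF P2.additive_right[OF w[OF i]] T'[OF m i \<Phi>(1)[OF m]]] by simp
    qed
    then have "- (\<Sum>i\<in>I. pr' (w i) (T' m i (\<Phi> m))) = (\<Sum>i\<in>I. pr' (w i) (T' m i (- \<Phi> m)))"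
      by (simp add: sum_negf)
    also have "\<dots> \<le> d m * M (- \<Phi> m)" by (rule bd[OF m P1.W.minus_in[OF \<Phi>(1)[OF m]]])
    finally show "- (\<Sum>i\<in>I. pr' (w i) (T' m i (\<Phi> m))) \<le> d m * M (\<Phi> m)"
      using P1.W.N_minus[OF \<Phi>(1)[OF m]] by simp
  qed
  finally have ge1: "1 \<le> (\<Sum>m\<in>Q. d m * M (\<Phi> m))" using g1 by linarith
  \<comment> \<open>Vectors inside the box nearly norm the \<open>\<Phi> m\<close>, with the surplus
    \<open>\<epsilon> / 2\<close> over \<open>d m\<close>. Since \<open>g \<le> 1\<close> on the
    box, while \<open>1 \<le> g e0\<close> is at most the sum of the
    \<open>d m * M (\<Phi> m)\<close>, the surplus forces every \<open>M (\<Phi> m)\<close> to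
    vanish, which contradicts that lower bound \<open>1\<close>.\<close>
  have "\<exists>u. u \<in> V \<and> N u \<le> d m + \<epsilon> \<and> (d m + \<epsilon> / 2) * M (\<Phi> m) \<le> pr (\<Phi> m) u" if m: "m \<in> Q" for m
    using P1.almost_norming[OF \<Phi>(1)[OF m], of "d m + \<epsilon> / 2" "d m + \<epsilon>"] d[OF m] \<epsilon> by (auto simp: field_simps)
  then obtain u where u: "\<And>m. m \<in> Q \<Longrightarrow> u m \<in> V" "\<And>m. m \<in> Q \<Longrightarrow> N (u m) \<le> d m + \<epsilon>"
    "\<And>m. m \<in> Q \<Longrightarrow> (d m + \<epsilon> / 2) * M (\<Phi> m) \<le> pr (\<Phi> m) (u m)" by metis
  define e :: "('m \<Rightarrow> 'v) \<times> ('i \<times> 'v \<Rightarrow> real)" where "e = (\<lambda>m. if m \<in> Q then u m else 0, \<lambda>_. 0)"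
  have e: "e \<in> E" using u by (auto simp: e_def E_def Z)
  have "(\<Sum>m\<in>Q. (d m + \<epsilon> / 2) * M (\<Phi> m)) \<le> (\<Sum>m\<in>Q. pr (\<Phi> m) (u m))"
    using u by (intro sum_mono) auto
  also have "\<dots> = g e" unfolding g_eq[OF e] by (simp add: e_def)
  also have "\<dots> \<le> 1"
  proof -
    have "1 \<in> S e" using u \<epsilon> by (auto simp: S_def e_def L_zero f_zero Z intro!: exI[of _ "\<lambda>_. 0"])
    from S_le[OF this] g(2)[OF e] show ?thesis by simp
  qed
  finally have "(\<Sum>m\<in>Q. d m * M (\<Phi> m)) + \<epsilon> / 2 * (\<Sum>m\<in>Q. M (\<Phi> m)) \<le> 1"
    by (simp add: sum.distrib sum_distrib_left algebra_simps)
  moreover have nn: "0 \<le> M (\<Phi> m)" if "m \<in> Q" for m using \<Phi>(1)[OF that] P1.W.N_nonneg by blast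
  have "0 \<le> (\<Sum>m\<in>Q. M (\<Phi> m))" using nn by (intro sum_nonneg) auto
  ultimately have "\<epsilon> / 2 * (\<Sum>m\<in>Q. M (\<Phi> m)) \<le> 0" using ge1 by linarith
  then have "(\<Sum>m\<in>Q. M (\<Phi> m)) \<le> 0" using \<epsilon> by (simp add: mult_le_0_iff)
  then have "(\<Sum>m\<in>Q. M (\<Phi> m)) = 0" using nn by (meson antisym sum_nonneg)
  then have "\<forall>m\<in>Q. M (\<Phi> m) = 0" using nn fin(2) by (simp add: sum_nonneg_eq_0_iff)
  then have "(\<Sum>m\<in>Q. d m * M (\<Phi> m)) = 0" by (intro sum.neutral) simp
  with ge1 show False by simp
qed

end

text \<open>A quantitative substitute for a barycentre of the \<open>x i\<close> that is almost fixed by the affine maps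
  \<open>y \<mapsto> a g y + b g\<close> as soon as these almost preserve the uniform distribution on the \<open>x i\<close>, measured
  by the energy distance.  In an \<open>\<ell>\<^sup>1\<close> space of which the \<open>a g\<close> permute the coordinates, the mean of
  the medians of all triples has this property; the formulation is chosen so that it passes to biduals.\<close>

definition approx_mean :: "'v::ab_group_add set \<Rightarrow> ('v \<Rightarrow> real) \<Rightarrow> ('g \<Rightarrow> 'v \<Rightarrow> 'v) \<Rightarrow> bool" where
  "approx_mean V N a \<longleftrightarrow> (\<forall>(k::nat) x F b \<eta> \<epsilon> R c.
     0 < k \<longrightarrow> (\<forall>i<k. x i \<in> V \<and> N (x i) \<le> R) \<longrightarrow> finite F \<longrightarrow> (\<forall>g\<in>F. b g \<in> V) \<longrightarrow>
     0 < \<eta> \<longrightarrow> \<eta> \<le> 1 \<longrightarrow> 0 < \<epsilon> \<longrightarrow>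
     (\<forall>g\<in>F. 0 \<le> c g \<and> (\<Sum>i<k. \<Sum>j<k. \<eta> * N (x i - x j) +
        6 / \<eta> * (N (a g (x i) + b g - x j) - N (x i - x j))) \<le> c g * (real k)\<^sup>2) \<longrightarrow>
     (\<exists>y\<in>V. N y \<le> 3 * R + \<epsilon> \<and> (\<forall>g\<in>F. N (a g y + b g - y) \<le> c g + \<epsilon>)))"

context bidual_pair
begin

text \<open>\<open>Helly_tuple\<close> replaces the data in the bidual by data in \<open>V\<close>
  that satisfy the same hypothesis up to \<open>\<epsilon> / 2\<close>. The mean \<open>y\<close>
  found there depends on the functionals under test; \<open>finite_intersection\<close> merges these
  local solutions into one functional on \<open>W\<close>, that is, an element of
  \<open>U\<close>.\<close>

lemma approx_mean_bidual:
  fixes a0 a1 a2 :: "'g \<Rightarrow> 'v \<Rightarrow> 'v" and st :: "'g \<Rightarrow> 'g"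
  assumes mean: "approx_mean V N a0"
    and a0: "\<And>g x. x \<in> V \<Longrightarrow> a0 g x \<in> V"
    and a0_add: "\<And>g x y. x \<in> V \<Longrightarrow> y \<in> V \<Longrightarrow> a0 g (x + y) = a0 g x + a0 g y"
    and a1: "\<And>g x. x \<in> W \<Longrightarrow> a1 g x \<in> W"
    and a1_add: "\<And>g x y. x \<in> W \<Longrightarrow> y \<in> W \<Longrightarrow> a1 g (x + y) = a1 g x + a1 g y"
    and a2: "\<And>g x. x \<in> U \<Longrightarrow> a2 g x \<in> U"
    and adj1: "\<And>g \<phi> x. \<phi> \<in> W \<Longrightarrow> x \<in> V \<Longrightarrow> pr \<phi> (a0 g x) = pr (a1 (st g) \<phi>) x"
    and adj2: "\<And>g u \<phi>. u \<in> U \<Longrightarrow> \<phi> \<in> W \<Longrightarrow> pr' (a2 g u) \<phi> = pr' u (a1 (st g) \<phi>)"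
  shows "approx_mean U K a2"
  unfolding approx_mean_def
proof (intro allI impI)
  fix k :: nat and x :: "nat \<Rightarrow> 'v" and F :: "'g set" and b :: "'g \<Rightarrow> 'v" and \<eta> \<epsilon> R :: real and c
  assume k: "0 < k" and "\<forall>i<k. x i \<in> U \<and> K (x i) \<le> R" and F: "finite F" and "\<forall>g\<in>F. b g \<in> U"
    and \<eta>: "0 < \<eta>" "\<eta> \<le> 1" and \<epsilon>: "0 < \<epsilon>"
    and "\<forall>g\<in>F. 0 \<le> c g \<and> (\<Sum>i<k. \<Sum>j<k. \<eta> * K (x i - x j) +
        6 / \<eta> * (K (a2 g (x i) + b g - x j) - K (x i - x j))) \<le> c g * (real k)\<^sup>2"
  then have x: "\<And>i. i < k \<Longrightarrow> x i \<in> U" and xR: "\<And>i. i < k \<Longrightarrow> K (x i) \<le> R"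
    and b: "\<And>g. g \<in> F \<Longrightarrow> b g \<in> U" and c: "\<And>g. g \<in> F \<Longrightarrow> 0 \<le> c g"
    and cb: "\<And>g. g \<in> F \<Longrightarrow> (\<Sum>i<k. \<Sum>j<k. \<eta> * K (x i - x j) +
        6 / \<eta> * (K (a2 g (x i) + b g - x j) - K (x i - x j))) \<le> c g * (real k)\<^sup>2"
    by auto
  have R: "0 \<le> R" using P2.W.N_nonneg[OF x[OF k]] xR[OF k] by simp
  note UI = P2.W.add_in P2.W.diff_in
  note prU = P1.W.additiveD[OF P2.additive_right]
  note prV = P1.Z.additiveD[OF P1.additive_right]
  have finite_case: "\<exists>l. additive_on W l \<and> (\<forall>\<phi>\<in>W. l \<phi> \<le> (3 * R + \<epsilon>) * M \<phi>) \<and>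
      (\<forall>g\<in>F'. l (a1 (st g) (\<phi> g) - \<phi> g) + pr' (b g) (\<phi> g) \<le> (c g + \<epsilon>) * M (\<phi> g) + \<epsilon>')"
    if F': "finite F'" "F' \<subseteq> F" and \<phi>: "\<And>g. \<phi> g \<in> W" and \<epsilon>': "0 < \<epsilon>'" for F' \<phi> \<epsilon>'
  proof -
    \<comment> \<open>The radius grows by \<open>3 * \<delta> \<le> \<epsilon> / 2\<close>, each
      summand of the hypothesis by at most
      \<open>24 * \<delta> / \<eta> \<le> \<epsilon> / 2\<close>, and \<open>\<epsilon>'\<close>
      absorbs the error in the pairing with \<open>b g\<close>.\<close>
    define \<delta> where "\<delta> = min (min (\<epsilon> / 6) (\<epsilon> * \<eta> / 48)) (min \<epsilon>' 1)"
    have "0 < \<delta>" using \<epsilon> \<epsilon>' \<eta> by (simp add: \<delta>_def)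
    moreover have "\<delta> \<le> \<epsilon> / 6" "\<delta> \<le> \<epsilon> * \<eta> / 48" "\<delta> \<le> \<epsilon>'" "\<delta> \<le> 1"
      unfolding \<delta>_def by (meson min.cobounded1 min.cobounded2 order_trans)+
    ultimately have \<delta>: "0 < \<delta>" "\<delta> \<le> \<epsilon> / 6" "\<delta> \<le> \<epsilon> * \<eta> / 48" "\<delta> \<le> \<epsilon>'" "\<delta> \<le> 1" by auto
    \<comment> \<open>The expressions in \<open>Helly_tuple\<close> are bounded from above only. The
      distances between the \<open>x i\<close> must not shrink, which is ensured by preserving the
      pairings with nearly norming functionals.\<close>
    have "\<exists>\<psi>\<in>W. M \<psi> \<le> 1 \<and> K (x i - x j) - \<delta> \<le> pr' (x i - x j) \<psi>" if ij: "i < k" "j < k" for i j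
    proof -
      have u: "x i - x j \<in> U" using x ij UI by blast
      define \<kappa> where "\<kappa> = K (x i - x j)"
      have \<kappa>: "0 \<le> \<kappa>" using P2.W.N_nonneg[OF u] by (simp add: \<kappa>_def)
      let ?c = "1 - \<delta> / (1 + \<kappa>)"
      have "\<delta> / (1 + \<kappa>) \<le> 1" "0 < \<delta> / (1 + \<kappa>)" using \<delta> \<kappa> by (auto simp: field_simps)
      then have "0 \<le> ?c" "?c < 1" by auto
      from P2.almost_norming[OF u this] obtain \<psi> where \<psi>: "\<psi> \<in> W" "M \<psi> \<le> 1" "?c * \<kappa> \<le> pr' (x i - x j) \<psi>"
        unfolding \<kappa>_def by blast
      have "\<delta> / (1 + \<kappa>) * \<kappa> \<le> \<delta>" using \<delta> \<kappa> by (simp add: field_simps)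
      then have "\<kappa> - \<delta> \<le> ?c * \<kappa>" by (simp add: algebra_simps)
      with \<psi> show ?thesis unfolding \<kappa>_def by force
    qed
    then obtain \<psi> where \<psi>: "\<And>i j. i < k \<Longrightarrow> j < k \<Longrightarrow> \<psi> i j \<in> W" "\<And>i j. i < k \<Longrightarrow> j < k \<Longrightarrow> M (\<psi> i j) \<le> 1"
      "\<And>i j. i < k \<Longrightarrow> j < k \<Longrightarrow> K (x i - x j) - \<delta> \<le> pr' (x i - x j) (\<psi> i j)" by metis
    define I :: "(nat + 'g) set" where "I = {..<k} <+> F"
    define Q :: "(nat + 'g \<times> nat \<times> nat) set" where "Q = {..<k} <+> F \<times> {..<k} \<times> {..<k}"
    define J :: "((nat + 'g) \<times> 'v) set" where
      "J = (\<lambda>(i, j). (Inl i, \<psi> i j)) ` ({..<k} \<times> {..<k}) \<union> (\<lambda>(i, j). (Inl j, \<psi> i j)) ` ({..<k} \<times> {..<k})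
         \<union> (\<lambda>g. (Inr g, \<phi> g)) ` F'"
    \<comment> \<open>The matrix of the expressions \<open>x i\<close> and
      \<open>a g (x i) + b g - x j\<close>. Two separate conditionals are subtracted so that
      \<open>i = j\<close> is covered; \<open>\<alpha>\<close> is a parameter because the same
      formula with the dual action is the adjoint matrix.\<close>
    define T where "T \<alpha> m idx z = (case m of Inl i \<Rightarrow> (if idx = Inl i then z else 0)
        | Inr (g, i, j) \<Rightarrow> (case idx of Inl l \<Rightarrow> (if l = i then \<alpha> g z else 0) - (if l = j then z else 0)
            | Inr h \<Rightarrow> (if h = g then z else 0)))"
      for \<alpha> :: "'g \<Rightarrow> 'v \<Rightarrow> 'v" and m :: "nat + 'g \<times> nat \<times> nat" and idx :: "nat + 'g" and z :: 'v
    define w where "w = case_sum x b"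
    define d where "d m = (case m of Inl i \<Rightarrow> K (x i) | Inr (g, i, j) \<Rightarrow> K (a2 g (x i) + b g - x j))" for m
    have T_sum: "(\<Sum>idx\<in>I. T a0 (Inr (g, i, j)) idx (v idx)) = a0 g (v (Inl i)) + v (Inr g) - v (Inl j)"
      if "g \<in> F" "i < k" "j < k" for g i j v
      using that F by (simp add: I_def sum.Plus T_def sum_subtractf)
    have T_sum': "(\<Sum>idx\<in>I. T a0 (Inl i) idx (v idx)) = v (Inl i)" if "i < k" for i v
      using that F by (auto simp: I_def T_def)
    have "\<exists>v. (\<forall>i. v i \<in> V) \<and> (\<forall>m\<in>Q. N (\<Sum>i\<in>I. T a0 m i (v i)) \<le> d m + \<delta>) \<and>
      (\<forall>(i, \<phi>)\<in>J. \<bar>pr \<phi> (v i) - pr' (w i) \<phi>\<bar> \<le> \<delta>)"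
    proof (rule Helly_tuple[of I Q J w "T a0" "T (\<lambda>g. a1 (st g))" d \<delta>])
      show "finite I" "finite Q" "finite J" using F F' by (auto simp: I_def Q_def J_def)
      show "i \<in> I \<and> \<phi> \<in> W" if "(i, \<phi>) \<in> J" for i \<phi>
        using that \<psi> \<phi> F' by (auto simp: J_def I_def)
      show "w i \<in> U" if "i \<in> I" for i using that x b by (auto simp: w_def I_def)
      show "T a0 m i z \<in> V" if "m \<in> Q" "i \<in> I" "z \<in> V" for m i z
        using that a0 by (auto simp: T_def split: sum.split prod.split intro!: P1.Z.diff_in P1.Z.zero_in P1.Z.minus_in)
      show "T a0 m i (y + z) = T a0 m i y + T a0 m i z" if "m \<in> Q" "i \<in> I" "y \<in> V" "z \<in> V" for m i y z
        using that a0_add by (auto simp: T_def split: sum.split prod.split)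
      show "T (\<lambda>g. a1 (st g)) m i z \<in> W" if "m \<in> Q" "i \<in> I" "z \<in> W" for m i z
        using that a1 by (auto simp: T_def split: sum.split prod.split intro!: P1.W.diff_in P1.W.zero_in P1.W.minus_in)
      show "pr \<phi> (T a0 m i z) = pr (T (\<lambda>g. a1 (st g)) m i \<phi>) z"
        if "m \<in> Q" "i \<in> I" "\<phi> \<in> W" "z \<in> V" for m i \<phi> z
      proof -
        note ad1 = P1.Z.additiveD[OF P1.additive_right[OF that(3)]]
        note ad2 = P1.W.additiveD[OF P1.additive_left[OF that(4)]]
        show ?thesis
          using adj1[OF that(3,4)] that(3,4) a0[OF that(4)] a1[OF that(3)] ad1(1,2,4) ad2(1,2,4)
          by (auto simp: T_def split: sum.split prod.split)
      qed
      show "0 \<le> d m" if "m \<in> Q" for m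
        using that x b a2 by (auto simp: Q_def d_def intro!: P2.W.N_nonneg UI)
      show "(\<Sum>i\<in>I. pr' (w i) (T (\<lambda>g. a1 (st g)) m i \<phi>)) \<le> d m * M \<phi>" if m: "m \<in> Q" and \<phi>: "\<phi> \<in> W" for m \<phi>
      proof -
        have p0: "pr' u 0 = 0" if "u \<in> U" for u using prU(1)[OF that] .
        consider (1) i where "m = Inl i" "i < k" | (2) g i j where "m = Inr (g, i, j)" "g \<in> F" "i < k" "j < k"
          using m by (auto simp: Q_def)
        then show ?thesis
        proof cases
          case 1
          have "(\<Sum>l<k. pr' (x l) (T (\<lambda>g. a1 (st g)) m (Inl l) \<phi>)) = (\<Sum>l<k. if l = i then pr' (x i) \<phi> else 0)"
            using p0[OF x] 1 by (intro sum.cong) (auto simp: T_def)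
          moreover have "(\<Sum>h\<in>F. pr' (b h) (T (\<lambda>g. a1 (st g)) m (Inr h) \<phi>)) = 0"
            using p0[OF b] 1 by (intro sum.neutral) (auto simp: T_def)
          ultimately have "(\<Sum>i\<in>I. pr' (w i) (T (\<lambda>g. a1 (st g)) m i \<phi>)) = pr' (x i) \<phi>"
            using 1 F by (simp add: I_def sum.Plus w_def)
          then show ?thesis using P2.pr_le[OF x[OF 1(2)] \<phi>] 1 by (simp add: d_def)
        next
          case 2
          have "(\<Sum>l<k. pr' (x l) (T (\<lambda>g. a1 (st g)) m (Inl l) \<phi>)) =
              (\<Sum>l<k. (if l = i then pr' (x i) (a1 (st g) \<phi>) else 0) - (if l = j then pr' (x j) \<phi> else 0))"
            using p0[OF x] 2 prU(2,4)[OF x] \<phi> a1[OF \<phi>] by (intro sum.cong) (auto simp: T_def)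
          moreover have "(\<Sum>h\<in>F. pr' (b h) (T (\<lambda>g. a1 (st g)) m (Inr h) \<phi>)) = (\<Sum>h\<in>F. if h = g then pr' (b g) \<phi> else 0)"
            using p0[OF b] 2 by (intro sum.cong) (auto simp: T_def)
          ultimately have "(\<Sum>i\<in>I. pr' (w i) (T (\<lambda>g. a1 (st g)) m i \<phi>)) =
              pr' (x i) (a1 (st g) \<phi>) - pr' (x j) \<phi> + pr' (b g) \<phi>"
            using 2 F by (simp add: I_def sum.Plus w_def sum_subtractf)
          also have "\<dots> = pr' (a2 g (x i) + b g - x j) \<phi>"
          proof -
            note ad = P2.W.additiveD[OF P2.additive_left[OF \<phi>]]
            have "a2 g (x i) \<in> U" "b g \<in> U" "x j \<in> U" "a2 g (x i) + b g \<in> U"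
              using 2 x b a2 UI by auto
            then show ?thesis using ad(3,4) adj2[OF x[OF 2(3)] \<phi>] by simp
          qed
          also have "\<dots> \<le> K (a2 g (x i) + b g - x j) * M \<phi>"
            using 2 x b a2 by (intro P2.pr_le \<phi> UI) auto
          finally show ?thesis using 2 by (simp add: d_def)
        qed
      qed
      show "0 < \<delta>" by fact
    qed blast
    then obtain v where v: "\<And>i. v i \<in> V" and vQ: "\<And>m. m \<in> Q \<Longrightarrow> N (\<Sum>i\<in>I. T a0 m i (v i)) \<le> d m + \<delta>"
      and vJ: "\<And>i \<phi>. (i, \<phi>) \<in> J \<Longrightarrow> \<bar>pr \<phi> (v i) - pr' (w i) \<phi>\<bar> \<le> \<delta>" by blast
    define x' where "x' i = v (Inl i)" for i
    define b' where "b' g = v (Inr g)" for g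
    have x': "x' i \<in> V" for i using v by (simp add: x'_def)
    have b': "b' g \<in> V" for g using v by (simp add: b'_def)
    have QI: "i < k \<Longrightarrow> Inl i \<in> Q" "g \<in> F \<Longrightarrow> i < k \<Longrightarrow> j < k \<Longrightarrow> Inr (g, i, j) \<in> Q" for g i j
      by (auto simp: Q_def)
    have x'R: "N (x' i) \<le> R + \<delta>" if "i < k" for i
      using vQ[OF QI(1)[OF that]] T_sum'[OF that, of v] xR[OF that] by (simp add: d_def x'_def)
    have upper_bd: "N (a0 g (x' i) + b' g - x' j) \<le> K (a2 g (x i) + b g - x j) + \<delta>"
      if "g \<in> F" "i < k" "j < k" for g i j
      using vQ[OF QI(2)[OF that]] T_sum[OF that, of v] by (simp add: d_def x'_def b'_def)
    \<comment> \<open>One \<open>\<delta>\<close> is lost because \<open>\<psi> i j\<close> is only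
      nearly norming, and one in each of the two pairings.\<close>
    have lower_bd: "K (x i - x j) - 3 * \<delta> \<le> N (x' i - x' j)" if ij: "i < k" "j < k" for i j
    proof -
      have j1: "(Inl i, \<psi> i j) \<in> J" and j2: "(Inl j, \<psi> i j) \<in> J" using ij by (auto simp: J_def)
      have "pr' (x i - x j) (\<psi> i j) = pr' (x i) (\<psi> i j) - pr' (x j) (\<psi> i j)"
        using P2.W.additiveD(4)[OF P2.additive_left[OF \<psi>(1)[OF ij]]] x ij by blast
      moreover have "pr (\<psi> i j) (x' i - x' j) = pr (\<psi> i j) (x' i) - pr (\<psi> i j) (x' j)"
        using prV(4)[OF \<psi>(1)[OF ij]] x' by blast
      ultimately have "K (x i - x j) - 3 * \<delta> \<le> pr (\<psi> i j) (x' i - x' j)"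
        using vJ[OF j1] vJ[OF j2] \<psi>(3)[OF ij] unfolding x'_def w_def by simp
      also have "\<dots> \<le> M (\<psi> i j) * N (x' i - x' j)" by (intro P1.pr_le \<psi>(1) ij P1.Z.diff_in x')
      also have "\<dots> \<le> 1 * N (x' i - x' j)"
        by (intro mult_right_mono \<psi>(2) ij P1.Z.N_nonneg P1.Z.diff_in x')
      finally show ?thesis by simp
    qed
    have summand: "\<eta> * N (x' i - x' j) + 6 / \<eta> * (N (a0 g (x' i) + b' g - x' j) - N (x' i - x' j)) \<le>
        \<eta> * K (x i - x j) + 6 / \<eta> * (K (a2 g (x i) + b g - x j) - K (x i - x j)) + \<epsilon> / 2"
      if g: "g \<in> F" and ij: "i < k" "j < k" for g i j
    proof -
      define A A' B B' where "A = N (x' i - x' j)" "A' = K (x i - x j)"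
        "B = N (a0 g (x' i) + b' g - x' j)" "B' = K (a2 g (x i) + b g - x j)"
      have 1: "B \<le> B' + \<delta>" "A' - 3 * \<delta> \<le> A"
        using upper_bd[OF g ij] lower_bd[OF ij] by (auto simp: A_A'_B_B'_def)
      \<comment> \<open>This is where \<open>\<eta> \<le> 1\<close> enters: the distance within the
        family has the coefficient \<open>\<eta> - 6 / \<eta> \<le> 0\<close>, so the lower bound
        for it works in the right direction.\<close>
      have "6 \<le> 6 / \<eta>" using \<eta> by (simp add: field_simps)
      then have 2: "0 \<le> 6 / \<eta> - \<eta>" "6 / \<eta> - \<eta> \<le> 6 / \<eta>" using \<eta> by linarith+
      have "(6 / \<eta> - \<eta>) * (A' - A) \<le> (6 / \<eta> - \<eta>) * (3 * \<delta>)" using 1 2 by (intro mult_left_mono) auto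
      also have "\<dots> \<le> 6 / \<eta> * (3 * \<delta>)" using 2 \<delta> by (intro mult_right_mono) auto
      finally have 3: "(6 / \<eta> - \<eta>) * (A' - A) \<le> 18 * \<delta> / \<eta>" by simp
      have 4: "6 / \<eta> * (B - B') \<le> 6 / \<eta> * \<delta>" using 1 \<eta> by (intro mult_left_mono) auto
      have "24 * \<delta> / \<eta> \<le> 24 * (\<epsilon> * \<eta> / 48) / \<eta>" using \<delta> \<eta> by (intro divide_right_mono mult_left_mono) auto
      also have "\<dots> = \<epsilon> / 2" using \<eta> by simp
      finally have 5: "24 * \<delta> / \<eta> \<le> \<epsilon> / 2" .
      have "\<eta> * A + 6 / \<eta> * (B - A) - (\<eta> * A' + 6 / \<eta> * (B' - A')) =
          (6 / \<eta> - \<eta>) * (A' - A) + 6 / \<eta> * (B - B')"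
        using \<eta> by (simp add: field_simps)
      also have "\<dots> \<le> 18 * \<delta> / \<eta> + 6 / \<eta> * \<delta>" using 3 4 by simp
      also have "\<dots> = 24 * \<delta> / \<eta>" by (simp add: field_simps)
      finally show ?thesis using 5 unfolding A_A'_B_B'_def by simp
    qed
    have "\<exists>y\<in>V. N y \<le> 3 * (R + \<delta>) + \<epsilon> / 2 \<and>
        (\<forall>g\<in>F. N (a0 g y + b' g - y) \<le> (c g + \<epsilon> / 2) + \<epsilon> / 2)"
    proof (rule mean[unfolded approx_mean_def, rule_format, of k x' "R + \<delta>" F b' \<eta>])
      show "0 < k" "finite F" "0 < \<eta>" "\<eta> \<le> 1" "0 < \<epsilon> / 2" using k F \<eta> \<epsilon> by auto
      show "x' i \<in> V \<and> N (x' i) \<le> R + \<delta>" if "i < k" for i using x' x'R[OF that] by simp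
      show "b' g \<in> V" for g by (rule b')
      fix g assume g: "g \<in> F"
      have "(\<Sum>i<k. \<Sum>j<k. \<eta> * N (x' i - x' j) + 6 / \<eta> * (N (a0 g (x' i) + b' g - x' j) - N (x' i - x' j))) \<le>
        (\<Sum>i<k. \<Sum>j<k. \<eta> * K (x i - x j) + 6 / \<eta> * (K (a2 g (x i) + b g - x j) - K (x i - x j)) + \<epsilon> / 2)"
        using summand[OF g] by (intro sum_mono) auto
      also have "\<dots> = (\<Sum>i<k. \<Sum>j<k. \<eta> * K (x i - x j) + 6 / \<eta> * (K (a2 g (x i) + b g - x j) - K (x i - x j)))
          + (real k)\<^sup>2 * (\<epsilon> / 2)"
        by (simp add: sum.distrib power2_eq_square)
      also have "\<dots> \<le> c g * (real k)\<^sup>2 + (real k)\<^sup>2 * (\<epsilon> / 2)" using cb[OF g] by simp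
      finally show "0 \<le> c g + \<epsilon> / 2 \<and> (\<Sum>i<k. \<Sum>j<k. \<eta> * N (x' i - x' j) +
          6 / \<eta> * (N (a0 g (x' i) + b' g - x' j) - N (x' i - x' j))) \<le> (c g + \<epsilon> / 2) * (real k)\<^sup>2"
        using c[OF g] \<epsilon> by (simp add: algebra_simps)
    qed
    then obtain y where y: "y \<in> V" "N y \<le> 3 * (R + \<delta>) + \<epsilon> / 2"
      and y': "\<And>g. g \<in> F \<Longrightarrow> N (a0 g y + b' g - y) \<le> (c g + \<epsilon> / 2) + \<epsilon> / 2" by blast
    have y3: "N (a0 g y + b' g - y) \<le> c g + \<epsilon>" if "g \<in> F" for g using y'[OF that] by simp
    have yR: "N y \<le> 3 * R + \<epsilon>" using y(2) \<delta> by simp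
    show ?thesis
    \<comment> \<open>Evaluation at \<open>y\<close> meets the constraints at the chosen
      \<open>\<phi> g\<close> only, since \<open>b'\<close> resembles \<open>b\<close> only there;
      this is what \<open>finite_intersection\<close> asks for.\<close>
    proof (intro exI[of _ "\<lambda>\<phi>. pr \<phi> y"] conjI ballI)
      show "additive_on W (\<lambda>\<phi>. pr \<phi> y)" by (rule P1.additive_left[OF y(1)])
      show "pr \<phi> y \<le> (3 * R + \<epsilon>) * M \<phi>" if "\<phi> \<in> W" for \<phi>
        using P1.pr_le[OF that y(1)] mult_left_mono[OF yR P1.W.N_nonneg[OF that]] by (simp add: mult.commute)
      fix g assume g: "g \<in> F'"
      then have gF: "g \<in> F" using F' by auto
      have "(Inr g, \<phi> g) \<in> J" using g by (auto simp: J_def)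
      from vJ[OF this] have near: "pr' (b g) (\<phi> g) \<le> pr (\<phi> g) (b' g) + \<delta>" by (simp add: w_def b'_def)
      have "pr (a1 (st g) (\<phi> g) - \<phi> g) y = pr (\<phi> g) (a0 g y) - pr (\<phi> g) y"
        using P1.W.additiveD(4)[OF P1.additive_left[OF y(1)] a1[OF \<phi>] \<phi>] adj1[OF \<phi> y(1)] by simp
      also have "\<dots> = pr (\<phi> g) (a0 g y + b' g - y) - pr (\<phi> g) (b' g)"
        using prV(3,4)[OF \<phi>] a0[OF y(1)] b' y(1) P1.Z.add_in by simp
      also have "pr (\<phi> g) (a0 g y + b' g - y) \<le> M (\<phi> g) * N (a0 g y + b' g - y)"
        using a0[OF y(1)] b' y(1) by (intro P1.pr_le \<phi> P1.Z.diff_in P1.Z.add_in)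
      also have "\<dots> \<le> M (\<phi> g) * (c g + \<epsilon>)" by (intro mult_left_mono y3 gF P1.W.N_nonneg \<phi>)
      finally show "pr (a1 (st g) (\<phi> g) - \<phi> g) y + pr' (b g) (\<phi> g) \<le> (c g + \<epsilon>) * M (\<phi> g) + \<epsilon>'"
        using near \<delta>(4) by (simp add: mult.commute)
    qed
  qed
  obtain l where l: "additive_on W l" "\<And>\<phi>. \<phi> \<in> W \<Longrightarrow> l \<phi> \<le> (3 * R + \<epsilon>) * M \<phi>"
    "\<And>g \<phi>. g \<in> F \<Longrightarrow> \<phi> \<in> W \<Longrightarrow> l (a1 (st g) \<phi> - \<phi>) + pr' (b g) \<phi> \<le> (c g + \<epsilon>) * M \<phi>"
  proof (rule P1.W.finite_intersection[of F "\<lambda>g \<phi>. a1 (st g) \<phi> - \<phi>" "\<lambda>g. pr' (b g)" "\<lambda>g. c g + \<epsilon>" "3 * R + \<epsilon>"])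
    show "a1 (st g) \<phi> - \<phi> \<in> W" if "\<phi> \<in> W" for g \<phi> using that a1 P1.W.diff_in by blast
    show "a1 (st g) (\<phi> + \<psi>) - (\<phi> + \<psi>) = a1 (st g) \<phi> - \<phi> + (a1 (st g) \<psi> - \<psi>)" if "\<phi> \<in> W" "\<psi> \<in> W" for g \<phi> \<psi>
      using a1_add[OF that] by simp
    show "additive_on W (pr' (b g))" if "g \<in> F" for g using P2.additive_right[OF b[OF that]] .
    show "0 \<le> c g + \<epsilon>" if "g \<in> F" for g using c[OF that] \<epsilon> by simp
    show "0 \<le> 3 * R + \<epsilon>" using R \<epsilon> by simp
    show "\<exists>l. additive_on W l \<and> (\<forall>x\<in>W. l x \<le> (3 * R + \<epsilon>) * M x) \<and>
        (\<forall>g\<in>F'. l (a1 (st g) (\<phi> g) - \<phi> g) + pr' (b g) (\<phi> g) \<le> (c g + \<epsilon>) * M (\<phi> g) + \<epsilon>')"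
      if "finite F'" "F' \<subseteq> F" "\<And>g. \<phi> g \<in> W" "0 < \<epsilon>'" for F' \<phi> \<epsilon>'
      using finite_case[OF that] .
  qed blast
  obtain y where y: "y \<in> U" "\<And>\<phi>. \<phi> \<in> W \<Longrightarrow> pr' y \<phi> = l \<phi>"
    using P2.represent[OF l(1,2)] by blast
  show "\<exists>y\<in>U. K y \<le> 3 * R + \<epsilon> \<and> (\<forall>g\<in>F. K (a2 g y + b g - y) \<le> c g + \<epsilon>)"
  proof (intro bexI[of _ y] conjI ballI)
    show "y \<in> U" by fact
    show "K y \<le> 3 * R + \<epsilon>" using y l R \<epsilon> by (intro P2.norm_least) auto
    fix g assume g: "g \<in> F"
    show "K (a2 g y + b g - y) \<le> c g + \<epsilon>"
    proof (rule P2.norm_least)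
      show "a2 g y + b g - y \<in> U" using a2[OF y(1)] b[OF g] y(1) UI by blast
      show "0 \<le> c g + \<epsilon>" using c[OF g] \<epsilon> by simp
      fix \<phi> assume \<phi>: "\<phi> \<in> W"
      note ad = P2.W.additiveD[OF P2.additive_left[OF \<phi>]]
      have "pr' (a2 g y + b g - y) \<phi> = pr' (a2 g y) \<phi> + pr' (b g) \<phi> - pr' y \<phi>"
        using ad(3,4) a2[OF y(1)] b[OF g] y(1) UI by simp
      also have "\<dots> = pr' y (a1 (st g) \<phi> - \<phi>) + pr' (b g) \<phi>"
        using adj2[OF y(1) \<phi>] prU(4)[OF y(1) a1[OF \<phi>] \<phi>] by simp
      also have "\<dots> \<le> (c g + \<epsilon>) * M \<phi>"
        using l(3)[OF g \<phi>] y(2)[OF P1.W.diff_in[OF a1[OF \<phi>] \<phi>]] by simp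
      finally show "pr' (a2 g y + b g - y) \<phi> \<le> (c g + \<epsilon>) * M \<phi>" .
    qed
  qed
qed

end

section \<open>Means of medians\<close>

definition med3 :: "real \<Rightarrow> real \<Rightarrow> real \<Rightarrow> real" where
  "med3 a b c = max (min a b) (min (max a b) c)"

definition med_mean :: "nat \<Rightarrow> (nat \<Rightarrow> real) \<Rightarrow> real" where
  "med_mean k x = (\<Sum>i<k. \<Sum>j<k. \<Sum>l<k. med3 (x i) (x j) (x l)) / real k ^ 3"

lemma med3_shift: "med3 (a + t) (b + t) (c + t) = med3 a b c + t"
  by (auto simp: med3_def max_def min_def)

lemma abs_med3_le: "\<bar>med3 a b c\<bar> \<le> \<bar>a\<bar> + \<bar>b\<bar> + \<bar>c\<bar>"
  by (auto simp: med3_def max_def min_def)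

lemma med_mean_shift:
  assumes "0 < k"
  shows "med_mean k (\<lambda>i. x i + t) = med_mean k x + t"
proof -
  have "(\<Sum>i<k. \<Sum>j<k. \<Sum>l<k. med3 (x i + t) (x j + t) (x l + t)) =
      (\<Sum>i<k. \<Sum>j<k. \<Sum>l<k. med3 (x i) (x j) (x l)) + real k ^ 3 * t"
    by (simp add: med3_shift sum.distrib power3_eq_cube)
  then show ?thesis using assms by (simp add: med_mean_def field_simps)
qed

lemma med_mean_zero: "med_mean k (\<lambda>_. 0) = 0"
  by (simp add: med_mean_def med3_def)

lemma abs_med_mean_le:
  assumes k: "0 < k"
  shows "\<bar>med_mean k x\<bar> \<le> 3 / real k * (\<Sum>i<k. \<bar>x i\<bar>)"
proof -
  have "\<bar>\<Sum>i<k. \<Sum>j<k. \<Sum>l<k. med3 (x i) (x j) (x l)\<bar> \<le> (\<Sum>i<k. \<Sum>j<k. \<Sum>l<k. \<bar>med3 (x i) (x j) (x l)\<bar>)"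
    by (intro order_trans[OF sum_abs] sum_mono) auto
  also have "\<dots> \<le> (\<Sum>i<k. \<Sum>j<k. \<Sum>l<k. \<bar>x i\<bar> + \<bar>x j\<bar> + \<bar>x l\<bar>)"
    by (intro sum_mono abs_med3_le)
  also have "\<dots> = 3 * real k ^ 2 * (\<Sum>i<k. \<bar>x i\<bar>)"
    by (simp add: sum.distrib sum_distrib_left[symmetric] power2_eq_square)
  finally have "\<bar>\<Sum>i<k. \<Sum>j<k. \<Sum>l<k. med3 (x i) (x j) (x l)\<bar> / real k ^ 3 \<le>
      3 * real k ^ 2 * (\<Sum>i<k. \<bar>x i\<bar>) / real k ^ 3"
    by (rule divide_right_mono) simp
  also have "\<dots> = 3 / real k * (\<Sum>i<k. \<bar>x i\<bar>)"
    using k by (simp add: power2_eq_square power3_eq_cube)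
  finally show ?thesis by (simp add: med_mean_def)
qed

text \<open>\<open>3 h^2 - 2 h^3\<close> is the probability that at least two of three independent
  events of probability \<open>h\<close> occur. The difference has the factor \<open>h - h'\<close>
  with cofactor \<open>3 (h - h^2) + 3 (h' - h'^2) + (h - h')^2\<close>. Young's inequality splits
  the two mixed products, and \<open>9 / 4 + 9 / 4 + 1 \<le> 6\<close> accounts for the
  constant.\<close>

lemma smoothstep_diff_le:
  fixes h h' \<eta> :: real
  assumes h: "0 \<le> h" "h \<le> 1" and h': "0 \<le> h'" "h' \<le> 1" and \<eta>: "0 < \<eta>" "\<eta> \<le> 1"
  shows "\<bar>(3 * h\<^sup>2 - 2 * h ^ 3) - (3 * h'\<^sup>2 - 2 * h' ^ 3)\<bar> \<le>
    \<eta> * ((h - h\<^sup>2) + (h' - h'\<^sup>2)) + 6 / \<eta> * (h - h')\<^sup>2"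
proof -
  define d where "d = \<bar>h - h'\<bar>"
  have d: "0 \<le> d" "d \<le> 1" using h h' by (auto simp: d_def)
  have young: "3 * d * v \<le> \<eta> * v + 9 / (4 * \<eta>) * d\<^sup>2" if v: "0 \<le> v" "v \<le> 1" for v
  proof -
    have "0 \<le> (\<eta> * v - 3 * d / 2)\<^sup>2 / \<eta>" using \<eta> by simp
    also have "\<dots> = \<eta> * v\<^sup>2 - 3 * d * v + 9 / (4 * \<eta>) * d\<^sup>2"
      using \<eta> by (simp add: power2_eq_square field_simps)
    also have "\<eta> * v\<^sup>2 \<le> \<eta> * v"
      using \<eta> v by (intro mult_left_mono) (auto simp: power2_eq_square mult_left_le)
    finally show ?thesis by simp
  qed
  have "0 \<le> t - t\<^sup>2 \<and> t - t\<^sup>2 \<le> 1" if "0 \<le> t" "t \<le> 1" for t :: real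
    using that zero_le_power2[of t] mult_left_le[of t t] unfolding power2_eq_square by linarith
  then have v: "0 \<le> h - h\<^sup>2" "h - h\<^sup>2 \<le> 1" "0 \<le> h' - h'\<^sup>2" "h' - h'\<^sup>2 \<le> 1"
    using h h' by auto
  have "(3 * h\<^sup>2 - 2 * h ^ 3) - (3 * h'\<^sup>2 - 2 * h' ^ 3) =
      (h - h') * (3 * (h - h\<^sup>2) + 3 * (h' - h'\<^sup>2) + (h - h')\<^sup>2)"
    by (simp add: power2_eq_square power3_eq_cube algebra_simps)
  then have "\<bar>(3 * h\<^sup>2 - 2 * h ^ 3) - (3 * h'\<^sup>2 - 2 * h' ^ 3)\<bar> =
      d * (3 * (h - h\<^sup>2) + 3 * (h' - h'\<^sup>2) + d\<^sup>2)"
    using v by (simp add: abs_mult d_def)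
  also have "\<dots> = 3 * d * (h - h\<^sup>2) + 3 * d * (h' - h'\<^sup>2) + d * d\<^sup>2" by (simp add: algebra_simps)
  also have "\<dots> \<le> (\<eta> * (h - h\<^sup>2) + 9 / (4 * \<eta>) * d\<^sup>2) + (\<eta> * (h' - h'\<^sup>2) + 9 / (4 * \<eta>) * d\<^sup>2) + 1 * d\<^sup>2"
    using young v d by (intro add_mono mult_right_mono) auto
  also have "\<dots> \<le> \<eta> * ((h - h\<^sup>2) + (h' - h'\<^sup>2)) + 6 / \<eta> * d\<^sup>2"
  proof -
    have "1 \<le> 1 / \<eta>" using \<eta> by simp
    then have "9 / (4 * \<eta>) + 9 / (4 * \<eta>) + 1 \<le> 6 / \<eta>" using \<eta> by (simp add: field_simps)
    from mult_right_mono[OF this, of "d\<^sup>2"] show ?thesis by (simp add: algebra_simps)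
  qed
  finally show ?thesis by (simp add: d_def)
qed

abbreviation below :: "real \<Rightarrow> real \<Rightarrow> real" where
  "below a r \<equiv> of_bool (r \<le> a)"

lemma has_integral_below:
  assumes "- B \<le> a" "a \<le> B"
  shows "(below a has_integral (a + B)) {- B..B}"
proof -
  have "((\<lambda>r. 1 :: real) has_integral (a + B)) {- B..a}"
    using has_integral_const_real[of "1 :: real" "- B" a] assms by simp
  moreover have "{- B..a} \<subseteq> {- B..B}" using assms by auto
  ultimately have "((\<lambda>r. if r \<in> {- B..a} then 1 else 0 :: real) has_integral (a + B)) {- B..B}"
    by (subst has_integral_restrict)
  then show ?thesis
    by (rule has_integral_eq[rotated]) auto
qed

text \<open>Layer-cake argument: with \<open>h r\<close> the proportion of the \<open>x i\<close> above \<open>r\<close>, the mean median is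
  the integral of \<open>3 h\<^sup>2 - 2 h\<^sup>3\<close>, the mean distance within a family that of \<open>2 (h - h\<^sup>2)\<close>, and the
  last bracket below that of the square of the difference of the two proportions.\<close>

lemma med_mean_diff_le:
  assumes k: "0 < k" and \<eta>: "0 < \<eta>" "\<eta> \<le> 1"
  shows "\<bar>med_mean k x - med_mean k z\<bar> \<le> (\<Sum>i<k. \<Sum>j<k. \<eta> / 2 * (\<bar>x i - x j\<bar> + \<bar>z i - z j\<bar>) +
    6 / \<eta> * (\<bar>z i - x j\<bar> - (\<bar>x i - x j\<bar> + \<bar>z i - z j\<bar>) / 2)) / (real k)\<^sup>2"
proof -
  \<comment> \<open>All values lie between \<open>- B\<close> and \<open>B\<close>, so the
    layer-cake integrals extend over a compact interval; the offset \<open>B\<close> cancels in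
    differences.\<close>
  define B where "B = (\<Sum>i<k. \<bar>x i\<bar>) + (\<Sum>i<k. \<bar>z i\<bar>)"
  have Bx: "\<bar>x i\<bar> \<le> B" and Bz: "\<bar>z i\<bar> \<le> B" if "i < k" for i
  proof -
    have "\<bar>x i\<bar> \<le> (\<Sum>i<k. \<bar>x i\<bar>)" "\<bar>z i\<bar> \<le> (\<Sum>i<k. \<bar>z i\<bar>)"
      using that by (auto intro!: member_le_sum)
    moreover have "0 \<le> (\<Sum>i<k. \<bar>x i\<bar>)" "0 \<le> (\<Sum>i<k. \<bar>z i\<bar>)" by (auto intro: sum_nonneg)
    ultimately show "\<bar>x i\<bar> \<le> B" "\<bar>z i\<bar> \<le> B" unfolding B_def by linarith+
  qed
  define dd where "dd a b r = below (max a b) r - below (min a b) r" for a b r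
  have dd: "(dd a b has_integral \<bar>a - b\<bar>) {- B..B}" if "\<bar>a\<bar> \<le> B" "\<bar>b\<bar> \<le> B" for a b
  proof -
    have "(dd a b has_integral (max a b + B) - (min a b + B)) {- B..B}"
      unfolding dd_def using that by (intro has_integral_diff has_integral_below) auto
    moreover have "(max a b + B) - (min a b + B) = \<bar>a - b\<bar>" by auto
    ultimately show ?thesis by simp
  qed
  have med: "(below (med3 a b c) has_integral (med3 a b c + B)) {- B..B}"
    if "\<bar>a\<bar> \<le> B" "\<bar>b\<bar> \<le> B" "\<bar>c\<bar> \<le> B" for a b c
    using that by (intro has_integral_below) (auto simp: med3_def max_def min_def)
  define lhs where "lhs u r = (\<Sum>i<k. \<Sum>j<k. \<Sum>l<k. below (med3 (u i) (u j) (u l)) r) / real k ^ 3" for u r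
  have lhs: "(lhs u has_integral (med_mean k u + B)) {- B..B}" if "\<And>i. i < k \<Longrightarrow> \<bar>u i\<bar> \<le> B" for u
  proof -
    have "(lhs u has_integral (\<Sum>i<k. \<Sum>j<k. \<Sum>l<k. med3 (u i) (u j) (u l) + B) / real k ^ 3) {- B..B}"
      unfolding lhs_def by (intro has_integral_divide has_integral_sum med that) auto
    moreover have "(\<Sum>i<k. \<Sum>j<k. \<Sum>l<k. med3 (u i) (u j) (u l) + B) / real k ^ 3 = med_mean k u + B"
      using k by (simp add: med_mean_def sum.distrib field_simps power3_eq_cube)
    ultimately show ?thesis by simp
  qed
  define rhs where "rhs r = (\<Sum>i<k. \<Sum>j<k. \<eta> / 2 * (dd (x i) (x j) r + dd (z i) (z j) r) +
    6 / \<eta> * (dd (z i) (x j) r - (dd (x i) (x j) r + dd (z i) (z j) r) / 2)) / (real k)\<^sup>2" for r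
  let ?R = "(\<Sum>i<k. \<Sum>j<k. \<eta> / 2 * (\<bar>x i - x j\<bar> + \<bar>z i - z j\<bar>) +
    6 / \<eta> * (\<bar>z i - x j\<bar> - (\<bar>x i - x j\<bar> + \<bar>z i - z j\<bar>) / 2)) / (real k)\<^sup>2"
  have rhs: "(rhs has_integral ?R) {- B..B}"
    unfolding rhs_def
    by (intro has_integral_divide has_integral_sum has_integral_add has_integral_diff has_integral_mult_right dd Bx Bz) auto
  have pt: "\<bar>lhs x r - lhs z r\<bar> \<le> rhs r" for r
  proof -
    define H where "H u = (\<Sum>i<k. below (u i) r) / real k" for u
    have Hsum: "(\<Sum>i<k. below (u i) r) = real k * H u" for u using k by (simp add: H_def)
    have H01: "0 \<le> H u" "H u \<le> 1" for u
    proof -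
      have "(\<Sum>i<k. below (u i) r) \<le> (\<Sum>i<k. 1)" by (intro sum_mono) auto
      then show "H u \<le> 1" using k by (simp add: H_def)
      show "0 \<le> H u" by (auto simp: H_def intro!: divide_nonneg_nonneg sum_nonneg)
    qed
    \<comment> \<open>The median is at least \<open>r\<close> iff two of the three numbers are.
      Expressing this, and the interval indicator \<open>dd\<close>, as polynomials in the single
      indicators makes the multiple sums factor into powers of \<open>H\<close>.\<close>
    have b3: "below (med3 a b c) r = below a r * below b r + below a r * below c r + below b r * below c r
        - 2 * (below a r * below b r * below c r)" for a b c
      by (auto simp: med3_def)
    have bd: "dd a b r = below a r + below b r - 2 * (below a r * below b r)" for a b
      by (auto simp: dd_def max_def min_def)
    have L: "lhs u r = 3 * (H u)\<^sup>2 - 2 * (H u) ^ 3" for u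
    proof -
      let ?b = "\<lambda>i. below (u i) r"
      have "(\<Sum>i<k. \<Sum>j<k. \<Sum>l<k. below (med3 (u i) (u j) (u l)) r) =
          (\<Sum>i<k. \<Sum>j<k. \<Sum>l<k. ?b i * ?b j) + (\<Sum>i<k. \<Sum>j<k. \<Sum>l<k. ?b i * ?b l)
          + (\<Sum>i<k. \<Sum>j<k. \<Sum>l<k. ?b j * ?b l) - 2 * (\<Sum>i<k. \<Sum>j<k. \<Sum>l<k. ?b i * ?b j * ?b l)"
        unfolding b3 sum.distrib sum_subtractf sum_distrib_left ..
      also have "\<dots> = 3 * (real k * (real k * H u)\<^sup>2) - 2 * (real k * H u) ^ 3"
        by (simp only: sum_distrib_left[symmetric] sum_distrib_right[symmetric] Hsum sum_constant card_lessThan)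
           (simp add: power2_eq_square power3_eq_cube)
      finally show ?thesis using k by (simp add: lhs_def field_simps power2_eq_square power3_eq_cube)
    qed
    have D: "(\<Sum>i<k. \<Sum>j<k. dd (u i) (w j) r) = (real k)\<^sup>2 * (H u + H w - 2 * (H u * H w))" for u w
    proof -
      have "(\<Sum>i<k. \<Sum>j<k. dd (u i) (w j) r) = (\<Sum>i<k. \<Sum>j<k. below (u i) r) + (\<Sum>i<k. \<Sum>j<k. below (w j) r)
          - 2 * (\<Sum>i<k. \<Sum>j<k. below (u i) r * below (w j) r)"
        unfolding bd sum.distrib sum_subtractf sum_distrib_left ..
      also have "\<dots> = (real k)\<^sup>2 * (H u + H w - 2 * (H u * H w))"
        by (simp only: sum_distrib_left[symmetric] sum_distrib_right[symmetric] Hsum sum_constant card_lessThan)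
           (simp add: power2_eq_square algebra_simps)
      finally show ?thesis .
    qed
    have "rhs r = (\<eta> / 2 * ((\<Sum>i<k. \<Sum>j<k. dd (x i) (x j) r) + (\<Sum>i<k. \<Sum>j<k. dd (z i) (z j) r)) +
        6 / \<eta> * ((\<Sum>i<k. \<Sum>j<k. dd (z i) (x j) r) -
          ((\<Sum>i<k. \<Sum>j<k. dd (x i) (x j) r) + (\<Sum>i<k. \<Sum>j<k. dd (z i) (z j) r)) / 2)) / (real k)\<^sup>2"
      unfolding rhs_def
      by (simp only: sum.distrib sum_subtractf sum_distrib_left[symmetric] sum_divide_distrib[symmetric])
    also have "\<dots> = \<eta> * ((H x - (H x)\<^sup>2) + (H z - (H z)\<^sup>2)) + 6 / \<eta> * (H x - H z)\<^sup>2"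
      unfolding D using k \<eta> by (simp add: field_simps power2_eq_square)
    finally show ?thesis unfolding L using smoothstep_diff_le[OF H01 H01 \<eta>] by simp
  qed
  have d: "((\<lambda>r. lhs x r - lhs z r) has_integral (med_mean k x - med_mean k z)) {- B..B}"
    using has_integral_diff[OF lhs[OF Bx] lhs[OF Bz]] by simp
  have "med_mean k x - med_mean k z \<le> ?R"
    by (rule has_integral_le[OF d rhs]) (use pt in \<open>auto simp: abs_le_iff\<close>)
  moreover have "- (med_mean k x - med_mean k z) \<le> ?R"
    by (rule has_integral_le[OF has_integral_neg[OF d] rhs]) (use pt in \<open>auto simp: abs_le_iff\<close>)
  ultimately show ?thesis by linarith
qed

lemma has_sum_finite_sum:
  fixes f :: "'i \<Rightarrow> 'a \<Rightarrow> 'b::topological_comm_monoid_add"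
  assumes "\<And>i. i \<in> I \<Longrightarrow> (f i has_sum s i) A"
  shows "((\<lambda>x. \<Sum>i\<in>I. f i x) has_sum (\<Sum>i\<in>I. s i)) A"
  using assms by (induction I rule: infinite_finite_induct) (auto intro: has_sum_add)

lemma has_sum_diff_real:
  fixes f g :: "'a \<Rightarrow> real"
  assumes "(f has_sum s) A" "(g has_sum t) A"
  shows "((\<lambda>x. f x - g x) has_sum (s - t)) A"
  using has_sum_add[OF assms(1) has_sum_uminusI[OF assms(2)]] by simp

text \<open>Coordinatewise means of medians commute with permuting coordinates and with adding
  \<open>b g\<close>, so the moved mean is the mean of the moved family \<open>z\<close>.
  \<open>med_mean_diff_le\<close> compares the two in each coordinate, and as \<open>a g\<close> is
  isometric both families have the same mutual distances.\<close>

lemma (in nspace) approx_mean_l1: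
  fixes coord :: "'v \<Rightarrow> 'w \<Rightarrow> real" and a :: "'g \<Rightarrow> 'v \<Rightarrow> 'v" and \<tau> :: "'g \<Rightarrow> 'w \<Rightarrow> 'w"
  assumes coord_add: "\<And>x y w. x \<in> V \<Longrightarrow> y \<in> V \<Longrightarrow> coord (x + y) w = coord x w + coord y w"
    and coord_supp: "\<And>x w. x \<in> V \<Longrightarrow> w \<notin> \<Omega> \<Longrightarrow> coord x w = 0"
    and coord_summable: "\<And>x. x \<in> V \<Longrightarrow> (\<lambda>w. \<bar>coord x w\<bar>) summable_on UNIV"
    and coord_surj: "\<And>f. (\<And>w. w \<notin> \<Omega> \<Longrightarrow> f w = 0) \<Longrightarrow> (\<lambda>w. \<bar>f w\<bar>) summable_on UNIV \<Longrightarrow> \<exists>x\<in>V. coord x = f"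
    and N_coord: "\<And>x. x \<in> V \<Longrightarrow> N x = (\<Sum>\<^sub>\<infinity>w. \<bar>coord x w\<bar>)"
    and a: "\<And>g x. x \<in> V \<Longrightarrow> a g x \<in> V"
    and a_add: "\<And>g x y. x \<in> V \<Longrightarrow> y \<in> V \<Longrightarrow> a g (x + y) = a g x + a g y"
    and a_iso: "\<And>g x. x \<in> V \<Longrightarrow> N (a g x) = N x"
    and a_coord: "\<And>g x w. x \<in> V \<Longrightarrow> w \<in> \<Omega> \<Longrightarrow> coord (a g x) w = coord x (\<tau> g w)"
  shows "approx_mean V N a"
  unfolding approx_mean_def
proof (intro allI impI)
  fix k :: nat and x :: "nat \<Rightarrow> 'v" and F :: "'g set" and b :: "'g \<Rightarrow> 'v" and \<eta> \<epsilon> R :: real and c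
  assume k: "0 < k" and "\<forall>i<k. x i \<in> V \<and> N (x i) \<le> R" and F: "finite F" and "\<forall>g\<in>F. b g \<in> V"
    and \<eta>: "0 < \<eta>" "\<eta> \<le> 1" and \<epsilon>: "0 < \<epsilon>"
    and "\<forall>g\<in>F. 0 \<le> c g \<and> (\<Sum>i<k. \<Sum>j<k. \<eta> * N (x i - x j) +
        6 / \<eta> * (N (a g (x i) + b g - x j) - N (x i - x j))) \<le> c g * (real k)\<^sup>2"
  then have x: "\<And>i. i < k \<Longrightarrow> x i \<in> V" and xR: "\<And>i. i < k \<Longrightarrow> N (x i) \<le> R"
    and b: "\<And>g. g \<in> F \<Longrightarrow> b g \<in> V"
    and cb: "\<And>g. g \<in> F \<Longrightarrow> (\<Sum>i<k. \<Sum>j<k. \<eta> * N (x i - x j) +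
        6 / \<eta> * (N (a g (x i) + b g - x j) - N (x i - x j))) \<le> c g * (real k)\<^sup>2"
    by auto
  have coord_diff: "coord (u - v) w = coord u w - coord v w" if "u \<in> V" "v \<in> V" for u v w
    using coord_add[OF diff_in[OF that] that(2), of w] by simp
  \<comment> \<open>With the guard the whole argument of \<open>med_mean\<close> is zero off
    \<open>\<Omega>\<close>; for \<open>i \<ge> k\<close> nothing is known about
    \<open>x i\<close>.\<close>
  define f where "f w = med_mean k (\<lambda>i. if i < k then coord (x i) w else 0)" for w
  have f_eq: "f w = med_mean k (\<lambda>i. coord (x i) w)" for w by (simp add: f_def med_mean_def)
  have bd: "\<bar>f w\<bar> \<le> 3 / real k * (\<Sum>i<k. \<bar>coord (x i) w\<bar>)" for w
    unfolding f_eq by (rule abs_med_mean_le[OF k])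
  have bs: "((\<lambda>w. 3 / real k * (\<Sum>i<k. \<bar>coord (x i) w\<bar>)) has_sum (3 / real k * (\<Sum>i<k. N (x i)))) UNIV"
    using x N_coord coord_summable
    by (intro has_sum_cmult_right has_sum_finite_sum) (auto simp: has_sum_infsum)
  have fs: "(\<lambda>w. \<bar>f w\<bar>) summable_on UNIV"
    by (rule summable_on_comparison_test[OF has_sum_imp_summable[OF bs] bd]) auto
  have f0: "f w = 0" if "w \<notin> \<Omega>" for w
  proof -
    have "(\<lambda>i. if i < k then coord (x i) w else 0) = (\<lambda>_. 0)"
      using coord_supp[OF x that] by auto
    then show ?thesis by (simp add: f_def med_mean_zero)
  qed
  obtain y where y: "y \<in> V" "coord y = f" using coord_surj[OF f0 fs] by blast
  have "N y \<le> 3 * R"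
  proof -
    have "N y \<le> 3 / real k * (\<Sum>i<k. N (x i))"
      unfolding N_coord[OF y(1)] y(2)
      using infsum_mono[OF fs has_sum_imp_summable[OF bs] bd] infsumI[OF bs] by simp
    also have "\<dots> \<le> 3 / real k * (\<Sum>i<k. R)" using xR by (intro mult_left_mono sum_mono) auto
    also have "\<dots> = 3 * R" using k by simp
    finally show ?thesis .
  qed
  moreover have "N (a g y + b g - y) \<le> c g" if g: "g \<in> F" for g
  proof -
    define z where "z i = a g (x i) + b g" for i
    have z: "z i \<in> V" if "i < k" for i using that x a b[OF g] by (auto simp: z_def intro: add_in)
    have zz: "N (z i - z j) = N (x i - x j)" if "i < k" "j < k" for i j
    proof -
      have "a g (x i) = a g (x i - x j) + a g (x j)"
        using a_add[OF diff_in[OF x[OF that(1)] x[OF that(2)]] x[OF that(2)], of g] by simp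
      then have "z i - z j = a g (x i - x j)" by (simp add: z_def)
      then show ?thesis using a_iso[OF diff_in] x that by simp
    qed
    have yb: "a g y + b g - y \<in> V" using a y b[OF g] by (auto intro: add_in diff_in)
    have cz: "coord (a g y + b g - y) w = med_mean k (\<lambda>i. coord (z i) w) - med_mean k (\<lambda>i. coord (x i) w)" for w
    proof -
      have 1: "coord (a g y + b g - y) w = coord (a g y) w + coord (b g) w - f w"
        using coord_diff[OF add_in[OF a[OF y(1)] b[OF g]] y(1)] coord_add[OF a[OF y(1)] b[OF g]] y(2) by simp
      have z_eq: "med_mean k (\<lambda>i. coord (z i) w) = med_mean k (\<lambda>i. if i < k then coord (z i) w else 0)"
        by (simp add: med_mean_def)
      show ?thesis
      proof (cases "w \<in> \<Omega>")
        case True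
        have "coord (a g y) w + coord (b g) w = med_mean k (\<lambda>i. coord (x i) (\<tau> g w) + coord (b g) w)"
          using a_coord[OF y(1) True] y(2) by (simp add: f_eq med_mean_shift[OF k])
        also have "\<dots> = med_mean k (\<lambda>i. coord (z i) w)"
          unfolding med_mean_def
          using coord_add[OF a b[OF g]] x a_coord[OF x True] by (simp add: z_def)
        finally show ?thesis using 1 by (simp add: f_eq)
      next
        case False
        have "(\<lambda>i. if i < k then coord (z i) w else 0) = (\<lambda>_. 0)"
          using coord_supp[OF z False] by auto
        then show ?thesis
          using 1 f0[OF False] coord_supp[OF a[OF y(1)] False] coord_supp[OF b[OF g] False]
          by (simp add: z_eq med_mean_zero f_eq)
      qed
    qed
    define rhs where "rhs w = (\<Sum>i<k. \<Sum>j<k. \<eta> / 2 * (\<bar>coord (x i - x j) w\<bar> + \<bar>coord (z i - z j) w\<bar>) +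
      6 / \<eta> * (\<bar>coord (z i - x j) w\<bar> - (\<bar>coord (x i - x j) w\<bar> + \<bar>coord (z i - z j) w\<bar>) / 2)) / (real k)\<^sup>2" for w
    have hs: "((\<lambda>w. \<bar>coord u w\<bar>) has_sum N u) UNIV" if "u \<in> V" for u
      unfolding N_coord[OF that] by (rule has_sum_infsum[OF coord_summable[OF that]])
    have rs: "(rhs has_sum (\<Sum>i<k. \<Sum>j<k. \<eta> / 2 * (N (x i - x j) + N (z i - z j)) +
      6 / \<eta> * (N (z i - x j) - (N (x i - x j) + N (z i - z j)) / 2)) / (real k)\<^sup>2) UNIV"
      unfolding rhs_def divide_inverse[of _ "(real k)\<^sup>2"] divide_inverse[of _ "2 :: real"]
      by (intro has_sum_cmult_left has_sum_finite_sum has_sum_add has_sum_diff_real has_sum_cmult_right hs diff_in x z) auto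
    have "\<bar>coord (a g y + b g - y) w\<bar> \<le> rhs w" for w
    proof -
      have "rhs w = (\<Sum>i<k. \<Sum>j<k. \<eta> / 2 * (\<bar>coord (x i) w - coord (x j) w\<bar> + \<bar>coord (z i) w - coord (z j) w\<bar>) +
        6 / \<eta> * (\<bar>coord (z i) w - coord (x j) w\<bar> - (\<bar>coord (x i) w - coord (x j) w\<bar> + \<bar>coord (z i) w - coord (z j) w\<bar>) / 2)) / (real k)\<^sup>2"
        unfolding rhs_def by (simp add: coord_diff x z)
      then show ?thesis
        unfolding cz using med_mean_diff_le[OF k \<eta>, of "\<lambda>i. coord (x i) w" "\<lambda>i. coord (z i) w"]
        by (simp add: abs_minus_commute)
    qed
    then have "N (a g y + b g - y) \<le> (\<Sum>i<k. \<Sum>j<k. \<eta> / 2 * (N (x i - x j) + N (z i - z j)) +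
      6 / \<eta> * (N (z i - x j) - (N (x i - x j) + N (z i - z j)) / 2)) / (real k)\<^sup>2"
      by (rule has_sum_mono[OF hs[OF yb] rs])
    also have "\<dots> = (\<Sum>i<k. \<Sum>j<k. \<eta> * N (x i - x j) +
        6 / \<eta> * (N (a g (x i) + b g - x j) - N (x i - x j))) / (real k)\<^sup>2"
      using zz by (intro arg_cong2[where f = "(/)"] sum.cong refl) (simp add: z_def)
    also have "\<dots> \<le> c g" using cb[OF g] k by (simp add: field_simps)
    finally show ?thesis .
  qed
  ultimately show "\<exists>y\<in>V. N y \<le> 3 * R + \<epsilon> \<and> (\<forall>g\<in>F. N (a g y + b g - y) \<le> c g + \<epsilon>)"
    using y(1) \<epsilon> by (intro bexI[of _ y] conjI ballI) (auto intro: add_increasing2)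
qed

section \<open>Fixed points of affine isometries of a dual space\<close>

lemma sum_lessThan_add:
  "(\<Sum>i<m + n. f i) = (\<Sum>i<m. f i) + (\<Sum>i<n. f (m + i) :: real)" for m n :: nat
  by (induction n) (auto simp: add.assoc)

text \<open>A family of orbit points that almost maximises the mean mutual distance is almost at mean
  distance zero (in the sense required by \<open>approx_mean\<close>) from each of its translates, because
  joining a family with a translate cannot increase the maximum.\<close>

lemma (in dual_pair) affine_fixed_point:
  fixes a1 a2 :: "'g::semigroup_mult \<Rightarrow> 'v \<Rightarrow> 'v" and st :: "'g \<Rightarrow> 'g" and c :: "'g \<Rightarrow> 'v"
  assumes mean: "approx_mean W M a2"
    and a1: "\<And>g x. x \<in> V \<Longrightarrow> a1 g x \<in> V"
    and a1_add: "\<And>g x y. x \<in> V \<Longrightarrow> y \<in> V \<Longrightarrow> a1 g (x + y) = a1 g x + a1 g y"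
    and a2: "\<And>g x. x \<in> W \<Longrightarrow> a2 g x \<in> W"
    and a2_add: "\<And>g x y. x \<in> W \<Longrightarrow> y \<in> W \<Longrightarrow> a2 g (x + y) = a2 g x + a2 g y"
    and a2_iso: "\<And>g x. x \<in> W \<Longrightarrow> M (a2 g x) = M x"
    and adj: "\<And>g \<phi> x. \<phi> \<in> W \<Longrightarrow> x \<in> V \<Longrightarrow> pr (a2 g \<phi>) x = pr \<phi> (a1 (st g) x)"
    and c: "\<And>g. c g \<in> W" and cocycle: "\<And>g t. a2 g (c t) + c g = c (g * t)"
    and bound: "\<And>g. M (c g) \<le> R"
  obtains y where "y \<in> W" "\<And>g. a2 g y + c g = y"
proof -
  have R: "0 \<le> R" using W.N_nonneg[OF c] bound order_trans by blast
  define D where "D s t = M (c s - c t)" for s t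
  have D0: "0 \<le> D s t" for s t unfolding D_def by (intro W.N_nonneg W.diff_in c)
  have D_sym: "D s t = D t s" for s t
    unfolding D_def using W.N_minus[OF W.diff_in[OF c[of s] c[of t]]] by simp
  have D_R: "D s t \<le> 2 * R" for s t
    unfolding D_def using W.N_diff[OF c[of s] c[of t]] bound[of s] bound[of t] by simp
  have D_inv: "D (g * s) (g * t) = D s t" for g s t
  proof -
    have "a2 g (c s) = a2 g (c s - c t) + a2 g (c t)"
      using a2_add[OF W.diff_in[OF c c] c, of g s t t] by simp
    then have "c (g * s) - c (g * t) = a2 g (c s - c t)"
      unfolding cocycle[symmetric] by simp
    then show ?thesis unfolding D_def using a2_iso[OF W.diff_in[OF c c]] by simp
  qed
  define en where "en k t = (\<Sum>i<k. \<Sum>j<k. D (t i) (t j)) / (real k)\<^sup>2" for k and t :: "nat \<Rightarrow> 'g"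
  have en_le: "en k t \<le> 2 * R" if "0 < k" for k t
  proof -
    have "(\<Sum>i<k. \<Sum>j<k. D (t i) (t j)) \<le> (\<Sum>i<k. \<Sum>j<k. 2 * R)" by (intro sum_mono D_R)
    then show ?thesis using that by (simp add: en_def field_simps power2_eq_square)
  qed
  define S where "S = {en k t | k t. 0 < k}"
  have bdd: "bdd_above S" using en_le by (auto simp: S_def intro!: bdd_aboveI[of _ "2 * R"])
  have ne: "S \<noteq> {}" unfolding S_def using zero_less_one[where 'a = nat] by blast
  have trans: "(\<Sum>i<k. \<Sum>j<k. D (g * t i) (t j)) \<le> (2 * Sup S - en k t) * (real k)\<^sup>2" if k: "0 < k" for k t g
  proof -
    \<comment> \<open>The join of the family with its translate has \<open>2 * k\<close> members. By
      invariance its two halves have equal energy, so comparison with the supremum bounds the cross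
      terms.\<close>
    define t' where "t' i = (if i < k then t i else g * t (i - k))" for i
    have swap: "(\<Sum>i<k. \<Sum>j<k. D (t i) (g * t j)) = (\<Sum>i<k. \<Sum>j<k. D (g * t i) (t j))"
      by (subst sum.swap) (simp add: D_sym)
    have e: "(\<Sum>i<k. \<Sum>j<k. D (t i) (t j)) = en k t * (real k)\<^sup>2" using k by (simp add: en_def)
    have "(\<Sum>i<k + k. \<Sum>j<k + k. D (t' i) (t' j)) =
        2 * (en k t * (real k)\<^sup>2) + 2 * (\<Sum>i<k. \<Sum>j<k. D (g * t i) (t j))"
      by (simp add: sum_lessThan_add sum.distrib t'_def D_inv swap e)
    moreover have "en (k + k) t' \<le> Sup S"
      using k by (intro cSup_upper bdd) (auto simp: S_def)
    then have "(\<Sum>i<k + k. \<Sum>j<k + k. D (t' i) (t' j)) \<le> Sup S * (4 * (real k)\<^sup>2)"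
      using k by (simp add: en_def field_simps power2_eq_square)
    ultimately show ?thesis by (simp add: algebra_simps)
  qed
  have approx: "\<exists>y\<in>W. M y \<le> 3 * R + 1 \<and> (\<forall>g\<in>F. M (a2 g y + c g - y) \<le> \<epsilon>)"
    if F: "finite F" and \<epsilon>: "0 < \<epsilon>" "\<epsilon> \<le> 1" for F \<epsilon>
  proof -
    \<comment> \<open>The summand \<open>1\<close> keeps the denominator positive. The term with
      factor \<open>\<eta>\<close> costs at most \<open>\<epsilon> / 4\<close>, and
      \<open>6 / \<eta> * (2 * \<delta>)\<close> with the \<open>\<delta>\<close> below equals
      \<open>\<epsilon> / 4\<close>.\<close>
    define \<eta> where "\<eta> = \<epsilon> / (8 * (R + 1))"
    have "\<epsilon> * 1 \<le> 1 * (8 * (R + 1))" using \<epsilon> R by (intro mult_mono) auto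
    then have \<eta>: "0 < \<eta>" "\<eta> \<le> 1" using \<epsilon> R by (auto simp: \<eta>_def)
    have \<eta>R: "\<eta> * (2 * R) \<le> \<epsilon> / 4"
    proof -
      have "\<eta> * (2 * R) \<le> \<eta> * (2 * (R + 1))" using \<eta> by (intro mult_left_mono) auto
      also have "\<dots> = \<epsilon> / 4" using R by (simp add: \<eta>_def field_simps)
      finally show ?thesis .
    qed
    define \<delta> where "\<delta> = \<eta> * \<epsilon> / 48"
    have \<delta>: "0 < \<delta>" using \<eta> \<epsilon> by (simp add: \<delta>_def)
    have "Sup S - \<delta> < Sup S" using \<delta> by simp
    then obtain v where "v \<in> S" "Sup S - \<delta> < v" using ne less_cSupE by blast
    then obtain k t where k: "0 < k" and kt: "Sup S - \<delta> < en k t" unfolding S_def by blast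
    have "\<exists>y\<in>W. M y \<le> 3 * R + \<epsilon> / 2 \<and> (\<forall>g\<in>F. M (a2 g y + c g - y) \<le> \<epsilon> / 2 + \<epsilon> / 2)"
    proof (rule mean[unfolded approx_mean_def, rule_format, of k "\<lambda>i. c (t i)" R F c \<eta> "\<epsilon> / 2" "\<lambda>_. \<epsilon> / 2"])
      show "0 < k" "finite F" "0 < \<eta>" "\<eta> \<le> 1" "0 < \<epsilon> / 2" "c g \<in> W" for g
        using k F \<eta> \<epsilon> c by auto
      show "c (t i) \<in> W \<and> M (c (t i)) \<le> R" for i using c bound by simp
      fix g
      have "(\<Sum>i<k. \<Sum>j<k. \<eta> * M (c (t i) - c (t j)) +
          6 / \<eta> * (M (a2 g (c (t i)) + c g - c (t j)) - M (c (t i) - c (t j)))) =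
          \<eta> * (\<Sum>i<k. \<Sum>j<k. D (t i) (t j)) + 6 / \<eta> * ((\<Sum>i<k. \<Sum>j<k. D (g * t i) (t j)) - (\<Sum>i<k. \<Sum>j<k. D (t i) (t j)))"
        unfolding cocycle D_def by (simp only: sum.distrib sum_subtractf sum_distrib_left[symmetric])
      also have "(\<Sum>i<k. \<Sum>j<k. D (t i) (t j)) = en k t * (real k)\<^sup>2" using k by (simp add: en_def)
      also have "\<eta> * (en k t * (real k)\<^sup>2) + 6 / \<eta> * ((\<Sum>i<k. \<Sum>j<k. D (g * t i) (t j)) - en k t * (real k)\<^sup>2)
          \<le> \<epsilon> / 4 * (real k)\<^sup>2 + 6 / \<eta> * (2 * \<delta> * (real k)\<^sup>2)"
      proof (intro add_mono mult_left_mono)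
        have "\<eta> * en k t \<le> \<eta> * (2 * R)" using en_le[OF k] \<eta> by (intro mult_left_mono) auto
        then have "\<eta> * en k t \<le> \<epsilon> / 4" using \<eta>R by simp
        from mult_right_mono[OF this, of "(real k)\<^sup>2"]
        show "\<eta> * (en k t * (real k)\<^sup>2) \<le> \<epsilon> / 4 * (real k)\<^sup>2" by (simp add: mult.assoc)
        have "(2 * Sup S - en k t) * (real k)\<^sup>2 - en k t * (real k)\<^sup>2 = (2 * (Sup S - en k t)) * (real k)\<^sup>2"
          by (simp add: algebra_simps)
        also have "\<dots> \<le> 2 * \<delta> * (real k)\<^sup>2" using kt by (intro mult_right_mono) auto
        finally show "(\<Sum>i<k. \<Sum>j<k. D (g * t i) (t j)) - en k t * (real k)\<^sup>2 \<le> 2 * \<delta> * (real k)\<^sup>2"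
          using trans[OF k, of g t] by linarith
        show "0 \<le> 6 / \<eta>" using \<eta> by simp
      qed
      also have "\<dots> = \<epsilon> / 2 * (real k)\<^sup>2" using \<eta> by (simp add: \<delta>_def field_simps)
      finally show "0 \<le> \<epsilon> / 2 \<and> (\<Sum>i<k. \<Sum>j<k. \<eta> * M (c (t i) - c (t j)) +
          6 / \<eta> * (M (a2 g (c (t i)) + c g - c (t j)) - M (c (t i) - c (t j)))) \<le> \<epsilon> / 2 * (real k)\<^sup>2"
        using \<epsilon> by simp
    qed
    then obtain y where "y \<in> W" "M y \<le> 3 * R + \<epsilon> / 2" "\<forall>g\<in>F. M (a2 g y + c g - y) \<le> \<epsilon> / 2 + \<epsilon> / 2" by blast
    then show ?thesis using \<epsilon> by (intro bexI[of _ y]) auto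
  qed
  have expand: "pr (a2 g y + c g - y) \<phi> = pr y (a1 (st g) \<phi> - \<phi>) + pr (c g) \<phi>"
    if y: "y \<in> W" and \<phi>: "\<phi> \<in> V" for g y \<phi>
  proof -
    note ad = W.additiveD[OF additive_left[OF \<phi>]] and ad' = Z.additiveD[OF additive_right[OF y]]
    show ?thesis
      using ad(4)[OF W.add_in[OF a2[OF y] c] y] ad(3)[OF a2[OF y] c] ad'(4)[OF a1[OF \<phi>] \<phi>] adj[OF y \<phi>] by simp
  qed
  \<comment> \<open>The tolerance can be \<open>0\<close> here because finitely many test vectors
    never exclude it: displacements in \<open>approx\<close> are as small as desired. Applied to
    \<open>x\<close> and \<open>- x\<close>, the resulting bound becomes the fixed point
    equation.\<close>
  obtain l where l: "additive_on V l" "\<And>x. x \<in> V \<Longrightarrow> l x \<le> (3 * R + 1) * N x"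
    "\<And>g x. g \<in> UNIV \<Longrightarrow> x \<in> V \<Longrightarrow> l (a1 (st g) x - x) + pr (c g) x \<le> 0 * N x"
  proof (rule Z.finite_intersection[of UNIV "\<lambda>g x. a1 (st g) x - x" "\<lambda>g. pr (c g)" "\<lambda>_. 0" "3 * R + 1"])
    show "a1 (st g) x - x \<in> V" if "x \<in> V" for g x using that a1 Z.diff_in by blast
    show "a1 (st g) (x + y) - (x + y) = a1 (st g) x - x + (a1 (st g) y - y)" if "x \<in> V" "y \<in> V" for g x y
      using a1_add[OF that] by simp
    show "additive_on V (pr (c g))" for g by (rule additive_right[OF c])
    show "0 \<le> 3 * R + 1" using R by simp
    fix F :: "'g set" and \<phi> :: "'g \<Rightarrow> 'v" and \<epsilon> :: real
    assume F: "finite F" and \<phi>: "\<And>g. \<phi> g \<in> V" and \<epsilon>: "0 < \<epsilon>"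
    \<comment> \<open>\<open>s\<close> dominates the norms of all test vectors, so a displacement of
      norm \<open>\<epsilon> / s\<close> pairs to at most \<open>\<epsilon>\<close>; the summand
      \<open>1\<close> makes the division legitimate.\<close>
    define s where "s = 1 + (\<Sum>g\<in>F. N (\<phi> g))"
    have s: "N (\<phi> g) \<le> s" "1 \<le> s" if "g \<in> F" for g
      using member_le_sum[OF that, of "\<lambda>g. N (\<phi> g)"] Z.N_nonneg[OF \<phi>] F sum_nonneg[of F "\<lambda>g. N (\<phi> g)"]
      by (auto simp: s_def intro: order_trans)
    have s1: "1 \<le> s" using Z.N_nonneg[OF \<phi>] sum_nonneg[of F "\<lambda>g. N (\<phi> g)"] by (simp add: s_def)
    have "0 < min 1 (\<epsilon> / s)" using \<epsilon> s1 by simp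
    then obtain y where y: "y \<in> W" "M y \<le> 3 * R + 1" "\<And>g. g \<in> F \<Longrightarrow> M (a2 g y + c g - y) \<le> min 1 (\<epsilon> / s)"
      using approx[OF F, of "min 1 (\<epsilon> / s)"] by auto
    show "\<exists>l. additive_on V l \<and> (\<forall>x\<in>V. l x \<le> (3 * R + 1) * N x) \<and>
        (\<forall>g\<in>F. l (a1 (st g) (\<phi> g) - \<phi> g) + pr (c g) (\<phi> g) \<le> 0 * N (\<phi> g) + \<epsilon>)"
    proof (intro exI[of _ "pr y"] conjI ballI)
      show "additive_on V (pr y)" by (rule additive_right[OF y(1)])
      show "pr y x \<le> (3 * R + 1) * N x" if "x \<in> V" for x
        using pr_le[OF y(1) that] mult_right_mono[OF y(2) Z.N_nonneg[OF that]] by simp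
      fix g assume g: "g \<in> F"
      have "pr (a2 g y + c g - y) (\<phi> g) \<le> M (a2 g y + c g - y) * N (\<phi> g)"
        by (intro pr_le W.diff_in W.add_in a2 y(1) c \<phi>)
      also have "\<dots> \<le> \<epsilon> / s * s"
        using y(3)[OF g] s[OF g] \<epsilon> Z.N_nonneg[OF \<phi>] by (intro mult_mono) auto
      also have "\<dots> = \<epsilon>" using s1 by simp
      finally show "pr y (a1 (st g) (\<phi> g) - \<phi> g) + pr (c g) (\<phi> g) \<le> 0 * N (\<phi> g) + \<epsilon>"
        using expand[OF y(1) \<phi>] by simp
    qed
  qed auto
  obtain y where y: "y \<in> W" "\<And>x. x \<in> V \<Longrightarrow> pr y x = l x" using represent[OF l(1,2)] by blast
  have "a2 g y + c g = y" for g
  proof -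
    have in': "a2 g y + c g - y \<in> W" by (intro W.diff_in W.add_in a2 y(1) c)
    have le: "pr (a2 g y + c g - y) x \<le> 0" if x: "x \<in> V" for x
      using expand[OF y(1) x] l(3)[OF UNIV_I x] y(2)[OF Z.diff_in[OF a1[OF x] x]] by simp
    have "a2 g y + c g - y = 0"
    proof (rule pr_ext[OF in' W.zero_in])
      fix x assume x: "x \<in> V"
      have "pr (a2 g y + c g - y) (- x) = - pr (a2 g y + c g - y) x"
        using Z.additiveD(2)[OF additive_right[OF in'] x] .
      then show "pr (a2 g y + c g - y) x = pr 0 x"
        using le[OF x] le[OF Z.minus_in[OF x]] W.additiveD(1)[OF additive_left[OF x]] by simp
    qed
    then show ?thesis by simp
  qed
  with y(1) show ?thesis using that by blast
qed

section \<open>Pushforwards and convolution\<close>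

lemma infsum_fibres:
  fixes f :: "'a \<Rightarrow> 'c::banach"
  assumes "f summable_on {t. h t \<in> B}"
  shows "infsum (\<lambda>u. infsum f {t. h t = u}) B = infsum f {t. h t \<in> B}"
    and "(\<lambda>u. infsum f {t. h t = u}) summable_on B"
proof -
  let ?S = "Sigma B (\<lambda>u. {t. h t = u})"
  have bij: "bij_betw snd ?S {t. h t \<in> B}"
    by (rule bij_betwI[of _ _ _ "\<lambda>t. (h t, t)"]) auto
  have s: "(\<lambda>p. f (snd p)) summable_on ?S"
    using summable_on_reindex_bij_betw[OF bij, of f] assms by simp
  have "infsum (\<lambda>u. infsum f {t. h t = u}) B = infsum (\<lambda>p. f (snd p)) ?S"
    using infsum_Sigma_banach[OF s] by simp
  also have "\<dots> = infsum f {t. h t \<in> B}" by (rule infsum_reindex_bij_betw[OF bij])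
  finally show "infsum (\<lambda>u. infsum f {t. h t = u}) B = infsum f {t. h t \<in> B}" .
  have "(\<lambda>(u, t). f t) summable_on ?S" using s by (simp add: case_prod_unfold)
  from summable_on_Sigma_banach[OF this]
  show "(\<lambda>u. infsum f {t. h t = u}) summable_on B" by simp
qed

lemma l1_summable:
  assumes "f \<in> l1"
  shows "(\<lambda>u. norm (f u)) summable_on A" "f summable_on A"
proof -
  show "(\<lambda>u. norm (f u)) summable_on A"
    using assms unfolding l1_def by (auto intro: summable_on_subset_banach)
  then show "f summable_on A" by (rule abs_summable_summable)
qed

lemma l1_add:
  assumes f: "f \<in> l1" and g: "g \<in> l1"
  shows "(\<lambda>u. f u + g u) \<in> l1" "l1norm (\<lambda>u. f u + g u) \<le> l1norm f + l1norm g"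
proof -
  have s: "(\<lambda>u. norm (f u) + norm (g u)) summable_on UNIV"
    using l1_summable(1)[OF f] l1_summable(1)[OF g] by (rule summable_on_add)
  have s': "(\<lambda>u. norm (f u + g u)) summable_on UNIV"
    by (rule summable_on_comparison_test[OF s norm_triangle_ineq]) auto
  then show "(\<lambda>u. f u + g u) \<in> l1" by (simp add: l1_def)
  have "l1norm (\<lambda>u. f u + g u) \<le> infsum (\<lambda>u. norm (f u) + norm (g u)) UNIV"
    unfolding l1norm_def by (rule infsum_mono[OF s' s norm_triangle_ineq])
  also have "\<dots> = l1norm f + l1norm g" unfolding l1norm_def
    by (rule infsum_add) (use f g l1_summable in auto)
  finally show "l1norm (\<lambda>u. f u + g u) \<le> l1norm f + l1norm g" .
qed

lemma l1_scale:
  assumes f: "f \<in> l1"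
  shows "(\<lambda>u. c * f u) \<in> l1" "l1norm (\<lambda>u. c * f u) = norm c * l1norm f"
  using l1_summable(1)[OF f] unfolding l1_def l1norm_def
  by (auto simp: norm_mult summable_on_cmult_right infsum_cmult_right')

lemma l1_diff:
  assumes f: "f \<in> l1" and g: "g \<in> l1"
  shows "(\<lambda>u. f u - g u) \<in> l1" "l1norm (\<lambda>u. f u - g u) \<le> l1norm f + l1norm g"
  using l1_add[OF f l1_scale(1)[OF g, of "- 1"]] l1_scale(2)[OF g, of "- 1"] by auto

lemma l1_zero: "(\<lambda>_. 0) \<in> l1" "l1norm (\<lambda>_. 0) = 0"
  by (auto simp: l1_def l1norm_def)

lemma l1norm_nonneg: "0 \<le> l1norm f"
  unfolding l1norm_def by (rule infsum_nonneg) auto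

lemma l1norm_eq_0D: "f \<in> l1 \<Longrightarrow> l1norm f \<le> 0 \<Longrightarrow> f u = 0"
  using nonneg_infsum_le_0D[of "\<lambda>u. norm (f u)" UNIV u] by (auto simp: l1_def l1norm_def)

lemma delta_l1: "delta s \<in> l1" "l1norm (delta s) = 1"
proof -
  have "((\<lambda>u. norm (delta s u)) has_sum 1) {s}"
    by (rule has_sum_finiteI) (auto simp: delta_def)
  then have h: "((\<lambda>u. norm (delta s u)) has_sum 1) UNIV"
    by (rule has_sum_cong_neutral[THEN iffD1, rotated 3]) (auto simp: delta_def)
  show "delta s \<in> l1" using has_sum_imp_summable[OF h] by (simp add: l1_def)
  show "l1norm (delta s) = 1" using infsumI[OF h] by (simp add: l1norm_def)
qed

lemma l1_tail_small:
  assumes f: "f \<in> l1" and \<epsilon>: "0 < \<epsilon>"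
  obtains A where "finite A" "l1norm (\<lambda>u. f u - (if u \<in> A then f u else 0)) < \<epsilon>"
proof -
  let ?n = "\<lambda>u. norm (f u)"
  obtain A where A: "finite A" "dist (sum ?n A) (infsum ?n UNIV) \<le> \<epsilon> / 2"
    using infsum_finite_approximation[OF l1_summable(1)[OF f, of UNIV], of "\<epsilon> / 2"] \<epsilon> by auto
  have "l1norm (\<lambda>u. f u - (if u \<in> A then f u else 0)) = infsum ?n (UNIV - A)"
    unfolding l1norm_def by (rule infsum_cong_neutral) auto
  also have "\<dots> = infsum ?n UNIV - sum ?n A"
    using infsum_Diff[OF l1_summable(1)[OF f, of UNIV] l1_summable(1)[OF f, of A]] A(1) by simp
  also have "\<dots> < \<epsilon>" using A(2) \<epsilon> unfolding dist_real_def by linarith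
  finally show ?thesis using that A(1) by blast
qed

text \<open>Together with \<open>l1_tail_small\<close> this extends statements about point masses to
  all of \<open>l1\<close>.\<close>

lemma finite_support_induct:
  assumes "finite A" and zero: "P (\<lambda>_. 0)"
    and step: "\<And>g c s. g \<in> l1 \<Longrightarrow> P g \<Longrightarrow> P (\<lambda>u. g u + c * delta s u)"
  shows "P (\<lambda>u. if u \<in> A then f u else 0)"
proof -
  have "(\<lambda>u. if u \<in> A then f u else 0) \<in> l1 \<and> P (\<lambda>u. if u \<in> A then f u else 0)"
    using \<open>finite A\<close>
  proof (induction A)
    case empty then show ?case using zero l1_zero by simp
  next
    case (insert a A)
    have "(\<lambda>u. if u \<in> insert a A then f u else 0) = (\<lambda>u. (if u \<in> A then f u else 0) + f a * delta a u)"
      using insert.hyps by (auto simp: fun_eq_iff delta_def)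
    then show ?case
      using insert.IH step l1_add(1)[OF conjunct1[OF insert.IH] l1_scale(1)[OF delta_l1(1)]] by simp
  qed
  then show ?thesis by simp
qed

lemma delta_inject: "delta s = delta t \<longleftrightarrow> s = t"
  by (metis delta_def zero_neq_one)

text \<open>The image of a complex measure. Translation, the projection onto the group image, and
  convolution as the image of a product measure all have this form, so identities between them
  reduce to composing maps.\<close>

definition push :: "('a \<Rightarrow> 'b) \<Rightarrow> ('a \<Rightarrow> complex) \<Rightarrow> 'b \<Rightarrow> complex" where
  "push h f = (\<lambda>u. infsum f {t. h t = u})"

lemma push_l1:
  assumes f: "f \<in> l1"
  shows "push h f \<in> l1" "l1norm (push h f) \<le> l1norm f"
proof -
  let ?n = "\<lambda>u. norm (f u)"
  have s: "?n summable_on {t. h t \<in> UNIV}" using l1_summable[OF f] by simp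
  note F = infsum_fibres[OF s]
  have le: "norm (push h f u) \<le> infsum ?n {t. h t = u}" for u
    unfolding push_def by (rule norm_infsum_bound[OF l1_summable(1)[OF f]])
  have s': "(\<lambda>u. norm (push h f u)) summable_on UNIV"
    by (rule summable_on_comparison_test[OF F(2) le]) auto
  then show "push h f \<in> l1" by (simp add: l1_def)
  have "l1norm (push h f) \<le> infsum (\<lambda>u. infsum ?n {t. h t = u}) UNIV"
    unfolding l1norm_def by (rule infsum_mono[OF s' F(2) le])
  then show "l1norm (push h f) \<le> l1norm f" using F(1) by (simp add: l1norm_def)
qed

lemma push_push: "f \<in> l1 \<Longrightarrow> push k (push h f) = push (\<lambda>t. k (h t)) f"
  unfolding push_def using infsum_fibres(1)[of f h] l1_summable(2) by (fastforce simp: fun_eq_iff)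

lemma push_add: "f \<in> l1 \<Longrightarrow> g \<in> l1 \<Longrightarrow> push h (\<lambda>u. f u + g u) = (\<lambda>u. push h f u + push h g u)"
  unfolding push_def by (intro ext infsum_add l1_summable)

lemma push_scale: "push h (\<lambda>u. c * f u) = (\<lambda>u. c * push h f u)"
  unfolding push_def by (intro ext infsum_cmult_right')

lemma push_diff: "f \<in> l1 \<Longrightarrow> g \<in> l1 \<Longrightarrow> push h (\<lambda>u. f u - g u) = (\<lambda>u. push h f u - push h g u)"
  using push_add[of f "\<lambda>u. - 1 * g u" h] l1_scale(1)[of g "- 1"] push_scale[of h "- 1" g] by simp

lemma push_zero: "push h (\<lambda>_. 0) = (\<lambda>_. 0)"
  by (simp add: push_def)

lemma push_delta: "push h (delta s) = delta (h s)"
proof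
  fix u
  have "infsum (delta s) {t. h t = u} = infsum (delta s) (if h s = u then {s} else {})"
    by (rule infsum_cong_neutral) (auto simp: delta_def split: if_splits)
  then show "push h (delta s) u = delta (h s) u"
    by (auto simp: push_def delta_def)
qed

lemma push_supp: "u \<notin> range h \<Longrightarrow> push h f u = 0"
proof -
  assume "u \<notin> range h"
  then have "{t. h t = u} = {}" by auto
  then show ?thesis by (simp add: push_def)
qed

lemma push_id_on:
  assumes "\<And>u. u \<notin> R \<Longrightarrow> f u = 0" "\<And>u. u \<in> R \<Longrightarrow> h u = u" "\<And>u. h u \<in> R"
  shows "push h f = f"
proof
  fix u
  have "infsum f {t. h t = u} = infsum f (if u \<in> R then {u} else {})"
    using assms by (intro infsum_cong_neutral) (auto split: if_splits, metis)
  then show "push h f u = f u" using assms(1)[of u] by (auto simp: push_def)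
qed

definition tens :: "('a \<Rightarrow> complex) \<Rightarrow> ('b \<Rightarrow> complex) \<Rightarrow> 'a \<times> 'b \<Rightarrow> complex" where
  "tens f g = (\<lambda>(s, t). f s * g t)"

lemma tens_l1:
  assumes f: "f \<in> l1" and g: "g \<in> l1"
  shows "tens f g \<in> l1" "l1norm (tens f g) = l1norm f * l1norm g"
proof -
  have eq: "infsum (\<lambda>y. norm (tens f g (x, y))) UNIV = norm (f x) * l1norm g" for x
    by (simp add: tens_def norm_mult l1norm_def infsum_cmult_right')
  have s: "(\<lambda>p. norm (tens f g p)) summable_on (UNIV \<times> UNIV)"
    unfolding Infinite_Sum.abs_summable_on_Sigma_iff eq
    using l1_summable(1)[OF g, of UNIV] l1_summable(1)[OF f, of UNIV] l1norm_nonneg[of g]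
    by (auto simp: tens_def norm_mult intro!: summable_on_cmult_right summable_on_cmult_left)
  then show "tens f g \<in> l1" by (simp add: l1_def)
  have "l1norm (tens f g) = infsum (\<lambda>x. infsum (\<lambda>y. norm (tens f g (x, y))) UNIV) UNIV"
    using infsum_Sigma_banach[OF s] by (simp add: l1norm_def)
  also have "\<dots> = l1norm f * l1norm g"
    unfolding eq by (simp add: infsum_cmult_left' l1norm_def)
  finally show "l1norm (tens f g) = l1norm f * l1norm g" .
qed

lemma infsum_tens_product:
  assumes f: "f \<in> l1" and g: "g \<in> l1"
  shows "infsum (tens f g) (A \<times> B) = infsum f A * infsum g B"
proof -
  have "infsum (tens f g) (A \<times> B) = infsum (\<lambda>x. infsum (\<lambda>y. tens f g (x, y)) B) A"
    by (rule infsum_Sigma_banach[symmetric]) (rule l1_summable(2)[OF tens_l1(1)[OF f g]])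
  also have "\<dots> = infsum (\<lambda>x. f x * infsum g B) A"
    by (simp add: tens_def infsum_cmult_right')
  finally show ?thesis by (simp add: infsum_cmult_left')
qed

lemma push_map_prod_tens:
  fixes h :: "'a \<Rightarrow> 'c" and k :: "'b \<Rightarrow> 'd"
  assumes "f \<in> l1" "g \<in> l1"
  shows "push (map_prod h k) (tens f g) = tens (push h f) (push k g)"
proof
  fix p :: "'c \<times> 'd"
  obtain s t where p: "p = (s, t)" by (cases p)
  have "{w. map_prod h k w = (s, t)} = {a. h a = s} \<times> {b. k b = t}" by auto
  then show "push (map_prod h k) (tens f g) p = tens (push h f) (push k g) p"
    using infsum_tens_product[OF assms, of "{a. h a = s}" "{b. k b = t}"]
    by (simp add: p push_def tens_def)
qed

lemma conv_eq_push: "conv f g = push (\<lambda>(s, t). s * t) (tens f g)"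
  unfolding conv_def push_def tens_def by (auto simp: case_prod_unfold)

lemma conv_l1:
  assumes "f \<in> l1" "g \<in> l1"
  shows "conv f g \<in> l1" "l1norm (conv f g) \<le> l1norm f * l1norm g"
  using push_l1[OF tens_l1(1)[OF assms], of "\<lambda>(s, t). s * t"] tens_l1(2)[OF assms]
  by (auto simp: conv_eq_push)

lemma conv_add_right:
  assumes "f \<in> l1" "g \<in> l1" "g' \<in> l1"
  shows "conv f (\<lambda>u. g u + g' u) = (\<lambda>u. conv f g u + conv f g' u)"
proof -
  have "tens f (\<lambda>u. g u + g' u) = (\<lambda>p. tens f g p + tens f g' p)"
    by (auto simp: tens_def fun_eq_iff algebra_simps)
  then show ?thesis unfolding conv_eq_push
    using push_add[OF tens_l1(1)[OF assms(1,2)] tens_l1(1)[OF assms(1,3)]] by simp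
qed

lemma conv_add_left:
  assumes "f \<in> l1" "f' \<in> l1" "g \<in> l1"
  shows "conv (\<lambda>u. f u + f' u) g = (\<lambda>u. conv f g u + conv f' g u)"
proof -
  have "tens (\<lambda>u. f u + f' u) g = (\<lambda>p. tens f g p + tens f' g p)"
    by (auto simp: tens_def fun_eq_iff algebra_simps)
  then show ?thesis unfolding conv_eq_push
    using push_add[OF tens_l1(1)[OF assms(1,3)] tens_l1(1)[OF assms(2,3)]] by simp
qed

lemma conv_scale_right: "conv f (\<lambda>u. c * g u) = (\<lambda>u. c * conv f g u)"
proof -
  have "tens f (\<lambda>u. c * g u) = (\<lambda>p. c * tens f g p)"
    by (auto simp: tens_def fun_eq_iff)
  then show ?thesis unfolding conv_eq_push by (simp add: push_scale)
qed

lemma conv_scale_left: "conv (\<lambda>u. c * f u) g = (\<lambda>u. c * conv f g u)"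
proof -
  have "tens (\<lambda>u. c * f u) g = (\<lambda>p. c * tens f g p)"
    by (auto simp: tens_def fun_eq_iff)
  then show ?thesis unfolding conv_eq_push by (simp add: push_scale)
qed

lemma tens_delta_left:
  fixes s :: 'a and f :: "'b \<Rightarrow> complex"
  shows "tens (delta s) f = push (Pair s) f"
proof
  fix p :: "'a \<times> 'b"
  obtain a t where p: "p = (a, t)" by (cases p)
  have "{t'. (s, t') = (a, t)} = (if a = s then {t} else {})" by auto
  then show "tens (delta s) f p = push (Pair s) f p"
    by (simp add: p tens_def push_def delta_def)
qed

lemma tens_delta_right:
  fixes s :: 'a and f :: "'b \<Rightarrow> complex"
  shows "tens f (delta s) = push (\<lambda>t. (t, s)) f"
proof
  fix p :: "'b \<times> 'a"
  obtain t a where p: "p = (t, a)" by (cases p)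
  have "{t'. (t', s) = (t, a)} = (if a = s then {t} else {})" by auto
  then show "tens f (delta s) p = push (\<lambda>t. (t, s)) f p"
    by (simp add: p tens_def push_def delta_def)
qed

lemma conv_delta_left: "f \<in> l1 \<Longrightarrow> conv (delta s) f = push (\<lambda>t. s * t) f"
  by (simp add: conv_eq_push tens_delta_left push_push)

lemma conv_delta_right: "f \<in> l1 \<Longrightarrow> conv f (delta s) = push (\<lambda>t. t * s) f"
  by (simp add: conv_eq_push tens_delta_right push_push)

lemma conv_delta_delta: "conv (delta s) (delta t) = delta (s * t)"
  by (simp add: conv_delta_left delta_l1 push_delta)

section \<open>Inverse semigroups\<close>

definition star :: "'s::semigroup_mult \<Rightarrow> 's" where
  "star s = (THE t. s * t * s = s \<and> t * s * t = t)"

context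
  assumes inv: "inverse_semigroup TYPE('s::semigroup_mult)"
begin

lemma star_inverse: "s * star s * s = s" "star s * s * star s = star s" for s :: 's
  using theI'[of "\<lambda>t. s * t * s = s \<and> t * s * t = t"] inv
  unfolding star_def inverse_semigroup_def by blast+

lemma star_unique: "s * t * s = s \<Longrightarrow> t * s * t = t \<Longrightarrow> star s = t" for s :: 's
  using inv star_inverse[of s] unfolding inverse_semigroup_def by metis

lemma star_star: "star (star s) = s" for s :: 's
  by (rule star_unique) (simp_all add: star_inverse)

lemma star_idems: "s * star s \<in> idems" "star s * s \<in> idems" for s :: 's
  unfolding idems_def using star_inverse[of s] by (simp_all add: mult.assoc[symmetric])

text \<open>Along with \<open>x\<close>, also \<open>f * x * e\<close> is an inverse of
  \<open>e * f\<close>; uniqueness gives \<open>x = f * x * e\<close>, which makes \<open>x\<close>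
  idempotent. An idempotent is its own inverse, hence \<open>x = e * f\<close>.\<close>

lemma idems_mult:
  fixes e f :: 's
  assumes e: "e \<in> idems" and f: "f \<in> idems"
  shows "e * f \<in> idems"
proof -
  have ee: "e * e = e" "\<And>z. e * (e * z) = e * z" and ff: "f * f = f" "\<And>z. f * (f * z) = f * z"
    using e f by (auto simp: idems_def mult.assoc[symmetric])
  define x where "x = star (e * f)"
  have x1: "e * (f * (x * (e * f))) = e * f" and x2: "x * (e * (f * x)) = x"
    using star_inverse[of "e * f"] by (simp_all add: x_def mult.assoc)
  have x2': "x * (e * (f * (x * z))) = x * z" for z
    using arg_cong[OF x2, of "\<lambda>w. w * z"] by (simp add: mult.assoc)
  have "star (e * f) = f * x * e"
    by (rule star_unique) (simp_all add: mult.assoc ee ff x1 x2')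
  then have x: "x = f * (x * e)" by (simp add: x_def mult.assoc)
  have "x * x = f * (x * e) * (f * (x * e))" by (rule arg_cong2[OF x x])
  also have "\<dots> = f * (x * e)" by (simp add: mult.assoc x2')
  also have "\<dots> = x" by (rule x[symmetric])
  finally have xx: "x * x = x" .
  have "star x = x" by (rule star_unique) (simp_all add: xx)
  then have "x = e * f" unfolding x_def by (simp add: star_star)
  then show ?thesis using xx by (simp add: idems_def)
qed

text \<open>Since products of idempotents are idempotent, \<open>e * f\<close> and
  \<open>f * e\<close> are both inverses of \<open>e * f\<close>.\<close>

lemma idems_commute:
  fixes e f :: 's
  assumes e: "e \<in> idems" and f: "f \<in> idems"
  shows "e * f = f * e"
proof -
  have ee: "e * e = e" "\<And>z. e * (e * z) = e * z" and ff: "f * f = f" "\<And>z. f * (f * z) = f * z"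
    using e f by (auto simp: idems_def mult.assoc[symmetric])
  have ef: "e * (f * (e * f)) = e * f" using idems_mult[OF e f] by (simp add: idems_def mult.assoc)
  have fe: "f * (e * (f * e)) = f * e" using idems_mult[OF f e] by (simp add: idems_def mult.assoc)
  have "star (e * f) = f * e" by (rule star_unique) (simp_all add: mult.assoc ee ff ef fe)
  moreover have "star (e * f) = e * f" by (rule star_unique) (simp_all add: mult.assoc ee ff ef)
  ultimately show ?thesis by simp
qed

lemma star_mult: "star (s * t) = star t * star s" for s t :: 's
proof (rule star_unique)
  \<comment> \<open>In the products below these two idempotents meet in the middle and are
    interchanged.\<close>
  note c = idems_commute[OF star_idems(2)[of s] star_idems(1)[of t]]
  have "s * t * (star t * star s) * (s * t) = s * ((t * star t) * (star s * s)) * t"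
    by (simp add: mult.assoc)
  also have "\<dots> = (s * star s * s) * (t * star t * t)" unfolding c[symmetric] by (simp add: mult.assoc)
  finally show "s * t * (star t * star s) * (s * t) = s * t" by (simp add: star_inverse)
  have "star t * star s * (s * t) * (star t * star s) = star t * ((star s * s) * (t * star t)) * star s"
    by (simp add: mult.assoc)
  also have "\<dots> = (star t * t * star t) * (star s * s * star s)" unfolding c by (simp add: mult.assoc)
  finally show "star t * star s * (s * t) * (star t * star s) = star t * star s" by (simp add: star_inverse)
qed

end

section \<open>The quotient by the ideal\<close>

locale quotient_tower =
  fixes L :: nat and q :: "('s::semigroup_mult \<Rightarrow> complex) \<Rightarrow> 'v::ab_group_add"
    and sm :: "complex \<Rightarrow> 'v \<Rightarrow> 'v" and V :: "nat \<Rightarrow> 'v set"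
    and pr :: "nat \<Rightarrow> 'v \<Rightarrow> 'v \<Rightarrow> complex" and nv :: "nat \<Rightarrow> 'v \<Rightarrow> real"
  assumes inv: "inverse_semigroup TYPE('s)" and tw: "dual_tower L q sm V pr nv"
begin

context
begin

private lemmas base = tw[unfolded dual_tower_def]

private lemmas step = base[THEN conjunct2, THEN conjunct2, THEN conjunct2, THEN conjunct2,
  THEN conjunct2, THEN conjunct2, THEN conjunct2, rule_format]

lemma q_in: "f \<in> l1 \<Longrightarrow> q f \<in> V 0"
  using base[THEN conjunct1] by blast

lemma q_surj: "x \<in> V 0 \<Longrightarrow> \<exists>f\<in>l1. q f = x"
  using base[THEN conjunct2, THEN conjunct1] by blast

lemma q_eq_iff: "f \<in> l1 \<Longrightarrow> g \<in> l1 \<Longrightarrow> q f = q g \<longleftrightarrow> (\<lambda>u. f u - g u) \<in> Jideal"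
  using base[THEN conjunct2, THEN conjunct2, THEN conjunct1] by blast

lemma q_add: "f \<in> l1 \<Longrightarrow> g \<in> l1 \<Longrightarrow> q (\<lambda>u. f u + g u) = q f + q g"
  using base[THEN conjunct2, THEN conjunct2, THEN conjunct2, THEN conjunct1] by blast

lemma q_scale: "f \<in> l1 \<Longrightarrow> q (\<lambda>u. c * f u) = sm c (q f)"
  using base[THEN conjunct2, THEN conjunct2, THEN conjunct2, THEN conjunct2, THEN conjunct1] by blast

lemma nv_q: "f \<in> l1 \<Longrightarrow> nv 0 (q f) = Inf {l1norm (\<lambda>u. f u + j u) | j. j \<in> Jideal}"
  using base[THEN conjunct2, THEN conjunct2, THEN conjunct2, THEN conjunct2, THEN conjunct2, THEN conjunct1] by blast

lemma V_add: "k \<le> L \<Longrightarrow> x \<in> V k \<Longrightarrow> y \<in> V k \<Longrightarrow> x + y \<in> V k"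
  using base[THEN conjunct2, THEN conjunct2, THEN conjunct2, THEN conjunct2, THEN conjunct2, THEN conjunct2, THEN conjunct1] by blast

lemma V_sm: "k \<le> L \<Longrightarrow> x \<in> V k \<Longrightarrow> sm c x \<in> V k"
  using base[THEN conjunct2, THEN conjunct2, THEN conjunct2, THEN conjunct2, THEN conjunct2, THEN conjunct2, THEN conjunct1] by blast

lemma pr_bfun: "k < L \<Longrightarrow> \<phi> \<in> V (Suc k) \<Longrightarrow> bfun (V k) sm (nv k) (pr k \<phi>)"
  using step[of k, THEN conjunct1] by blast

lemma pr_ex1: "k < L \<Longrightarrow> bfun (V k) sm (nv k) l \<Longrightarrow> \<exists>!\<phi>. \<phi> \<in> V (Suc k) \<and> (\<forall>x\<in>V k. pr k \<phi> x = l x)"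
  using step[of k, THEN conjunct2, THEN conjunct1] by blast

lemma pr_add: "k < L \<Longrightarrow> \<phi> \<in> V (Suc k) \<Longrightarrow> \<psi> \<in> V (Suc k) \<Longrightarrow> x \<in> V k \<Longrightarrow> pr k (\<phi> + \<psi>) x = pr k \<phi> x + pr k \<psi> x"
  using step[of k, THEN conjunct2, THEN conjunct2, THEN conjunct1] by blast

lemma pr_sm: "k < L \<Longrightarrow> \<phi> \<in> V (Suc k) \<Longrightarrow> x \<in> V k \<Longrightarrow> pr k (sm c \<phi>) x = c * pr k \<phi> x"
  using step[of k, THEN conjunct2, THEN conjunct2, THEN conjunct2, THEN conjunct1] by blast

lemma nv_Suc: "k < L \<Longrightarrow> \<phi> \<in> V (Suc k) \<Longrightarrow> nv (Suc k) \<phi> = Sup {norm (pr k \<phi> x) | x. x \<in> V k \<and> nv k x \<le> 1}"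
  using step[of k, THEN conjunct2, THEN conjunct2, THEN conjunct2, THEN conjunct2] by blast

end

lemma pr_arg_add: "k < L \<Longrightarrow> \<phi> \<in> V (Suc k) \<Longrightarrow> x \<in> V k \<Longrightarrow> y \<in> V k \<Longrightarrow> pr k \<phi> (x + y) = pr k \<phi> x + pr k \<phi> y"
  and pr_arg_sm: "k < L \<Longrightarrow> \<phi> \<in> V (Suc k) \<Longrightarrow> x \<in> V k \<Longrightarrow> pr k \<phi> (sm c x) = c * pr k \<phi> x"
  using pr_bfun unfolding bfun_def by blast+

lemma pr_eqI:
  assumes "k < L" "\<phi> \<in> V (Suc k)" "\<psi> \<in> V (Suc k)" "\<And>x. x \<in> V k \<Longrightarrow> pr k \<phi> x = pr k \<psi> x"
  shows "\<phi> = \<psi>"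
  using pr_ex1[OF assms(1) pr_bfun[OF assms(1,3)]] assms by metis

lemma q_zero: "q (\<lambda>_. 0) = 0"
  using q_add[OF l1_zero(1) l1_zero(1)] by simp

lemma V_zero: "k \<le> L \<Longrightarrow> 0 \<in> V k"
proof (cases k)
  case 0
  then show ?thesis using q_in[OF l1_zero(1)] q_zero by simp
next
  case (Suc j)
  assume "k \<le> L"
  then have j: "j < L" using Suc by simp
  have "bfun (V j) sm (nv j) (\<lambda>_. 0)" unfolding bfun_def by (auto intro: exI[of _ 0])
  from pr_ex1[OF j this] obtain \<phi> where \<phi>: "\<phi> \<in> V (Suc j)" "\<And>x. x \<in> V j \<Longrightarrow> pr j \<phi> x = 0" by blast
  have "\<phi> + \<phi> = \<phi>"
    using \<phi> j V_add[of "Suc j"] by (intro pr_eqI[OF j]) (auto simp: pr_add)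
  then show ?thesis using \<phi>(1) Suc by simp
qed

lemma
  assumes "k \<le> L" "x \<in> V k"
  shows sm_add: "sm (c + d) x = sm c x + sm d x"
    and sm_sm: "sm c (sm d x) = sm (c * d) x"
    and sm_one: "sm 1 x = x"
proof -
  have "sm (c + d) x = sm c x + sm d x \<and> sm c (sm d x) = sm (c * d) x \<and> sm 1 x = x"
  proof (cases k)
    case 0
    then obtain f where f: "f \<in> l1" "q f = x" using q_surj assms by blast
    have "q (\<lambda>u. (c + d) * f u) = q (\<lambda>u. c * f u + d * f u)" by (simp add: algebra_simps)
    then have 1: "sm (c + d) x = sm c x + sm d x"
      using q_add[OF l1_scale(1) l1_scale(1), OF f(1) f(1)] q_scale[OF f(1)] f(2) by simp
    have "q (\<lambda>u. c * (d * f u)) = q (\<lambda>u. (c * d) * f u)" by (simp add: mult.assoc)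
    then have 2: "sm c (sm d x) = sm (c * d) x"
      using q_scale[OF l1_scale(1)[OF f(1)]] q_scale[OF f(1)] f(2) by simp
    have "sm 1 x = x" using q_scale[OF f(1), of 1] f(2) by simp
    with 1 2 show ?thesis by simp
  next
    case (Suc j)
    then have j: "j < L" and x: "x \<in> V (Suc j)" using assms by auto
    have in': "sm c x \<in> V (Suc j)" for c using V_sm x j by simp
    have "sm (c + d) x = sm c x + sm d x"
      using in' x V_add[of "Suc j"] j by (intro pr_eqI[OF j]) (auto simp: pr_add pr_sm algebra_simps)
    moreover have "sm c (sm d x) = sm (c * d) x"
      using in' x V_sm[of "Suc j"] j by (intro pr_eqI[OF j]) (auto simp: pr_sm)
    moreover have "sm 1 x = x"
      using in' x by (intro pr_eqI[OF j]) (auto simp: pr_sm j)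
    ultimately show ?thesis by simp
  qed
  then show "sm (c + d) x = sm c x + sm d x" "sm c (sm d x) = sm (c * d) x" "sm 1 x = x" by auto
qed

lemma sm_plus:
  assumes "k \<le> L" "x \<in> V k" "y \<in> V k"
  shows "sm c (x + y) = sm c x + sm c y"
proof (cases k)
  case 0
  then obtain f g where fg: "f \<in> l1" "q f = x" "g \<in> l1" "q g = y"
    using q_surj[of x] q_surj[of y] assms by blast
  have "sm c (x + y) = q (\<lambda>u. c * (f u + g u))" using fg q_scale[OF l1_add(1)[OF fg(1,3)]] q_add by simp
  also have "\<dots> = q (\<lambda>u. c * f u + c * g u)" by (simp add: algebra_simps)
  finally show ?thesis using fg q_scale q_add[OF l1_scale(1) l1_scale(1)] by simp
next
  case (Suc j)
  then have j: "j < L" and xy: "x \<in> V (Suc j)" "y \<in> V (Suc j)" and s: "Suc j \<le> L" using assms by auto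
  show ?thesis
    using xy V_add[OF s] V_sm[OF s] by (intro pr_eqI[OF j]) (auto simp: pr_add pr_sm j algebra_simps)
qed

lemma sm_minus_one: "k \<le> L \<Longrightarrow> x \<in> V k \<Longrightarrow> sm (- 1) x = - x"
  using sm_add[of k x 1 "- 1"] sm_add[of k x 0 0] by (simp add: sm_one add_eq_0_iff)

lemma Jideal_iff: "f \<in> Jideal \<longleftrightarrow> f \<in> l1 \<and> q f = 0"
  using q_eq_iff[of f "\<lambda>_. 0"] l1_zero(1) q_zero by (auto simp: Jideal_def)

lemma Jideal_closed:
  assumes f: "f \<in> l1" and approx: "\<And>\<epsilon>. 0 < \<epsilon> \<Longrightarrow> \<exists>g\<in>Jideal. l1norm (\<lambda>u. f u - g u) < \<epsilon>"
  shows "f \<in> Jideal"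
  unfolding Jideal_def
proof (intro CollectI conjI allI impI f)
  fix \<epsilon> :: real assume "0 < \<epsilon>"
  then obtain g where g: "g \<in> Jideal" "l1norm (\<lambda>u. f u - g u) < \<epsilon> / 2" using approx[of "\<epsilon> / 2"] by auto
  then obtain h where h: "h \<in> Jspan" "l1norm (\<lambda>u. g u - h u) < \<epsilon> / 2" and gl: "g \<in> l1"
    using \<open>0 < \<epsilon>\<close> unfolding Jideal_def by (auto dest: spec[of _ "\<epsilon> / 2"])
  have hl: "h \<in> l1"
  proof -
    obtain m :: nat and c s e t where h_eq: "h = (\<lambda>u. \<Sum>i<m. c i * (delta (s i * e i * t i) u - delta (s i * t i) u))"
      using h(1) by (auto simp: Jspan_def)
    show ?thesis unfolding h_eq
      by (induction m) (auto intro!: l1_zero l1_add l1_scale l1_diff delta_l1)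
  qed
  have "l1norm (\<lambda>u. (f u - g u) + (g u - h u)) \<le> l1norm (\<lambda>u. f u - g u) + l1norm (\<lambda>u. g u - h u)"
    by (intro l1_add l1_diff f gl hl)
  with g(2) h(2) have "l1norm (\<lambda>u. f u - h u) < \<epsilon>" by simp
  with h(1) show "\<exists>g\<in>Jspan. l1norm (\<lambda>u. f u - g u) < \<epsilon>" by blast
qed

text \<open>A choice of representatives of the classes of the maximal group image of the semigroup,
  whose congruence identifies \<open>s\<close> and \<open>t\<close> iff \<open>delta s - delta t\<close> lies in \<open>J\<close>.\<close>

definition rep :: "'s \<Rightarrow> 's" where
  "rep s = (SOME t. q (delta t) = q (delta s))"

lemma q_delta_rep: "q (delta (rep s)) = q (delta s)"
  unfolding rep_def by (rule someI[of _ s]) simp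

lemma rep_eq_iff: "rep s = rep t \<longleftrightarrow> q (delta s) = q (delta t)"
  using q_delta_rep unfolding rep_def by metis

lemma rep_rep: "rep (rep s) = rep s"
  by (simp add: rep_eq_iff q_delta_rep)

lemma rep_middle: "e \<in> idems \<Longrightarrow> rep (s * e * t) = rep (s * t)"
proof -
  assume e: "e \<in> idems"
  have "(\<lambda>u. delta (s * e * t) u - delta (s * t) u) \<in> Jspan"
    unfolding Jspan_def using e
    by (intro CollectI exI[of _ 1] exI[of _ "\<lambda>_. 1"] exI[of _ "\<lambda>_. s"] exI[of _ "\<lambda>_. e"] exI[of _ "\<lambda>_. t"]) simp
  then have "(\<lambda>u. delta (s * e * t) u - delta (s * t) u) \<in> Jideal"
    unfolding Jideal_def by (auto intro!: l1_diff delta_l1 bexI simp: l1_zero)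
  then show ?thesis using q_eq_iff[OF delta_l1(1) delta_l1(1)] by (simp add: rep_eq_iff)
qed

text \<open>\<open>rep_middle\<close> deletes an idempotent between two factors; inserting
  \<open>star s * s\<close> and commuting it past \<open>e\<close> brings \<open>e\<close> into such
  a position.\<close>

lemma rep_idem_right: "e \<in> idems \<Longrightarrow> rep (s * e) = rep s"
proof -
  assume e: "e \<in> idems"
  have "s * e = s * (star s * s * e)" using star_inverse(1)[OF inv, of s] by (simp add: mult.assoc[symmetric])
  also have "star s * s * e = e * (star s * s)" by (rule idems_commute[OF inv star_idems(2)[OF inv] e])
  finally have "rep (s * e) = rep (s * (e * (star s * s)))" by (rule arg_cong)
  then have "rep (s * e) = rep (s * e * (star s * s))" unfolding mult.assoc .
  also have "\<dots> = rep (s * (star s * s))" by (rule rep_middle[OF e])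
  finally show ?thesis using star_inverse(1)[OF inv, of s] by (simp add: mult.assoc)
qed

lemma rep_idem_left: "e \<in> idems \<Longrightarrow> rep (e * s) = rep s"
proof -
  assume e: "e \<in> idems"
  have "e * s = (e * (s * star s)) * s" using star_inverse(1)[OF inv, of s] by (simp add: mult.assoc)
  also have "e * (s * star s) = (s * star s) * e" by (rule idems_commute[OF inv e star_idems(1)[OF inv]])
  finally have "rep (e * s) = rep ((s * star s) * e * s)" by (rule arg_cong)
  also have "\<dots> = rep ((s * star s) * s)" by (rule rep_middle[OF e])
  finally show ?thesis using star_inverse(1)[OF inv, of s] by simp
qed

text \<open>\<open>push h\<close> kills the generators and is contractive, so it kills their closed
  span. The map \<open>h\<close> is general so that \<open>rep\<close> may be combined with
  translations, which yields \<open>rep_mult_right\<close> and \<open>rep_mult_left\<close>.\<close>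

lemma push_Jideal:
  assumes f: "f \<in> Jideal" and h: "\<And>s e t :: 's. e \<in> idems \<Longrightarrow> h (s * e * t) = h (s * t)"
  shows "push h f = (\<lambda>_. 0)"
proof -
  from f have fl: "f \<in> l1" by (simp add: Jideal_def)
  have "l1norm (push h f) \<le> 0"
  proof (rule field_le_epsilon)
    fix \<epsilon> :: real assume "0 < \<epsilon>"
    then obtain g where g: "g \<in> Jspan" "l1norm (\<lambda>u. f u - g u) < \<epsilon>" using f by (auto simp: Jideal_def)
    obtain m :: nat and c s e t where e: "\<And>i. i < m \<Longrightarrow> e i \<in> idems"
      and g_eq: "g = (\<lambda>u. \<Sum>i<m. c i * (delta (s i * e i * t i) u - delta (s i * t i) u))"
      using g(1) unfolding Jspan_def mem_Collect_eq by blast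
    have "g \<in> l1 \<and> push h g = (\<lambda>_. 0)" unfolding g_eq using e
    proof (induction m)
      case 0 then show ?case by (simp add: l1_zero push_zero)
    next
      case (Suc m)
      let ?d = "\<lambda>u. delta (s m * e m * t m) u - delta (s m * t m) u"
      have d: "?d \<in> l1" by (intro l1_diff delta_l1)
      have "push h ?d = (\<lambda>_. 0)"
        using h[OF Suc.prems[of m]] by (simp add: push_diff delta_l1 push_delta)
      then have "push h (\<lambda>u. c m * ?d u) = (\<lambda>_. 0)" by (simp only: push_scale) simp
      then show ?case using Suc l1_scale(1)[OF d] by (simp add: l1_add push_add)
    qed
    then have g0: "g \<in> l1" "push h g = (\<lambda>_. 0)" by auto
    have "push h f = push h (\<lambda>u. f u - g u)" using push_diff[OF fl g0(1), of h] g0(2) by simp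
    then show "l1norm (push h f) \<le> 0 + \<epsilon>"
      using push_l1(2)[OF l1_diff(1)[OF fl g0(1)], of h] g(2) by simp
  qed
  from l1norm_eq_0D[OF push_l1(1)[OF fl] this] show ?thesis by (rule ext)
qed

lemma push_rep_Jideal: "f \<in> Jideal \<Longrightarrow> push rep f = (\<lambda>_. 0)"
  by (rule push_Jideal[OF _ rep_middle])

text \<open>For point masses this is the choice of \<open>rep\<close>; the general case follows by
  approximation, as \<open>push rep\<close> is contractive and \<open>Jideal\<close> is
  closed.\<close>

lemma q_push_rep:
  assumes f: "f \<in> l1"
  shows "q (push rep f) = q f"
proof -
  have pf: "push rep f \<in> l1" using push_l1(1)[OF f] .
  have "(\<lambda>u. push rep f u - f u) \<in> Jideal"
  proof (rule Jideal_closed[OF l1_diff(1)[OF pf f]])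
    fix \<epsilon> :: real assume "0 < \<epsilon>"
    then obtain A where A: "finite A" "l1norm (\<lambda>u. f u - (if u \<in> A then f u else 0)) < \<epsilon> / 2"
      using l1_tail_small[OF f, of "\<epsilon> / 2"] by auto
    let ?f = "\<lambda>u. if u \<in> A then f u else 0"
    have "?f \<in> l1 \<and> q (push rep ?f) = q ?f"
    proof (rule finite_support_induct[OF A(1)])
      show "(\<lambda>_. 0) \<in> l1 \<and> q (push rep (\<lambda>_. 0)) = q (\<lambda>_. 0)" by (simp add: push_zero l1_zero)
      fix g c s assume g: "g \<in> l1" and IH: "g \<in> l1 \<and> q (push rep g) = q g"
      have d: "(\<lambda>u. c * delta s u) \<in> l1" "(\<lambda>u. c * delta (rep s) u) \<in> l1" by (intro l1_scale delta_l1)+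
      have "push rep (\<lambda>u. g u + c * delta s u) = (\<lambda>u. push rep g u + c * delta (rep s) u)"
        using push_add[OF g d(1), of rep] by (simp add: push_scale push_delta)
      then show "(\<lambda>u. g u + c * delta s u) \<in> l1 \<and> q (push rep (\<lambda>u. g u + c * delta s u)) = q (\<lambda>u. g u + c * delta s u)"
        using IH l1_add(1)[OF g d(1)] q_add[OF g d(1)] q_add[OF push_l1(1)[OF g, of rep] d(2)]
          q_scale[OF delta_l1(1)] q_delta_rep by simp
    qed
    then have fA: "?f \<in> l1" and "q (push rep ?f) = q ?f" by auto
    then have J: "(\<lambda>u. push rep ?f u - ?f u) \<in> Jideal" using q_eq_iff push_l1(1) by blast
    let ?d = "\<lambda>u. f u - ?f u"
    have d: "?d \<in> l1" by (rule l1_diff(1)[OF f fA])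
    have "(\<lambda>u. push rep f u - f u - (push rep ?f u - ?f u)) = (\<lambda>u. push rep ?d u - ?d u)"
      using push_diff[OF f fA, of rep] by (auto simp: fun_eq_iff)
    then have "l1norm (\<lambda>u. push rep f u - f u - (push rep ?f u - ?f u)) \<le> l1norm (push rep ?d) + l1norm ?d"
      using l1_diff(2)[OF push_l1(1)[OF d] d] by simp
    also have "\<dots> < \<epsilon>" using push_l1(2)[OF d, of rep] A(2) by simp
    finally show "\<exists>g\<in>Jideal. l1norm (\<lambda>u. push rep f u - f u - g u) < \<epsilon>"
      by (rule bexI[OF _ J])
  qed
  then show ?thesis using q_eq_iff[OF pf f] by simp
qed

lemma q_eq_push_iff:
  assumes "f \<in> l1" "g \<in> l1"
  shows "q f = q g \<longleftrightarrow> push rep f = push rep g"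
proof
  assume "q f = q g"
  then have "(\<lambda>u. f u - g u) \<in> Jideal" using q_eq_iff assms by blast
  from push_rep_Jideal[OF this] show "push rep f = push rep g"
    using push_diff[OF assms, of rep] by (auto simp: fun_eq_iff)
next
  assume "push rep f = push rep g"
  then show "q f = q g" using q_push_rep assms by metis
qed

text \<open>The same choice as in \<open>tact_l\<close> and \<open>tact_r\<close> at level
  \<open>0\<close>, so that their equations can be read in terms of \<open>lift\<close>.\<close>

definition lift :: "'v \<Rightarrow> 's \<Rightarrow> complex" where
  "lift x = (SOME f. f \<in> l1 \<and> q f = x)"

text \<open>By \<open>q_eq_push_iff\<close> this does not depend on the choice made in
  \<open>lift\<close>; it identifies the quotient with the functions in \<open>l1\<close> supported
  on \<open>range rep\<close>.\<close>

definition coords :: "'v \<Rightarrow> 's \<Rightarrow> complex" where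
  "coords x = push rep (lift x)"

lemma lift: "x \<in> V 0 \<Longrightarrow> lift x \<in> l1 \<and> q (lift x) = x"
  unfolding lift_def using q_surj by (rule someI2_bex) auto

lemma coords_q: "f \<in> l1 \<Longrightarrow> coords (q f) = push rep f"
  unfolding coords_def using lift[OF q_in] q_eq_push_iff by blast

lemma coords_l1: "x \<in> V 0 \<Longrightarrow> coords x \<in> l1"
  unfolding coords_def using lift push_l1(1) by blast

lemma q_coords: "x \<in> V 0 \<Longrightarrow> q (coords x) = x"
  unfolding coords_def using lift q_push_rep by metis

lemma coords_add:
  assumes "x \<in> V 0" "y \<in> V 0"
  shows "coords (x + y) = (\<lambda>u. coords x u + coords y u)"
proof -
  have l: "lift x \<in> l1" "lift y \<in> l1" "q (lift x) = x" "q (lift y) = y" using lift assms by auto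
  have "coords (x + y) = push rep (\<lambda>u. lift x u + lift y u)"
    using coords_q[OF l1_add(1)[OF l(1,2)]] q_add[OF l(1,2)] l(3,4) by simp
  then show ?thesis using push_add[OF l(1,2)] by (simp add: coords_def)
qed

lemma coords_sm:
  assumes "x \<in> V 0"
  shows "coords (sm c x) = (\<lambda>u. c * coords x u)"
proof -
  have l: "lift x \<in> l1" "q (lift x) = x" using lift assms by auto
  have "coords (sm c x) = push rep (\<lambda>u. c * lift x u)"
    using coords_q[OF l1_scale(1)[OF l(1)]] q_scale[OF l(1)] l(2) by simp
  then show ?thesis by (simp add: push_scale coords_def)
qed

lemma coords_supp: "u \<notin> range rep \<Longrightarrow> coords x u = 0"
  unfolding coords_def by (rule push_supp)

lemma coords_surj: "f \<in> l1 \<Longrightarrow> (\<And>u. u \<notin> range rep \<Longrightarrow> f u = 0) \<Longrightarrow> coords (q f) = f"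
  unfolding coords_q by (rule push_id_on[of "range rep"]) (auto simp: rep_rep)

text \<open>The infimum in the quotient norm is attained at \<open>coords x\<close>:
  \<open>push rep\<close> sends every representative of \<open>x\<close> to it without increasing
  the norm.\<close>

lemma nv_coords:
  assumes x: "x \<in> V 0"
  shows "nv 0 x = l1norm (coords x)"
proof -
  let ?S = "{l1norm (\<lambda>u. coords x u + j u) | j. j \<in> Jideal}"
  have "nv 0 x = Inf ?S" using nv_q[OF coords_l1[OF x]] q_coords[OF x] by simp
  also have "\<dots> = l1norm (coords x)"
  proof (rule cInf_eq_minimum)
    have "(\<lambda>_ :: 's. 0) \<in> Jideal" by (simp add: Jideal_iff l1_zero(1) q_zero)
    then show "l1norm (coords x) \<in> ?S" by force
    fix t assume "t \<in> ?S"
    then obtain j where j: "j \<in> Jideal" "t = l1norm (\<lambda>u. coords x u + j u)" by auto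
    have jl: "j \<in> l1" using j by (simp add: Jideal_def)
    have "push rep (\<lambda>u. coords x u + j u) = (\<lambda>u. push rep (coords x) u + 0)"
      using push_add[OF coords_l1[OF x] jl, of rep] push_rep_Jideal[OF j(1)] by simp
    also have "\<dots> = coords x" using coords_q[OF coords_l1[OF x]] q_coords[OF x] by simp
    finally show "l1norm (coords x) \<le> t"
      using push_l1(2)[OF l1_add(1)[OF coords_l1[OF x] jl], of rep] j(2) by simp
  qed
  finally show ?thesis .
qed

end

section \<open>Norms on the dual tower\<close>

lemma has_sum_bool_split:
  fixes g h :: "'a \<Rightarrow> real"
  assumes "g summable_on UNIV" "h summable_on UNIV"
  shows "((\<lambda>(u, b). if b then g u else h u) has_sum (infsum g UNIV + infsum h UNIV)) UNIV"
proof -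
  let ?f = "\<lambda>(u, b). if b then g u else h u"
  have 1: "(?f has_sum infsum g UNIV) (range (\<lambda>u. (u, True)))"
    using assms(1) by (subst has_sum_reindex) (auto simp: inj_on_def o_def)
  have 2: "(?f has_sum infsum h UNIV) (range (\<lambda>u. (u, False)))"
    using assms(2) by (subst has_sum_reindex) (auto simp: inj_on_def o_def)
  have "(?f has_sum (infsum g UNIV + infsum h UNIV)) (range (\<lambda>u. (u, True)) \<union> range (\<lambda>u. (u, False)))"
    using 1 2 by (rule has_sum_Un_disjoint) auto
  moreover have "range (\<lambda>u. (u, True)) \<union> range (\<lambda>u. (u, False)) = (UNIV :: ('a \<times> bool) set)"
    by (auto simp: image_iff)
  ultimately show ?thesis by simp
qed

context quotient_tower
begin

definition coord :: "'v \<Rightarrow> 's \<times> bool \<Rightarrow> real" where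
  "coord x = (\<lambda>(u, b). if b then Re (coords x u) else Im (coords x u))"

text \<open>\<open>RN k\<close> is a norm on \<open>V k\<close> as a real vector space, equivalent to \<open>nv k\<close>.  At level \<open>0\<close> real and
  imaginary parts are separated, so that \<open>V 0\<close> becomes a real \<open>\<ell>\<^sup>1\<close> space.\<close>

primrec RN :: "nat \<Rightarrow> 'v \<Rightarrow> real" where
  "RN 0 x = (\<Sum>\<^sub>\<infinity>w. \<bar>coord x w\<bar>)"
| "RN (Suc k) \<phi> = Inf {C. 0 \<le> C \<and> (\<forall>x\<in>V k. Re (pr k \<phi> x) \<le> C * RN k x)}"

declare RN.simps [simp del]

definition scr :: "real \<Rightarrow> 'v \<Rightarrow> 'v" where
  "scr c x = sm (of_real c) x"

lemma coord_has_sum: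
  assumes x: "x \<in> V 0"
  shows "((\<lambda>w. \<bar>coord x w\<bar>) has_sum ((\<Sum>\<^sub>\<infinity>u. \<bar>Re (coords x u)\<bar>) + (\<Sum>\<^sub>\<infinity>u. \<bar>Im (coords x u)\<bar>))) UNIV"
    and "(\<lambda>u. \<bar>Re (coords x u)\<bar>) summable_on UNIV" "(\<lambda>u. \<bar>Im (coords x u)\<bar>) summable_on UNIV"
proof -
  note s = l1_summable(1)[OF coords_l1[OF x], of UNIV]
  show 1: "(\<lambda>u. \<bar>Re (coords x u)\<bar>) summable_on UNIV"
    by (rule summable_on_comparison_test[OF s]) (auto simp: abs_Re_le_cmod)
  show 2: "(\<lambda>u. \<bar>Im (coords x u)\<bar>) summable_on UNIV"
    by (rule summable_on_comparison_test[OF s]) (auto simp: abs_Im_le_cmod)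
  have "(\<lambda>w. \<bar>coord x w\<bar>) = (\<lambda>(u, b). if b then \<bar>Re (coords x u)\<bar> else \<bar>Im (coords x u)\<bar>)"
    by (auto simp: coord_def fun_eq_iff)
  then show "((\<lambda>w. \<bar>coord x w\<bar>) has_sum ((\<Sum>\<^sub>\<infinity>u. \<bar>Re (coords x u)\<bar>) + (\<Sum>\<^sub>\<infinity>u. \<bar>Im (coords x u)\<bar>))) UNIV"
    using has_sum_bool_split[OF 1 2] by simp
qed

lemma RN_0: "x \<in> V 0 \<Longrightarrow> RN 0 x = (\<Sum>\<^sub>\<infinity>u. \<bar>Re (coords x u)\<bar>) + (\<Sum>\<^sub>\<infinity>u. \<bar>Im (coords x u)\<bar>)"
  using infsumI[OF coord_has_sum(1)] by (simp add: RN.simps)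

lemma coord_summable: "x \<in> V 0 \<Longrightarrow> (\<lambda>w. \<bar>coord x w\<bar>) summable_on UNIV"
  using has_sum_imp_summable[OF coord_has_sum(1)] .

lemma coord_add: "x \<in> V 0 \<Longrightarrow> y \<in> V 0 \<Longrightarrow> coord (x + y) w = coord x w + coord y w"
  by (cases w) (simp add: coord_def coords_add)

lemma RN_0_le_nv:
  assumes x: "x \<in> V 0"
  shows "RN 0 x \<le> 2 * nv 0 x" "nv 0 x \<le> RN 0 x"
proof -
  note s = l1_summable(1)[OF coords_l1[OF x], of UNIV]
  have "(\<Sum>\<^sub>\<infinity>u. \<bar>Re (coords x u)\<bar>) \<le> l1norm (coords x)" "(\<Sum>\<^sub>\<infinity>u. \<bar>Im (coords x u)\<bar>) \<le> l1norm (coords x)"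
    unfolding l1norm_def using coord_has_sum(2,3)[OF x] s
    by (auto intro!: infsum_mono abs_Re_le_cmod abs_Im_le_cmod)
  then show "RN 0 x \<le> 2 * nv 0 x" using RN_0[OF x] nv_coords[OF x] by simp
  have "l1norm (coords x) \<le> (\<Sum>\<^sub>\<infinity>u. \<bar>Re (coords x u)\<bar> + \<bar>Im (coords x u)\<bar>)"
    unfolding l1norm_def using coord_has_sum(2,3)[OF x] s
    by (intro infsum_mono summable_on_add) (auto simp: cmod_le)
  also have "\<dots> = RN 0 x" unfolding RN_0[OF x] using coord_has_sum(2,3)[OF x] by (rule infsum_add)
  finally show "nv 0 x \<le> RN 0 x" using nv_coords[OF x] by simp
qed

text \<open>Invariance under the imaginary unit recovers imaginary parts from the real parts used at
  the next level; equivalence with \<open>nv\<close> ensures that both norms have the same bounded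
  functionals.\<close>

definition norm_level :: "nat \<Rightarrow> bool" where
  "norm_level k \<longleftrightarrow> nspace (V k) scr (RN k) \<and> (\<forall>x\<in>V k. RN k (sm \<i> x) = RN k x) \<and>
     (\<exists>C>0. \<forall>x\<in>V k. nv k x \<le> C * RN k x \<and> RN k x \<le> C * nv k x)"

lemma norm_level_0: "norm_level 0"
  unfolding norm_level_def
proof (intro conjI ballI)
  show "nspace (V 0) scr (RN 0)"
  proof
    show "0 \<in> V 0" by (simp add: V_zero)
    fix x assume x: "x \<in> V 0"
    show "scr c x \<in> V 0" for c using V_sm x by (simp add: scr_def)
    show "scr (a + b) x = scr a x + scr b x" for a b
      using sm_add[of 0 x "of_real a" "of_real b"] x by (simp add: scr_def)
    show "scr 1 x = x" using sm_one[of 0 x] x by (simp add: scr_def)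
    have "coord (scr c x) w = c * coord x w" for c w
      using x by (cases w) (simp add: coord_def scr_def coords_sm)
    then show "RN 0 (scr c x) = \<bar>c\<bar> * RN 0 x" for c
      by (simp add: RN.simps abs_mult infsum_cmult_right')
    fix y assume y: "y \<in> V 0"
    show xy: "x + y \<in> V 0" using V_add x y by simp
    have "\<bar>coord (x + y) w\<bar> \<le> \<bar>coord x w\<bar> + \<bar>coord y w\<bar>" for w using coord_add[OF x y, of w] by simp
    then have "RN 0 (x + y) \<le> (\<Sum>\<^sub>\<infinity>w. \<bar>coord x w\<bar> + \<bar>coord y w\<bar>)"
      unfolding RN.simps(1) by (intro infsum_mono summable_on_add coord_summable x y xy)
    also have "\<dots> = RN 0 x + RN 0 y"
      unfolding RN.simps(1) using coord_summable x y by (intro infsum_add) auto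
    finally show "RN 0 (x + y) \<le> RN 0 x + RN 0 y" .
  qed
  show "RN 0 (sm \<i> x) = RN 0 x" if "x \<in> V 0" for x
    using RN_0[OF that] RN_0[OF V_sm[OF _ that], of \<i>] that by (simp add: coords_sm)
  have "nv 0 x \<le> 2 * RN 0 x \<and> RN 0 x \<le> 2 * nv 0 x" if x: "x \<in> V 0" for x
  proof -
    have "0 \<le> RN 0 x" unfolding RN.simps(1) by (rule infsum_nonneg) auto
    then show ?thesis using RN_0_le_nv[OF x] by simp
  qed
  then show "\<exists>C>0. \<forall>x\<in>V 0. nv 0 x \<le> C * RN 0 x \<and> RN 0 x \<le> C * nv 0 x"
    by (intro exI[of _ 2]) auto
qed

lemma pr_bounded:
  assumes k: "k < L" and lev: "norm_level k" and \<phi>: "\<phi> \<in> V (Suc k)"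
  obtains C where "0 \<le> C" "\<And>x. x \<in> V k \<Longrightarrow> norm (pr k \<phi> x) \<le> C * RN k x"
proof -
  interpret nspace "V k" scr "RN k" using lev by (simp add: norm_level_def)
  obtain C0 where C0: "C0 > 0" "\<And>x. x \<in> V k \<Longrightarrow> nv k x \<le> C0 * RN k x" "\<And>x. x \<in> V k \<Longrightarrow> RN k x \<le> C0 * nv k x"
    using lev by (auto simp: norm_level_def)
  obtain C1 where C1: "\<And>x. x \<in> V k \<Longrightarrow> norm (pr k \<phi> x) \<le> C1 * nv k x"
    using pr_bfun[OF k \<phi>] unfolding bfun_def by blast
  show ?thesis
  proof
    show "0 \<le> \<bar>C1\<bar> * C0" using C0(1) by simp
    fix x assume x: "x \<in> V k"
    have "0 \<le> C0 * nv k x" using C0(3)[OF x] N_nonneg[OF x] by linarith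
    then have nn: "0 \<le> nv k x" using C0(1) by (simp add: zero_le_mult_iff)
    have "norm (pr k \<phi> x) \<le> \<bar>C1\<bar> * nv k x"
      using C1[OF x] mult_right_mono[OF abs_ge_self[of C1] nn] by linarith
    also have "\<dots> \<le> \<bar>C1\<bar> * (C0 * RN k x)" using C0(2)[OF x] by (intro mult_left_mono) auto
    finally show "norm (pr k \<phi> x) \<le> \<bar>C1\<bar> * C0 * RN k x" by simp
  qed
qed

lemma RN_Suc:
  assumes k: "k < L" and lev: "norm_level k" and \<phi>: "\<phi> \<in> V (Suc k)"
  shows "0 \<le> RN (Suc k) \<phi>"
    and "\<And>x. x \<in> V k \<Longrightarrow> Re (pr k \<phi> x) \<le> RN (Suc k) \<phi> * RN k x"
    and "\<And>C. 0 \<le> C \<Longrightarrow> (\<And>x. x \<in> V k \<Longrightarrow> Re (pr k \<phi> x) \<le> C * RN k x) \<Longrightarrow> RN (Suc k) \<phi> \<le> C"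
proof -
  interpret nspace "V k" scr "RN k" using lev by (simp add: norm_level_def)
  let ?S = "{C. 0 \<le> C \<and> (\<forall>x\<in>V k. Re (pr k \<phi> x) \<le> C * RN k x)}"
  obtain C0 where C0: "0 \<le> C0" "\<And>x. x \<in> V k \<Longrightarrow> norm (pr k \<phi> x) \<le> C0 * RN k x"
    using pr_bounded[OF k lev \<phi>] by blast
  have C0S: "C0 \<in> ?S" using C0 complex_Re_le_cmod order_trans by blast
  have bdd: "bdd_below ?S" by (rule bdd_belowI[of _ 0]) auto
  show "0 \<le> RN (Suc k) \<phi>" unfolding RN.simps(2) using C0S by (intro cInf_greatest) auto
  show "Re (pr k \<phi> x) \<le> RN (Suc k) \<phi> * RN k x" if x: "x \<in> V k" for x
  proof (cases "RN k x = 0")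
    case True
    then show ?thesis using C0S x by auto
  next
    case False
    then have pos: "0 < RN k x" using N_nonneg[OF x] by simp
    have "Re (pr k \<phi> x) / RN k x \<le> RN (Suc k) \<phi>"
      unfolding RN.simps(2) using C0S x pos by (intro cInf_greatest) (auto simp: pos_divide_le_eq)
    then show ?thesis using pos by (simp add: pos_divide_le_eq)
  qed
  show "RN (Suc k) \<phi> \<le> C" if "0 \<le> C" "\<And>x. x \<in> V k \<Longrightarrow> Re (pr k \<phi> x) \<le> C * RN k x" for C
    unfolding RN.simps(2) using that by (intro cInf_lower bdd) auto
qed

lemma norm_level_Suc:
  assumes k: "k < L" and lev: "norm_level k"
  shows "norm_level (Suc k)"
  unfolding norm_level_def
proof (intro conjI ballI)
  interpret nspace "V k" scr "RN k" using lev by (simp add: norm_level_def)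
  note R = RN_Suc[OF k lev]
  have k': "Suc k \<le> L" "k \<le> L" using k by auto
  have sc_le: "RN (Suc k) (scr c \<phi>) \<le> \<bar>c\<bar> * RN (Suc k) \<phi>" if \<phi>: "\<phi> \<in> V (Suc k)" for c \<phi>
  proof (rule R(3))
    show "scr c \<phi> \<in> V (Suc k)" using V_sm k' \<phi> by (simp add: scr_def)
    show "0 \<le> \<bar>c\<bar> * RN (Suc k) \<phi>" using R(1)[OF \<phi>] by simp
    fix x assume x: "x \<in> V k"
    have "Re (pr k (scr c \<phi>) x) = c * Re (pr k \<phi> x)" using pr_sm[OF k \<phi> x] by (simp add: scr_def)
    also have "\<dots> = \<bar>c\<bar> * Re (pr k \<phi> (if 0 \<le> c then x else - x))"
      using pr_arg_sm[OF k \<phi> x, of "- 1"] sm_minus_one[OF k'(2) x] by auto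
    also have "\<dots> \<le> \<bar>c\<bar> * (RN (Suc k) \<phi> * RN k x)"
      using R(2)[OF \<phi>, of "if 0 \<le> c then x else - x"] x minus_in[OF x] N_minus[OF x]
      by (intro mult_left_mono) auto
    finally show "Re (pr k (scr c \<phi>) x) \<le> \<bar>c\<bar> * RN (Suc k) \<phi> * RN k x" by (simp add: mult.assoc)
  qed
  show "nspace (V (Suc k)) scr (RN (Suc k))"
  proof
    show "0 \<in> V (Suc k)" by (rule V_zero[OF k'(1)])
    fix \<phi> assume \<phi>: "\<phi> \<in> V (Suc k)"
    show in': "scr c \<phi> \<in> V (Suc k)" for c using V_sm[OF k'(1) \<phi>] by (simp add: scr_def)
    show "scr (a + b) \<phi> = scr a \<phi> + scr b \<phi>" for a b
      using sm_add[OF k'(1) \<phi>, of "of_real a" "of_real b"] by (simp add: scr_def)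
    show one: "scr 1 \<phi> = \<phi>" using sm_one[OF k'(1) \<phi>] by (simp add: scr_def)
    show "RN (Suc k) (scr c \<phi>) = \<bar>c\<bar> * RN (Suc k) \<phi>" for c
    proof (cases "c = 0")
      case True
      then show ?thesis using sc_le[OF \<phi>, of c] R(1)[OF in', of c] by simp
    next
      case False
      have "scr (1 / c) (scr c \<phi>) = \<phi>"
        using sm_sm[OF k'(1) \<phi>, of "of_real (1 / c)" "of_real c"] False one by (simp add: scr_def)
      then have "RN (Suc k) \<phi> \<le> \<bar>1 / c\<bar> * RN (Suc k) (scr c \<phi>)" using sc_le[OF in', of "1 / c" c] by simp
      then have "\<bar>c\<bar> * RN (Suc k) \<phi> \<le> RN (Suc k) (scr c \<phi>)" using False by (simp add: field_simps)
      with sc_le[OF \<phi>, of c] show ?thesis by simp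
    qed
    fix \<psi> assume \<psi>: "\<psi> \<in> V (Suc k)"
    show sum: "\<phi> + \<psi> \<in> V (Suc k)" by (rule V_add[OF k'(1) \<phi> \<psi>])
    show "RN (Suc k) (\<phi> + \<psi>) \<le> RN (Suc k) \<phi> + RN (Suc k) \<psi>"
    proof (rule R(3)[OF sum])
      show "0 \<le> RN (Suc k) \<phi> + RN (Suc k) \<psi>" using R(1)[OF \<phi>] R(1)[OF \<psi>] by simp
      show "Re (pr k (\<phi> + \<psi>) x) \<le> (RN (Suc k) \<phi> + RN (Suc k) \<psi>) * RN k x" if x: "x \<in> V k" for x
        using R(2)[OF \<phi> x] R(2)[OF \<psi> x] pr_add[OF k \<phi> \<psi> x] by (simp add: algebra_simps)
    qed
  qed
  have i_eq: "RN k (sm \<i> x) = RN k x" if "x \<in> V k" for x using lev that by (simp add: norm_level_def)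
  have i_le: "RN (Suc k) (sm \<i> \<phi>) \<le> RN (Suc k) \<phi>" if \<phi>: "\<phi> \<in> V (Suc k)" for \<phi>
  proof (rule R(3)[OF V_sm[OF k'(1) \<phi>] R(1)[OF \<phi>]])
    fix x assume x: "x \<in> V k"
    have "pr k (sm \<i> \<phi>) x = pr k \<phi> (sm \<i> x)" using pr_sm[OF k \<phi> x] pr_arg_sm[OF k \<phi> x] by simp
    then show "Re (pr k (sm \<i> \<phi>) x) \<le> RN (Suc k) \<phi> * RN k x"
      using R(2)[OF \<phi> V_sm[OF k'(2) x], of \<i>] i_eq[OF x] by simp
  qed
  show "RN (Suc k) (sm \<i> \<phi>) = RN (Suc k) \<phi>" if \<phi>: "\<phi> \<in> V (Suc k)" for \<phi>
  proof -
    have in': "sm \<i> \<psi> \<in> V (Suc k)" if "\<psi> \<in> V (Suc k)" for \<psi> using V_sm[OF k'(1) that] .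
    \<comment> \<open>Multiplication by the imaginary unit has order four, so being contractive it
      is isometric.\<close>
    have "sm \<i> (sm \<i> (sm \<i> (sm \<i> \<phi>))) = \<phi>"
      using \<phi> in' by (simp add: sm_sm[OF k'(1)] sm_one[OF k'(1)])
    then have "RN (Suc k) \<phi> \<le> RN (Suc k) (sm \<i> \<phi>)"
      using i_le[OF in'[OF in'[OF in'[OF \<phi>]]]] i_le[OF in'[OF in'[OF \<phi>]]] i_le[OF in'[OF \<phi>]] by simp
    with i_le[OF \<phi>] show ?thesis by simp
  qed
  obtain C where C: "C > 0" "\<And>x. x \<in> V k \<Longrightarrow> nv k x \<le> C * RN k x" "\<And>x. x \<in> V k \<Longrightarrow> RN k x \<le> C * nv k x"
    using lev by (auto simp: norm_level_def)
  have "nv (Suc k) \<phi> \<le> 2 * C * RN (Suc k) \<phi> \<and> RN (Suc k) \<phi> \<le> 2 * C * nv (Suc k) \<phi>" if \<phi>: "\<phi> \<in> V (Suc k)" for \<phi>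
  proof -
    let ?S = "{norm (pr k \<phi> x) | x. x \<in> V k \<and> nv k x \<le> 1}"
    have nv: "nv (Suc k) \<phi> = Sup ?S" by (rule nv_Suc[OF k \<phi>])
    have absRe: "\<bar>Re (pr k \<phi> x)\<bar> \<le> RN (Suc k) \<phi> * RN k x" if x: "x \<in> V k" for x
      using R(2)[OF \<phi> x] R(2)[OF \<phi> minus_in[OF x]] N_minus[OF x] pr_arg_sm[OF k \<phi> x, of "- 1"]
        sm_minus_one[OF k'(2) x] by simp
    have up: "norm (pr k \<phi> x) \<le> 2 * C * RN (Suc k) \<phi>" if x: "x \<in> V k" "nv k x \<le> 1" for x
    proof -
      \<comment> \<open>\<open>RN (Suc k)\<close> controls real parts only; \<open>sm \<i> x\<close>
        supplies the imaginary part, at the cost of a factor \<open>2\<close>.\<close>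
      have "\<bar>Im (pr k \<phi> x)\<bar> = \<bar>Re (pr k \<phi> (sm \<i> x))\<bar>" using pr_arg_sm[OF k \<phi> x(1)] by simp
      then have le: "norm (pr k \<phi> x) \<le> 2 * (RN (Suc k) \<phi> * RN k x)"
        using cmod_le[of "pr k \<phi> x"] absRe[OF x(1)] absRe[OF V_sm[OF k'(2) x(1)], of \<i>] i_eq[OF x(1)] by simp
      have "RN k x \<le> C * 1" using C(3)[OF x(1)] mult_left_mono[OF x(2), of C] C(1) by linarith
      from mult_left_mono[OF this R(1)[OF \<phi>]] le show ?thesis by (simp add: mult.commute mult.left_commute)
    qed
    have "nv k 0 \<le> 1" using C(2)[OF zero_in] N_zero by simp
    then have ne: "?S \<noteq> {}" using zero_in by blast
    have bdd: "bdd_above ?S" using up by (auto intro!: bdd_aboveI[of _ "2 * C * RN (Suc k) \<phi>"])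
    have 1: "nv (Suc k) \<phi> \<le> 2 * C * RN (Suc k) \<phi>"
      unfolding nv using up by (intro cSup_least ne) auto
    have nn: "0 \<le> nv (Suc k) \<phi>"
    proof -
      have "norm (pr k \<phi> 0) \<le> nv (Suc k) \<phi>"
        unfolding nv using \<open>nv k 0 \<le> 1\<close> zero_in by (intro cSup_upper bdd) blast
      then show ?thesis using norm_ge_zero order_trans by blast
    qed
    have "RN (Suc k) \<phi> \<le> C * nv (Suc k) \<phi>"
    proof (rule R(3)[OF \<phi>])
      show "0 \<le> C * nv (Suc k) \<phi>" using C(1) nn by simp
      fix x assume x: "x \<in> V k"
      show "Re (pr k \<phi> x) \<le> C * nv (Suc k) \<phi> * RN k x"
      proof (cases "RN k x = 0")
        case True then show ?thesis using R(2)[OF \<phi> x] by simp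
      next
        case False
        then have pos: "0 < RN k x" using N_nonneg[OF x] by simp
        define t where "t = 1 / (C * RN k x)"
        have t: "0 < t" using pos C(1) by (simp add: t_def)
        have "RN k (scr t x) = 1 / C" using N_sc[OF x] t pos by (simp add: t_def)
        then have "nv k (scr t x) \<le> 1" using C(2)[OF sc_in[OF x], of t] C(1) by simp
        then have "norm (pr k \<phi> (scr t x)) \<le> nv (Suc k) \<phi>"
          unfolding nv using sc_in[OF x] by (intro cSup_upper bdd) blast
        then have "t * norm (pr k \<phi> x) \<le> nv (Suc k) \<phi>"
          using pr_arg_sm[OF k \<phi> x] t by (simp add: scr_def norm_mult)
        then have "norm (pr k \<phi> x) \<le> C * RN k x * nv (Suc k) \<phi>"
          using pos C(1) by (simp add: t_def field_simps)
        then show ?thesis using complex_Re_le_cmod[of "pr k \<phi> x"] by (simp add: mult_ac)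
      qed
    qed
    also have "\<dots> \<le> 2 * C * nv (Suc k) \<phi>" using C(1) nn by simp
    finally show ?thesis using 1 by simp
  qed
  then show "\<exists>C>0. \<forall>x\<in>V (Suc k). nv (Suc k) x \<le> C * RN (Suc k) x \<and> RN (Suc k) x \<le> C * nv (Suc k) x"
    using C(1) by (intro exI[of _ "2 * C"]) auto
qed

lemma norm_level: "k \<le> L \<Longrightarrow> norm_level k"
  by (induction k) (auto intro: norm_level_0 norm_level_Suc)

lemma nspace_level: "k \<le> L \<Longrightarrow> nspace (V k) scr (RN k)"
  using norm_level by (simp add: norm_level_def)

text \<open>A bounded real functional \<open>l\<close> is the real part of the complex functional
  \<open>l x - i l (i x)\<close>, so taking real parts identifies the complex dual with the real
  one.\<close>

lemma dual_pair_level: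
  assumes k: "k < L"
  shows "dual_pair (V k) scr (RN k) (V (Suc k)) (RN (Suc k)) (\<lambda>\<phi> x. Re (pr k \<phi> x))"
proof -
  have k': "Suc k \<le> L" "k \<le> L" using k by auto
  note lev = norm_level[OF k'(2)]
  interpret Z: nspace "V k" scr "RN k" by (rule nspace_level[OF k'(2)])
  interpret W: nspace "V (Suc k)" scr "RN (Suc k)" by (rule nspace_level[OF k'(1)])
  note R = RN_Suc[OF k lev]
  show ?thesis
  proof
    fix \<phi> \<psi> x assume \<phi>: "\<phi> \<in> V (Suc k)" and \<psi>: "\<psi> \<in> V (Suc k)"
      and eq: "\<And>x. x \<in> V k \<Longrightarrow> Re (pr k \<phi> x) = Re (pr k \<psi> x)"
    show "\<phi> = \<psi>"
    proof (rule pr_eqI[OF k \<phi> \<psi>])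
      fix x assume x: "x \<in> V k"
      show "pr k \<phi> x = pr k \<psi> x"
        using eq[OF x] eq[OF V_sm[OF k'(2) x], of \<i>] pr_arg_sm[OF k \<phi> x] pr_arg_sm[OF k \<psi> x]
        by (simp add: complex_eq_iff)
    qed
  next
    fix l C assume l: "additive_on (V k) l" and bd: "\<And>x. x \<in> V k \<Longrightarrow> l x \<le> C * RN k x"
    note lD = Z.additiveD[OF l]
    have hom: "l (scr t x) = t * l x" if x: "x \<in> V k" for t x
    proof -
      have "l (scr t x) = t * l (scr 1 x)"
      proof (rule additive_bounded_real_linear)
        show "l (scr (s + t) x) = l (scr s x) + l (scr t x)" for s t
          using Z.sc_add[OF x] lD(3)[OF Z.sc_in[OF x] Z.sc_in[OF x]] by simp
        show "l (scr t x) \<le> C * RN k x * \<bar>t\<bar>" for t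
          using bd[OF Z.sc_in[OF x], of t] Z.N_sc[OF x] by (simp add: mult_ac)
      qed
      then show ?thesis using Z.sc_one[OF x] by simp
    qed
    have cx: "l (sm c x) = Re c * l x + Im c * l (sm \<i> x)" if x: "x \<in> V k" for c x
    proof -
      have "sm c x = sm (of_real (Re c) + of_real (Im c) * \<i>) x" by (metis complex_eq mult.commute)
      also have "\<dots> = scr (Re c) x + scr (Im c) (sm \<i> x)"
        using sm_add[OF k'(2) x] sm_sm[OF k'(2) x] by (simp add: scr_def)
      finally show ?thesis
        using lD(3) hom x V_sm[OF k'(2) x] Z.sc_in by simp
    qed
    define l' where "l' x = Complex (l x) (- l (sm \<i> x))" for x
    have absl: "\<bar>l x\<bar> \<le> \<bar>C\<bar> * RN k x" if x: "x \<in> V k" for x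
    proof -
      have "C * RN k x \<le> \<bar>C\<bar> * RN k x" using Z.N_nonneg[OF x] by (intro mult_right_mono) auto
      then show ?thesis
        using bd[OF x] bd[OF Z.minus_in[OF x]] lD(2)[OF x] Z.N_minus[OF x] by (simp add: abs_le_iff)
    qed
    obtain C0 where C0: "C0 > 0" "\<And>x. x \<in> V k \<Longrightarrow> RN k x \<le> C0 * nv k x"
      using lev by (auto simp: norm_level_def)
    have i_eq: "RN k (sm \<i> x) = RN k x" if "x \<in> V k" for x using lev that by (simp add: norm_level_def)
    have "bfun (V k) sm (nv k) l'"
      unfolding bfun_def
    proof (intro conjI ballI allI exI)
      show "l' (x + y) = l' x + l' y" if "x \<in> V k" "y \<in> V k" for x y
        using that lD(3) sm_plus[OF k'(2)] V_sm[OF k'(2)] by (simp add: l'_def complex_eq_iff)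
      show "l' (sm c x) = c * l' x" if x: "x \<in> V k" for c x
        using cx[OF x, of c] cx[OF x, of "\<i> * c"] sm_sm[OF k'(2) x, of \<i> c]
        by (simp add: l'_def complex_eq_iff algebra_simps)
      show "norm (l' x) \<le> (2 * \<bar>C\<bar> * C0) * nv k x" if x: "x \<in> V k" for x
      proof -
        have "norm (l' x) \<le> \<bar>l x\<bar> + \<bar>l (sm \<i> x)\<bar>" using cmod_le[of "l' x"] by (simp add: l'_def)
        also have "\<dots> \<le> 2 * \<bar>C\<bar> * RN k x"
          using absl[OF x] absl[OF V_sm[OF k'(2) x], of \<i>] i_eq[OF x] by simp
        also have "\<dots> \<le> 2 * \<bar>C\<bar> * (C0 * nv k x)" using C0(2)[OF x] by (intro mult_left_mono) auto
        finally show ?thesis by (simp add: mult.assoc)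
      qed
    qed
    from pr_ex1[OF k this] obtain \<phi> where "\<phi> \<in> V (Suc k)" "\<And>x. x \<in> V k \<Longrightarrow> pr k \<phi> x = l' x" by blast
    then show "\<exists>\<phi>\<in>V (Suc k). \<forall>x\<in>V k. Re (pr k \<phi> x) = l x" by (intro bexI[of _ \<phi>]) (auto simp: l'_def)
  qed (auto simp: pr_add[OF k] pr_arg_add[OF k] pr_sm[OF k] pr_arg_sm[OF k] scr_def R(2) R(3))
qed

end

section \<open>Module actions on the dual tower\<close>

context quotient_tower
begin

text \<open>The map sending \<open>a\<close> to \<open>rep (s * a)\<close> is unaffected by deleting
  idempotents, so its pushforward kills \<open>delta (rep t) - delta t\<close>. Together with
  \<open>rep_mult_left\<close> this makes the relation behind \<open>rep\<close> a
  congruence.\<close>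

lemma rep_mult_right: "rep (s * rep t) = rep (s * t)"
proof -
  have "(\<lambda>u. delta (rep t) u - delta t u) \<in> Jideal"
    using q_eq_iff[OF delta_l1(1) delta_l1(1)] q_delta_rep by blast
  then have "push (\<lambda>a. rep (s * a)) (\<lambda>u. delta (rep t) u - delta t u) = (\<lambda>_. 0)"
    by (rule push_Jideal) (use rep_middle[of _ "s * a" for a] in \<open>simp add: mult.assoc\<close>)
  then have "delta (rep (s * rep t)) = delta (rep (s * t))"
    by (simp add: push_diff delta_l1 push_delta fun_eq_iff)
  then show ?thesis by (simp add: delta_inject)
qed

lemma rep_mult_left: "rep (rep s * t) = rep (s * t)"
proof -
  have "(\<lambda>u. delta (rep s) u - delta s u) \<in> Jideal"
    using q_eq_iff[OF delta_l1(1) delta_l1(1)] q_delta_rep by blast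
  then have "push (\<lambda>a. rep (a * t)) (\<lambda>u. delta (rep s) u - delta s u) = (\<lambda>_. 0)"
    by (rule push_Jideal) (use rep_middle[of _ a "b * t" for a b] in \<open>simp add: mult.assoc\<close>)
  then have "delta (rep (rep s * t)) = delta (rep (s * t))"
    by (simp add: push_diff delta_l1 push_delta fun_eq_iff)
  then show ?thesis by (simp add: delta_inject)
qed

lemma push_rep_conv:
  assumes f: "f \<in> l1" and g: "g \<in> l1"
  shows "push rep (conv f g) = push (\<lambda>(s, t). rep (s * t)) (tens (push rep f) (push rep g))"
proof -
  have "push rep (conv f g) = push (\<lambda>p. rep (fst p * snd p)) (tens f g)"
    by (simp add: conv_eq_push push_push[OF tens_l1(1)[OF f g]] case_prod_unfold)
  also have "(\<lambda>p. rep (fst p * snd p)) = (\<lambda>p. (\<lambda>(s, t). rep (s * t)) (map_prod rep rep p))"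
    by (auto simp: fun_eq_iff rep_mult_left rep_mult_right)
  also have "push \<dots> (tens f g) = push (\<lambda>(s, t). rep (s * t)) (push (map_prod rep rep) (tens f g))"
    by (rule push_push[OF tens_l1(1)[OF f g], symmetric])
  finally show ?thesis by (simp only: push_map_prod_tens[OF f g])
qed

lemma q_conv_cong:
  assumes "f \<in> l1" "f' \<in> l1" "g \<in> l1" "g' \<in> l1" "q f = q f'" "q g = q g'"
  shows "q (conv f g) = q (conv f' g')"
proof -
  have "push rep f = push rep f'" "push rep g = push rep g'" using assms q_eq_push_iff by auto
  then have "push rep (conv f g) = push rep (conv f' g')"
    using push_rep_conv[OF assms(1,3)] push_rep_conv[OF assms(2,4)] by simp
  then show ?thesis using q_eq_push_iff[OF conv_l1(1) conv_l1(1)] assms by simp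
qed

text \<open>Multiplication by an idempotent preserves classes, so \<open>\<alpha>\<close> acts on
  the right through its total mass, exactly as it does in the trivial left action.\<close>

lemma q_conv_idems:
  assumes f: "f \<in> l1" and \<alpha>: "\<alpha> \<in> l1E"
  shows "q (conv f \<alpha>) = sm (infsum \<alpha> UNIV) (q f)"
proof -
  have \<alpha>l: "\<alpha> \<in> l1" and \<alpha>0: "\<And>t. t \<notin> idems \<Longrightarrow> \<alpha> t = 0" using \<alpha> by (auto simp: l1E_def)
  have "push rep (conv f \<alpha>) = push rep (\<lambda>u. infsum \<alpha> UNIV * f u)"
  proof
    fix v
    have "push rep (conv f \<alpha>) v = infsum (tens f \<alpha>) {p. rep (fst p * snd p) = v}"
      unfolding conv_eq_push push_push[OF tens_l1(1)[OF f \<alpha>l]] by (simp add: push_def case_prod_unfold)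
    also have "\<dots> = infsum (tens f \<alpha>) ({s. rep s = v} \<times> UNIV)"
    proof (rule infsum_cong_neutral)
      have 0: "\<alpha> b = 0 \<or> rep (a * b) = rep a" for a b using \<alpha>0 rep_idem_right by blast
      show "tens f \<alpha> p = 0" if "p \<in> {s. rep s = v} \<times> UNIV - {p. rep (fst p * snd p) = v}" for p
        using that 0[of "snd p" "fst p"] by (auto simp: tens_def case_prod_unfold)
      show "tens f \<alpha> p = 0" if "p \<in> {p. rep (fst p * snd p) = v} - {s. rep s = v} \<times> UNIV" for p
        using that 0[of "snd p" "fst p"] by (cases p) (auto simp: tens_def)
    qed simp
    also have "\<dots> = push rep (\<lambda>u. infsum \<alpha> UNIV * f u) v"
      unfolding infsum_tens_product[OF f \<alpha>l] push_scale by (simp add: push_def mult.commute)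
    finally show "push rep (conv f \<alpha>) v = push rep (\<lambda>u. infsum \<alpha> UNIV * f u) v" .
  qed
  then show ?thesis
    using q_eq_push_iff[OF conv_l1(1)[OF f \<alpha>l] l1_scale(1)[OF f]] q_scale[OF f] by simp
qed

definition al :: "nat \<Rightarrow> ('s \<Rightarrow> complex) \<Rightarrow> 'v \<Rightarrow> 'v" where
  "al k f x = Sl q V pr k f x"

definition ar :: "nat \<Rightarrow> 'v \<Rightarrow> ('s \<Rightarrow> complex) \<Rightarrow> 'v" where
  "ar k x f = Sr q V pr k x f"

lemma al_Suc: "al (Suc k) f \<phi> = (THE \<psi>. \<psi> \<in> V (Suc k) \<and> (\<forall>x\<in>V k. pr k \<psi> x = pr k \<phi> (ar k x f)))"
  and ar_Suc: "ar (Suc k) \<phi> f = (THE \<psi>. \<psi> \<in> V (Suc k) \<and> (\<forall>x\<in>V k. pr k \<psi> x = pr k \<phi> (al k f x)))"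
  by (simp_all add: al_def ar_def)

lemma al_0: "f \<in> l1 \<Longrightarrow> g \<in> l1 \<Longrightarrow> al 0 f (q g) = q (conv f g)"
  using q_conv_cong[of f f "lift (q g)" g] lift[OF q_in, of g] by (simp add: al_def lift_def)

lemma ar_0: "f \<in> l1 \<Longrightarrow> g \<in> l1 \<Longrightarrow> ar 0 (q g) f = q (conv g f)"
  using q_conv_cong[of "lift (q g)" g f f] lift[OF q_in, of g] by (simp add: ar_def lift_def)

text \<open>The factor \<open>2\<close> is the price of passing from \<open>nv 0\<close> to
  \<open>RN 0\<close>; transposition preserves it, so it is the same at all levels.\<close>

definition act_level :: "nat \<Rightarrow> bool" where
  "act_level k \<longleftrightarrow> (\<forall>f\<in>l1. \<forall>x\<in>V k. al k f x \<in> V k \<and> ar k x f \<in> V k \<and>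
     (\<forall>y\<in>V k. al k f (x + y) = al k f x + al k f y \<and> ar k (x + y) f = ar k x f + ar k y f) \<and>
     (\<forall>c. al k f (sm c x) = sm c (al k f x) \<and> ar k (sm c x) f = sm c (ar k x f)) \<and>
     RN k (al k f x) \<le> 2 * l1norm f * RN k x \<and> RN k (ar k x f) \<le> 2 * l1norm f * RN k x)"

lemma act_levelD:
  assumes "act_level k" "f \<in> l1" "x \<in> V k"
  shows "al k f x \<in> V k" "ar k x f \<in> V k"
    "y \<in> V k \<Longrightarrow> al k f (x + y) = al k f x + al k f y" "y \<in> V k \<Longrightarrow> ar k (x + y) f = ar k x f + ar k y f"
    "al k f (sm c x) = sm c (al k f x)" "ar k (sm c x) f = sm c (ar k x f)"
    "RN k (al k f x) \<le> 2 * l1norm f * RN k x" "RN k (ar k x f) \<le> 2 * l1norm f * RN k x"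
  using assms unfolding act_level_def by blast+

lemma act_level_0: "act_level 0"
  unfolding act_level_def
proof (intro ballI)
  fix f :: "'s \<Rightarrow> complex" and x assume f: "f \<in> l1" and x: "x \<in> V 0"
  define g where "g = coords x"
  have g: "g \<in> l1" "q g = x" "l1norm g = nv 0 x"
    using coords_l1[OF x] q_coords[OF x] nv_coords[OF x] by (auto simp: g_def)
  have bd: "RN 0 (q h) \<le> 2 * l1norm f * RN 0 x" if h: "h \<in> l1" "l1norm h \<le> l1norm f * l1norm g" for h
  proof -
    have "RN 0 (q h) \<le> 2 * nv 0 (q h)" by (rule RN_0_le_nv(1)[OF q_in[OF h(1)]])
    also have "nv 0 (q h) \<le> l1norm h"
      using nv_coords[OF q_in[OF h(1)]] coords_q[OF h(1)] push_l1(2)[OF h(1)] by simp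
    also have "l1norm h \<le> l1norm f * RN 0 x"
      using h(2) mult_left_mono[OF RN_0_le_nv(2)[OF x] l1norm_nonneg[of f]] g(3) by simp
    finally show ?thesis by simp
  qed
  have "al 0 f (x + y) = al 0 f x + al 0 f y \<and> ar 0 (x + y) f = ar 0 x f + ar 0 y f" if y: "y \<in> V 0" for y
  proof -
    obtain h where h: "h \<in> l1" "q h = y" using q_surj[OF y] by blast
    have xy: "x + y = q (\<lambda>u. g u + h u)" using q_add[OF g(1) h(1)] g h by simp
    have "al 0 f (x + y) = q (\<lambda>u. conv f g u + conv f h u)"
      unfolding xy using al_0[OF f l1_add(1)[OF g(1) h(1)]] conv_add_right[OF f g(1) h(1)] by simp
    moreover have "ar 0 (x + y) f = q (\<lambda>u. conv g f u + conv h f u)"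
      unfolding xy using ar_0[OF f l1_add(1)[OF g(1) h(1)]] conv_add_left[OF g(1) h(1) f] by simp
    ultimately show ?thesis
      using q_add[OF conv_l1(1)[OF f g(1)] conv_l1(1)[OF f h(1)]] q_add[OF conv_l1(1)[OF g(1) f] conv_l1(1)[OF h(1) f]]
        al_0[OF f g(1)] al_0[OF f h(1)] ar_0[OF f g(1)] ar_0[OF f h(1)] g(2) h(2) by simp
  qed
  moreover have "al 0 f (sm c x) = sm c (al 0 f x) \<and> ar 0 (sm c x) f = sm c (ar 0 x f)" for c
  proof -
    have cx: "sm c x = q (\<lambda>u. c * g u)" using q_scale[OF g(1)] g by simp
    show ?thesis
      unfolding cx using al_0[OF f l1_scale(1)[OF g(1)]] ar_0[OF f l1_scale(1)[OF g(1)]]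
        q_scale[OF conv_l1(1)[OF f g(1)]] q_scale[OF conv_l1(1)[OF g(1) f]] al_0[OF f g(1)] ar_0[OF f g(1)] g(2)
      by (simp only: conv_scale_left conv_scale_right)
  qed
  moreover have "al 0 f x = q (conv f g)" "ar 0 x f = q (conv g f)" using al_0[OF f g(1)] ar_0[OF f g(1)] g(2) by auto
  ultimately show "al 0 f x \<in> V 0 \<and> ar 0 x f \<in> V 0 \<and>
     (\<forall>y\<in>V 0. al 0 f (x + y) = al 0 f x + al 0 f y \<and> ar 0 (x + y) f = ar 0 x f + ar 0 y f) \<and>
     (\<forall>c. al 0 f (sm c x) = sm c (al 0 f x) \<and> ar 0 (sm c x) f = sm c (ar 0 x f)) \<and>
     RN 0 (al 0 f x) \<le> 2 * l1norm f * RN 0 x \<and> RN 0 (ar 0 x f) \<le> 2 * l1norm f * RN 0 x"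
    using bd[OF conv_l1(1)[OF f g(1)] conv_l1(2)[OF f g(1)]] bd[OF conv_l1(1)[OF g(1) f]] conv_l1(2)[OF g(1) f]
      q_in conv_l1(1)[OF f g(1)] conv_l1(1)[OF g(1) f] by (simp add: mult.commute)
qed

text \<open>Justifies the \<open>THE\<close> in \<open>tact_l\<close> and \<open>tact_r\<close>:
  bounded linear maps have transposes on the next level.\<close>

lemma adjoint_exists:
  assumes k: "k < L" and \<phi>: "\<phi> \<in> V (Suc k)"
    and T: "\<And>x. x \<in> V k \<Longrightarrow> T x \<in> V k" "\<And>x y. x \<in> V k \<Longrightarrow> y \<in> V k \<Longrightarrow> T (x + y) = T x + T y"
      "\<And>x c. x \<in> V k \<Longrightarrow> T (sm c x) = sm c (T x)" "\<And>x. x \<in> V k \<Longrightarrow> RN k (T x) \<le> B * RN k x"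
  shows "\<exists>!\<psi>. \<psi> \<in> V (Suc k) \<and> (\<forall>x\<in>V k. pr k \<psi> x = pr k \<phi> (T x))"
proof (rule pr_ex1[OF k])
  have lev: "norm_level k" using norm_level k by simp
  obtain C where C: "0 \<le> C" "\<And>x. x \<in> V k \<Longrightarrow> norm (pr k \<phi> x) \<le> C * RN k x"
    using pr_bounded[OF k lev \<phi>] by blast
  obtain C0 where C0: "C0 > 0" "\<And>x. x \<in> V k \<Longrightarrow> RN k x \<le> C0 * nv k x"
    using lev by (auto simp: norm_level_def)
  interpret nspace "V k" scr "RN k" using lev by (simp add: norm_level_def)
  show "bfun (V k) sm (nv k) (\<lambda>x. pr k \<phi> (T x))"
    unfolding bfun_def
  proof (intro conjI ballI allI exI)
    show "pr k \<phi> (T (x + y)) = pr k \<phi> (T x) + pr k \<phi> (T y)" if "x \<in> V k" "y \<in> V k" for x y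
      using that T pr_arg_add[OF k \<phi>] by simp
    show "pr k \<phi> (T (sm c x)) = c * pr k \<phi> (T x)" if "x \<in> V k" for c x
      using that T pr_arg_sm[OF k \<phi>] by simp
    show "norm (pr k \<phi> (T x)) \<le> (C * \<bar>B\<bar> * C0) * nv k x" if x: "x \<in> V k" for x
    proof -
      have "norm (pr k \<phi> (T x)) \<le> C * RN k (T x)" by (rule C(2)[OF T(1)[OF x]])
      also have "\<dots> \<le> C * (\<bar>B\<bar> * RN k x)"
        using T(4)[OF x] mult_right_mono[OF abs_ge_self[of B] N_nonneg[OF x]] C(1)
        by (intro mult_left_mono) auto
      also have "\<dots> \<le> C * (\<bar>B\<bar> * (C0 * nv k x))" using C0(2)[OF x] C(1) by (intro mult_left_mono) auto
      finally show ?thesis by (simp add: mult.assoc)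
    qed
  qed
qed

lemma act_Suc:
  assumes k: "k < L" and lev: "act_level k" and \<phi>: "\<phi> \<in> V (Suc k)" and f: "f \<in> l1"
  shows "al (Suc k) f \<phi> \<in> V (Suc k)" "\<And>x. x \<in> V k \<Longrightarrow> pr k (al (Suc k) f \<phi>) x = pr k \<phi> (ar k x f)"
    "ar (Suc k) \<phi> f \<in> V (Suc k)" "\<And>x. x \<in> V k \<Longrightarrow> pr k (ar (Suc k) \<phi> f) x = pr k \<phi> (al k f x)"
proof -
  note A = act_levelD[OF lev f]
  have "\<exists>!\<psi>. \<psi> \<in> V (Suc k) \<and> (\<forall>x\<in>V k. pr k \<psi> x = pr k \<phi> (ar k x f))"
    by (rule adjoint_exists[OF k \<phi>, of _ "2 * l1norm f"]) (use A in auto)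
  from theI'[OF this] show "al (Suc k) f \<phi> \<in> V (Suc k)"
    "\<And>x. x \<in> V k \<Longrightarrow> pr k (al (Suc k) f \<phi>) x = pr k \<phi> (ar k x f)" unfolding al_Suc by auto
  have "\<exists>!\<psi>. \<psi> \<in> V (Suc k) \<and> (\<forall>x\<in>V k. pr k \<psi> x = pr k \<phi> (al k f x))"
    by (rule adjoint_exists[OF k \<phi>, of _ "2 * l1norm f"]) (use A in auto)
  from theI'[OF this] show "ar (Suc k) \<phi> f \<in> V (Suc k)"
    "\<And>x. x \<in> V k \<Longrightarrow> pr k (ar (Suc k) \<phi> f) x = pr k \<phi> (al k f x)" unfolding ar_Suc by auto
qed

lemma act_level_Suc:
  assumes k: "k < L" and lev: "act_level k"
  shows "act_level (Suc k)"
  unfolding act_level_def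
proof (intro ballI)
  fix f :: "'s \<Rightarrow> complex" and \<phi> assume f: "f \<in> l1" and \<phi>: "\<phi> \<in> V (Suc k)"
  have s: "Suc k \<le> L" using k by simp
  note A = act_levelD[OF lev f] and S = act_Suc[OF k lev _ f]
  interpret dual_pair "V k" scr "RN k" "V (Suc k)" "RN (Suc k)" "\<lambda>\<phi> x. Re (pr k \<phi> x)"
    by (rule dual_pair_level[OF k])
  have "al (Suc k) f (\<phi> + \<psi>) = al (Suc k) f \<phi> + al (Suc k) f \<psi> \<and> ar (Suc k) (\<phi> + \<psi>) f = ar (Suc k) \<phi> f + ar (Suc k) \<psi> f"
    if \<psi>: "\<psi> \<in> V (Suc k)" for \<psi>
  proof
    have sum: "\<phi> + \<psi> \<in> V (Suc k)" by (rule V_add[OF s \<phi> \<psi>])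
    show "al (Suc k) f (\<phi> + \<psi>) = al (Suc k) f \<phi> + al (Suc k) f \<psi>"
      by (rule pr_eqI[OF k S(1)[OF sum] V_add[OF s S(1)[OF \<phi>] S(1)[OF \<psi>]]])
         (simp add: S(2) sum \<phi> \<psi> pr_add[OF k] S(1) A(2))
    show "ar (Suc k) (\<phi> + \<psi>) f = ar (Suc k) \<phi> f + ar (Suc k) \<psi> f"
      by (rule pr_eqI[OF k S(3)[OF sum] V_add[OF s S(3)[OF \<phi>] S(3)[OF \<psi>]]])
         (simp add: S(4) sum \<phi> \<psi> pr_add[OF k] S(3) A(1))
  qed
  moreover have "al (Suc k) f (sm c \<phi>) = sm c (al (Suc k) f \<phi>) \<and> ar (Suc k) (sm c \<phi>) f = sm c (ar (Suc k) \<phi> f)" for c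
  proof
    have c\<phi>: "sm c \<phi> \<in> V (Suc k)" by (rule V_sm[OF s \<phi>])
    show "al (Suc k) f (sm c \<phi>) = sm c (al (Suc k) f \<phi>)"
      by (rule pr_eqI[OF k S(1)[OF c\<phi>] V_sm[OF s S(1)[OF \<phi>]]])
         (simp add: S(2) c\<phi> \<phi> pr_sm[OF k] S(1) A(2))
    show "ar (Suc k) (sm c \<phi>) f = sm c (ar (Suc k) \<phi> f)"
      by (rule pr_eqI[OF k S(3)[OF c\<phi>] V_sm[OF s S(3)[OF \<phi>]]])
         (simp add: S(4) c\<phi> \<phi> pr_sm[OF k] S(3) A(1))
  qed
  moreover have "RN (Suc k) (al (Suc k) f \<phi>) \<le> 2 * l1norm f * RN (Suc k) \<phi>"
  proof (rule norm_least[OF S(1)[OF \<phi>]])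
    show nn: "0 \<le> 2 * l1norm f * RN (Suc k) \<phi>" using l1norm_nonneg[of f] W.N_nonneg[OF \<phi>] by simp
    fix x assume x: "x \<in> V k"
    have "Re (pr k (al (Suc k) f \<phi>) x) \<le> RN (Suc k) \<phi> * RN k (ar k x f)"
      using pr_le[OF \<phi> A(2)[OF x]] S(2)[OF \<phi> x] by simp
    also have "\<dots> \<le> RN (Suc k) \<phi> * (2 * l1norm f * RN k x)"
      using A(8)[OF x] W.N_nonneg[OF \<phi>] by (intro mult_left_mono)
    finally show "Re (pr k (al (Suc k) f \<phi>) x) \<le> 2 * l1norm f * RN (Suc k) \<phi> * RN k x" by (simp only: mult_ac)
  qed
  moreover have "RN (Suc k) (ar (Suc k) \<phi> f) \<le> 2 * l1norm f * RN (Suc k) \<phi>"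
  proof (rule norm_least[OF S(3)[OF \<phi>]])
    show nn: "0 \<le> 2 * l1norm f * RN (Suc k) \<phi>" using l1norm_nonneg[of f] W.N_nonneg[OF \<phi>] by simp
    fix x assume x: "x \<in> V k"
    have "Re (pr k (ar (Suc k) \<phi> f) x) \<le> RN (Suc k) \<phi> * RN k (al k f x)"
      using pr_le[OF \<phi> A(1)[OF x]] S(4)[OF \<phi> x] by simp
    also have "\<dots> \<le> RN (Suc k) \<phi> * (2 * l1norm f * RN k x)"
      using A(7)[OF x] W.N_nonneg[OF \<phi>] by (intro mult_left_mono)
    finally show "Re (pr k (ar (Suc k) \<phi> f) x) \<le> 2 * l1norm f * RN (Suc k) \<phi> * RN k x" by (simp only: mult_ac)
  qed
  ultimately show "al (Suc k) f \<phi> \<in> V (Suc k) \<and> ar (Suc k) \<phi> f \<in> V (Suc k) \<and>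
     (\<forall>y\<in>V (Suc k). al (Suc k) f (\<phi> + y) = al (Suc k) f \<phi> + al (Suc k) f y \<and> ar (Suc k) (\<phi> + y) f = ar (Suc k) \<phi> f + ar (Suc k) y f) \<and>
     (\<forall>c. al (Suc k) f (sm c \<phi>) = sm c (al (Suc k) f \<phi>) \<and> ar (Suc k) (sm c \<phi>) f = sm c (ar (Suc k) \<phi> f)) \<and>
     RN (Suc k) (al (Suc k) f \<phi>) \<le> 2 * l1norm f * RN (Suc k) \<phi> \<and> RN (Suc k) (ar (Suc k) \<phi> f) \<le> 2 * l1norm f * RN (Suc k) \<phi>"
    using S(1,3)[OF \<phi>] by blast
qed

lemma act_level: "k \<le> L \<Longrightarrow> act_level k"
  by (induction k) (auto intro: act_level_0 act_level_Suc)

lemmas act = act_levelD[OF act_level]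

lemma pr_al: "k < L \<Longrightarrow> \<phi> \<in> V (Suc k) \<Longrightarrow> f \<in> l1 \<Longrightarrow> x \<in> V k \<Longrightarrow> pr k (al (Suc k) f \<phi>) x = pr k \<phi> (ar k x f)"
  using act_Suc(2) act_level by simp

lemma pr_ar: "k < L \<Longrightarrow> \<phi> \<in> V (Suc k) \<Longrightarrow> f \<in> l1 \<Longrightarrow> x \<in> V k \<Longrightarrow> pr k (ar (Suc k) \<phi> f) x = pr k \<phi> (al k f x)"
  using act_Suc(4) act_level by simp

end

section \<open>Algebraic laws of the module actions\<close>

context quotient_tower
begin

lemma act_add_alg:
  assumes f: "f \<in> l1" and g: "g \<in> l1"
  shows "k \<le> L \<Longrightarrow> x \<in> V k \<Longrightarrow> al k (\<lambda>u. f u + g u) x = al k f x + al k g x \<and>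
    ar k x (\<lambda>u. f u + g u) = ar k x f + ar k x g"
proof (induction k arbitrary: x)
  case 0
  then obtain h where h: "h \<in> l1" "q h = x" using q_surj by blast
  show ?case
    using al_0[OF l1_add(1)[OF f g] h(1)] ar_0[OF l1_add(1)[OF f g] h(1)] al_0[OF f h(1)] al_0[OF g h(1)]
      ar_0[OF f h(1)] ar_0[OF g h(1)] h(2) conv_add_left[OF f g h(1)] conv_add_right[OF h(1) f g]
      q_add[OF conv_l1(1)[OF f h(1)] conv_l1(1)[OF g h(1)]] q_add[OF conv_l1(1)[OF h(1) f] conv_l1(1)[OF h(1) g]]
    by simp
next
  case (Suc k)
  then have k: "k < L" and x: "x \<in> V (Suc k)" and s: "Suc k \<le> L" "k \<le> L" by auto
  note fg = l1_add(1)[OF f g]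
  have IH: "al k (\<lambda>u. f u + g u) z = al k f z + al k g z" "ar k z (\<lambda>u. f u + g u) = ar k z f + ar k z g"
    if "z \<in> V k" for z using Suc.IH[OF s(2) that] by auto
  show ?case
  proof
    show "al (Suc k) (\<lambda>u. f u + g u) x = al (Suc k) f x + al (Suc k) g x"
      using f g by (intro pr_eqI[OF k] act[OF s(1)] V_add[OF s(1)] fg x)
        (simp_all add: pr_al[OF k] x fg pr_add[OF k] act[OF s(1)] act[OF s(2)] IH pr_arg_add[OF k])
    show "ar (Suc k) x (\<lambda>u. f u + g u) = ar (Suc k) x f + ar (Suc k) x g"
      using f g by (intro pr_eqI[OF k] act[OF s(1)] V_add[OF s(1)] fg x)
        (simp_all add: pr_ar[OF k] x fg pr_add[OF k] act[OF s(1)] act[OF s(2)] IH pr_arg_add[OF k])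
  qed
qed

lemma act_scale_alg:
  assumes f: "f \<in> l1"
  shows "k \<le> L \<Longrightarrow> x \<in> V k \<Longrightarrow> al k (\<lambda>u. c * f u) x = sm c (al k f x) \<and>
    ar k x (\<lambda>u. c * f u) = sm c (ar k x f)"
proof (induction k arbitrary: x)
  case 0
  then obtain h where h: "h \<in> l1" "q h = x" using q_surj by blast
  show ?case
    using al_0[OF l1_scale(1)[OF f] h(1)] ar_0[OF l1_scale(1)[OF f] h(1)] al_0[OF f h(1)]
      ar_0[OF f h(1)] h(2) q_scale[OF conv_l1(1)[OF f h(1)]] q_scale[OF conv_l1(1)[OF h(1) f]]
    by (simp add: conv_scale_left conv_scale_right)
next
  case (Suc k)
  then have k: "k < L" and x: "x \<in> V (Suc k)" and s: "Suc k \<le> L" "k \<le> L" by auto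
  note cf = l1_scale(1)[OF f, of c]
  have IH: "al k (\<lambda>u. c * f u) z = sm c (al k f z)" "ar k z (\<lambda>u. c * f u) = sm c (ar k z f)"
    if "z \<in> V k" for z using Suc.IH[OF s(2) that] by auto
  show ?case
  proof
    show "al (Suc k) (\<lambda>u. c * f u) x = sm c (al (Suc k) f x)"
      using f by (intro pr_eqI[OF k] act[OF s(1)] V_sm[OF s(1)] cf x)
        (simp_all add: pr_al[OF k] x cf pr_sm[OF k] act[OF s(1)] act[OF s(2)] IH pr_arg_sm[OF k])
    show "ar (Suc k) x (\<lambda>u. c * f u) = sm c (ar (Suc k) x f)"
      using f by (intro pr_eqI[OF k] act[OF s(1)] V_sm[OF s(1)] cf x)
        (simp_all add: pr_ar[OF k] x cf pr_sm[OF k] act[OF s(1)] act[OF s(2)] IH pr_arg_sm[OF k])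
  qed
qed

text \<open>The laws are proved jointly because transposition exchanges the left and the right
  action.\<close>

lemma act_delta:
  "k \<le> L \<Longrightarrow> x \<in> V k \<Longrightarrow>
    al k (delta s) (al k (delta t) x) = al k (delta (s * t)) x \<and>
    ar k (ar k x (delta s)) (delta t) = ar k x (delta (s * t)) \<and>
    ar k (al k (delta s) x) (delta t) = al k (delta s) (ar k x (delta t)) \<and>
    (e \<in> idems \<longrightarrow> al k (delta e) x = x \<and> ar k x (delta e) = x)"
proof (induction k arbitrary: x s t)
  case 0
  then obtain h where h: "h \<in> l1" "q h = x" using q_surj by blast
  note d = delta_l1(1)
  have L0: "al 0 (delta s) (q g) = q (push (\<lambda>a. s * a) g)" if "g \<in> l1" for g s
    using al_0[OF d that] conv_delta_left[OF that] by simp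
  have R0: "ar 0 (q g) (delta s) = q (push (\<lambda>a. a * s) g)" if "g \<in> l1" for g s
    using ar_0[OF d that] conv_delta_right[OF that] by simp
  have "q (push (\<lambda>a. e * a) h) = q h" "q (push (\<lambda>a. a * e) h) = q h" if e: "e \<in> idems"
    using q_eq_push_iff[OF push_l1(1)[OF h(1)] h(1)] push_push[OF h(1), of rep]
    by (simp_all add: rep_idem_left[OF e] rep_idem_right[OF e])
  then show ?case
    using h by (auto simp: L0 R0 push_l1(1) push_push mult.assoc)
next
  case (Suc k)
  then have k: "k < L" and x: "x \<in> V (Suc k)" and s: "Suc k \<le> L" "k \<le> L" by auto
  note d = delta_l1(1)
  have IH: "al k (delta a) (al k (delta b) z) = al k (delta (a * b)) z"
    "ar k (ar k z (delta a)) (delta b) = ar k z (delta (a * b))"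
    "ar k (al k (delta a) z) (delta b) = al k (delta a) (ar k z (delta b))"
    "e \<in> idems \<Longrightarrow> al k (delta e) z = z" "e \<in> idems \<Longrightarrow> ar k z (delta e) = z"
    if "z \<in> V k" for z a b using Suc.IH[OF s(2) that, of a b] by auto
  note simps = pr_al[OF k] pr_ar[OF k] x d act(1,2)[OF s(1)] act(1,2)[OF s(2)] IH
  note intros = pr_eqI[OF k] act(1,2)[OF s(1)] x d
  show ?case
  proof (intro conjI impI)
    show "al (Suc k) (delta s) (al (Suc k) (delta t) x) = al (Suc k) (delta (s * t)) x"
      by (intro intros) (simp add: simps)
    show "ar (Suc k) (ar (Suc k) x (delta s)) (delta t) = ar (Suc k) x (delta (s * t))"
      by (intro intros) (simp add: simps)
    show "ar (Suc k) (al (Suc k) (delta s) x) (delta t) = al (Suc k) (delta s) (ar (Suc k) x (delta t))"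
      by (intro intros) (simp add: simps)
    show "al (Suc k) (delta e) x = x" "ar (Suc k) x (delta e) = x" if "e \<in> idems"
      using that by (intro intros; simp add: simps)+
  qed
qed

lemma
  assumes "k \<le> L" "x \<in> V k"
  shows al_al: "al k (delta s) (al k (delta t) x) = al k (delta (s * t)) x"
    and ar_ar: "ar k (ar k x (delta s)) (delta t) = ar k x (delta (s * t))"
    and ar_al: "ar k (al k (delta s) x) (delta t) = al k (delta s) (ar k x (delta t))"
    and al_idem: "e \<in> idems \<Longrightarrow> al k (delta e) x = x"
    and ar_idem: "e \<in> idems \<Longrightarrow> ar k x (delta e) = x"
  using act_delta[OF assms] by blast+

text \<open>Both actions reduce to the total mass of \<open>\<alpha>\<close>. This yields
  commutativity of the module and, in \<open>derivation_scale\<close>, the homogeneity of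
  derivations.\<close>

lemma E_act:
  assumes \<alpha>: "\<alpha> \<in> l1E"
  shows "k \<le> L \<Longrightarrow> x \<in> V k \<Longrightarrow> El q V pr k \<alpha> x = sm (infsum \<alpha> UNIV) x \<and> Er q V pr k x \<alpha> = sm (infsum \<alpha> UNIV) x"
proof (induction k arbitrary: x)
  case 0
  then have l: "lift x \<in> l1" "q (lift x) = x" using lift by auto
  show ?case
    using q_scale[OF l(1)] q_conv_idems[OF l(1) \<alpha>] l(2)
    by (simp add: Eact_l_def Eact_r_def lift_def)
next
  case (Suc k)
  then have k: "k < L" and x: "x \<in> V (Suc k)" and s: "Suc k \<le> L" "k \<le> L" by auto
  let ?c = "infsum \<alpha> UNIV"
  have eq: "(THE \<psi>. \<psi> \<in> V (Suc k) \<and> (\<forall>z\<in>V k. pr k \<psi> z = pr k x (T z))) = sm ?c x"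
    if T: "\<And>z. z \<in> V k \<Longrightarrow> T z = sm ?c z" for T
  proof (rule the_equality)
    show "sm ?c x \<in> V (Suc k) \<and> (\<forall>z\<in>V k. pr k (sm ?c x) z = pr k x (T z))"
      using V_sm[OF s(1) x] T by (simp add: pr_sm[OF k x] pr_arg_sm[OF k x])
    then show "\<psi> = sm ?c x" if "\<psi> \<in> V (Suc k) \<and> (\<forall>z\<in>V k. pr k \<psi> z = pr k x (T z))" for \<psi>
      using that by (intro pr_eqI[OF k]) auto
  qed
  show ?case unfolding tact_l.simps(2) tact_r.simps(2)
    using Suc.IH[OF s(2)] by (intro conjI eq) auto
qed

section \<open>Conjugation by semigroup elements\<close>

definition cj :: "nat \<Rightarrow> 's \<Rightarrow> 'v \<Rightarrow> 'v" where
  "cj k g x = ar k (al k (delta g) x) (delta (star g))"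

lemma cj_in: "k \<le> L \<Longrightarrow> x \<in> V k \<Longrightarrow> cj k g x \<in> V k"
  unfolding cj_def by (intro act delta_l1)

lemma cj_add: "k \<le> L \<Longrightarrow> x \<in> V k \<Longrightarrow> y \<in> V k \<Longrightarrow> cj k g (x + y) = cj k g x + cj k g y"
  unfolding cj_def by (simp add: act delta_l1)

lemma cj_star_cj:
  assumes k: "k \<le> L" and x: "x \<in> V k"
  shows "cj k (star g) (cj k g x) = x"
proof -
  let ?g = "delta g :: 's \<Rightarrow> complex" and ?h = "delta (star g) :: 's \<Rightarrow> complex"
  have in': "al k ?g x \<in> V k" "ar k x ?h \<in> V k" using act(1,2)[OF k delta_l1(1) x] by auto
  have "cj k (star g) (cj k g x) = ar k (al k ?h (al k ?g (ar k x ?h))) ?g"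
    unfolding cj_def star_star[OF inv] using ar_al[OF k x] by simp
  also have "\<dots> = ar k (ar k x ?h) ?g"
    using al_al[OF k in'(2)] al_idem[OF k in'(2) star_idems(2)[OF inv]] by simp
  also have "\<dots> = x" using ar_ar[OF k x] ar_idem[OF k x star_idems(2)[OF inv]] by simp
  finally show ?thesis .
qed

lemma pr_cj:
  assumes k: "k < L" and \<phi>: "\<phi> \<in> V (Suc k)" and x: "x \<in> V k"
  shows "pr k (cj (Suc k) g \<phi>) x = pr k \<phi> (cj k (star g) x)"
proof -
  have s: "Suc k \<le> L" "k \<le> L" using k by auto
  show ?thesis unfolding cj_def star_star[OF inv]
    using pr_ar[OF k act(1)[OF s(1) delta_l1(1) \<phi>] delta_l1(1) x]
      pr_al[OF k \<phi> delta_l1(1) act(1)[OF s(2) delta_l1(1) x]] by simp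
qed

lemma rep_conj: "rep (star g * rep (g * t * star g) * g) = rep t"
proof -
  have "rep (star g * rep (g * t * star g) * g) = rep (rep (star g * rep (g * t * star g)) * g)"
    by (simp only: rep_mult_left)
  also have "\<dots> = rep (star g * (g * t * star g) * g)" by (simp only: rep_mult_left rep_mult_right)
  also have "\<dots> = rep ((star g * g) * t * (star g * g))" by (simp only: mult.assoc)
  also have "\<dots> = rep t" by (simp only: rep_idem_right[OF star_idems(2)[OF inv]] rep_idem_left[OF star_idems(2)[OF inv]])
  finally show ?thesis .
qed

text \<open>By \<open>rep_conj\<close>, conjugation permutes the classes, with inverse given by
  \<open>star g\<close>; so only one point of \<open>range rep\<close> contributes to the fibre over
  \<open>u\<close>.\<close>

lemma coords_cj:
  assumes x: "x \<in> V 0" and u: "u \<in> range rep"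
  shows "coords (cj 0 g x) u = coords x (rep (star g * u * g))"
proof -
  note c = coords_l1[OF x]
  have "cj 0 g x = q (push (\<lambda>t. g * t * star g) (coords x))"
    unfolding cj_def using al_0[OF delta_l1(1) c] q_coords[OF x] conv_delta_left[OF c]
      ar_0[OF delta_l1(1) push_l1(1)[OF c]] conv_delta_right[OF push_l1(1)[OF c, of "(*) g"], of "star g"]
      push_push[OF c, of "\<lambda>t. t * star g" "(*) g"]
    by simp
  then have "coords (cj 0 g x) = push (\<lambda>t. rep (g * t * star g)) (coords x)"
    using coords_q[OF push_l1(1)[OF c]] push_push[OF c] by simp
  then have "coords (cj 0 g x) u = infsum (coords x) {t. rep (g * t * star g) = u}" by (simp add: push_def)
  also have "\<dots> = infsum (coords x) {rep (star g * u * g)}"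
  proof (rule infsum_cong_neutral)
    have ru: "rep u = u" using u rep_rep by auto
    show "coords x t = 0" if "t \<in> {rep (star g * u * g)} - {t. rep (g * t * star g) = u}" for t
      using that rep_conj[of "star g" u] ru by (auto simp: star_star[OF inv])
    show "coords x t = 0" if t: "t \<in> {t. rep (g * t * star g) = u} - {rep (star g * u * g)}" for t
    proof (rule coords_supp, rule notI)
      assume "t \<in> range rep"
      then have "rep t = t" using rep_rep by auto
      then show False using t rep_conj[of g t] by auto
    qed
  qed simp
  finally show ?thesis by simp
qed

lemma coord_cj: "x \<in> V 0 \<Longrightarrow> w \<in> range rep \<times> UNIV \<Longrightarrow>
    coord (cj 0 g x) w = coord x (map_prod (\<lambda>u. rep (star g * u * g)) id w)"
  using coords_cj by (auto simp: coord_def)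

lemma coord_supp: "w \<notin> range rep \<times> UNIV \<Longrightarrow> coord x w = 0"
  using coords_supp by (cases w) (auto simp: coord_def)

lemma RN_cj_le_0:
  assumes x: "x \<in> V 0"
  shows "RN 0 (cj 0 g x) \<le> RN 0 x"
proof -
  let ?\<tau> = "map_prod (\<lambda>u. rep (star g * u * g)) (id :: bool \<Rightarrow> bool)" and ?\<Omega> = "range rep \<times> (UNIV :: bool set)"
  have inj: "inj_on ?\<tau> ?\<Omega>"
  proof (rule inj_on_inverseI)
    show "map_prod (\<lambda>u. rep (g * u * star g)) id (?\<tau> w) = w" if "w \<in> ?\<Omega>" for w
      using that rep_conj[of "star g"] by (auto simp: star_star[OF inv] rep_rep)
  qed
  have "RN 0 (cj 0 g x) = infsum (\<lambda>w. \<bar>coord x (?\<tau> w)\<bar>) ?\<Omega>"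
    unfolding RN.simps by (rule infsum_cong_neutral) (auto simp: coord_supp coord_cj[OF x] simp del: map_prod_simp)
  also have "\<dots> = infsum (\<lambda>w. \<bar>coord x w\<bar>) (?\<tau> ` ?\<Omega>)"
    using infsum_reindex[OF inj, of "\<lambda>w. \<bar>coord x w\<bar>"] by (simp add: o_def)
  also have "\<dots> \<le> RN 0 x"
    unfolding RN.simps using coord_summable[OF x]
    by (intro infsum_mono2) (auto intro: summable_on_subset_banach)
  finally show ?thesis .
qed

text \<open>Conjugations by \<open>g\<close> and \<open>star g\<close> are mutually inverse, so it
  suffices that both are contractive. This passes to the dual because the transpose of a conjugation
  is again one.\<close>

lemma RN_cj: "k \<le> L \<Longrightarrow> x \<in> V k \<Longrightarrow> RN k (cj k g x) = RN k x"
proof (induction k arbitrary: x g)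
  case 0
  then show ?case
    using RN_cj_le_0[of x g] RN_cj_le_0[OF cj_in, of x "star g" g] cj_star_cj[of 0 x g] by simp
next
  case (Suc k)
  then have k: "k < L" and s: "Suc k \<le> L" "k \<le> L" by auto
  interpret dual_pair "V k" scr "RN k" "V (Suc k)" "RN (Suc k)" "\<lambda>\<phi> x. Re (pr k \<phi> x)"
    by (rule dual_pair_level[OF k])
  have le: "RN (Suc k) (cj (Suc k) g \<phi>) \<le> RN (Suc k) \<phi>" if \<phi>: "\<phi> \<in> V (Suc k)" for g \<phi>
    using pr_le[OF \<phi> cj_in[OF s(2)]] Suc.IH[OF s(2)]
    by (intro norm_least[OF cj_in[OF s(1) \<phi>] W.N_nonneg[OF \<phi>]]) (simp add: pr_cj[OF k \<phi>])
  show ?case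
    using le[OF Suc.prems(2), of g] le[OF cj_in[OF s(1) Suc.prems(2)], of "star g" g]
      cj_star_cj[OF s(1) Suc.prems(2), of g] by simp
qed

section \<open>Approximate means on the even levels\<close>

lemma approx_mean_0: "approx_mean (V 0) (RN 0) (cj 0)"
proof (rule nspace.approx_mean_l1[OF nspace_level, where coord = coord and \<Omega> = "range rep \<times> UNIV"
      and \<tau> = "\<lambda>g. map_prod (\<lambda>u. rep (star g * u * g)) id"])
  fix f :: "'s \<times> bool \<Rightarrow> real"
  assume supp: "\<And>w. w \<notin> range rep \<times> UNIV \<Longrightarrow> f w = 0" and s: "(\<lambda>w. \<bar>f w\<bar>) summable_on UNIV"
  define F where "F u = Complex (f (u, True)) (f (u, False))" for u
  have slice: "(\<lambda>u. \<bar>f (u, b)\<bar>) summable_on UNIV" for b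
    using summable_on_reindex[of "\<lambda>u. (u, b)" UNIV "\<lambda>w. \<bar>f w\<bar>"] summable_on_subset_banach[OF s, of "range (\<lambda>u. (u, b))"]
    by (simp add: inj_on_def o_def)
  have "(\<lambda>u. norm (F u)) summable_on UNIV"
    by (rule summable_on_comparison_test[OF summable_on_add[OF slice[of True] slice[of False]]])
       (auto simp: F_def intro: order_trans[OF cmod_le])
  then have F: "F \<in> l1" by (simp add: l1_def)
  have "coords (q F) = F" using F supp by (intro coords_surj) (auto simp: F_def Complex_eq_0)
  then have "coord (q F) = f" by (auto simp: coord_def F_def fun_eq_iff)
  then show "\<exists>x\<in>V 0. coord x = f" using q_in[OF F] by blast
qed (auto simp: coord_add coord_supp coord_summable RN.simps(1)[symmetric] cj_in cj_add RN_cj coord_cj simp del: map_prod_simp)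

text \<open>Each step passes to a bidual; the odd level in between is the test space, on which
  conjugation by \<open>star g\<close> is the adjoint.\<close>

lemma approx_mean_even: "2 * j \<le> L \<Longrightarrow> approx_mean (V (2 * j)) (RN (2 * j)) (cj (2 * j))"
proof (induction j)
  case 0 show ?case using approx_mean_0 by simp
next
  case (Suc j)
  let ?k = "2 * j"
  have k: "?k < L" "Suc ?k < L" "?k \<le> L" "Suc ?k \<le> L" "Suc (Suc ?k) \<le> L" using Suc.prems by auto
  interpret bidual_pair "V ?k" scr "RN ?k" "V (Suc ?k)" "RN (Suc ?k)" "\<lambda>\<phi> x. Re (pr ?k \<phi> x)"
    "V (Suc (Suc ?k))" "RN (Suc (Suc ?k))" "\<lambda>\<phi> x. Re (pr (Suc ?k) \<phi> x)"
    using dual_pair_level[OF k(1)] dual_pair_level[OF k(2)] by (rule bidual_pair.intro)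
  have "approx_mean (V (Suc (Suc ?k))) (RN (Suc (Suc ?k))) (cj (Suc (Suc ?k)))"
    by (rule approx_mean_bidual[of "cj ?k" "cj (Suc ?k)" _ star])
       (use Suc k in \<open>simp_all add: cj_in cj_add pr_cj star_star[OF inv]\<close>)
  then show ?case by simp
qed

section \<open>Commutativity and innerness of derivations\<close>

lemma commutative: "k \<le> L \<Longrightarrow> commutative_Emod q V pr k"
  unfolding commutative_Emod_def using E_act by simp

lemma idems_nonempty: "\<exists>e :: 's. e \<in> idems"
  using star_idems(1)[OF inv] by blast

text \<open>Module derivations are only assumed additive. Complex homogeneity comes from
  \<open>l1E\<close>-linearity, because \<open>c * delta e\<close> acts as the scalar
  \<open>c\<close>.\<close>

lemma derivation_scale:
  assumes D: "module_derivation q V pr nv L D" and a: "a \<in> l1"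
  shows "D (\<lambda>u. c * a u) = sm c (D a)"
proof -
  obtain e :: 's where e: "e \<in> idems" using idems_nonempty by blast
  let ?\<alpha> = "\<lambda>u. c * delta e u"
  have \<alpha>: "?\<alpha> \<in> l1E" using e l1_scale(1)[OF delta_l1(1)] by (auto simp: l1E_def delta_def)
  have "infsum (delta e) UNIV = 1"
    using fun_cong[OF push_delta[of "\<lambda>_. ()" e], of "()"] by (simp add: push_def delta_def)
  then have s: "infsum ?\<alpha> UNIV = c" by (simp add: infsum_cmult_right')
  have "D (Eact_l ?\<alpha> a) = El q V pr L ?\<alpha> (D a)" "D a \<in> V L"
    using D \<alpha> a unfolding module_derivation_def by blast+
  then show ?thesis using E_act[OF \<alpha>, of L "D a"] by (simp add: Eact_l_def s)
qed

lemma derivation_inner: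
  assumes D: "module_derivation q V pr nv L D" and n: "L = 2 * n" "0 < n"
  shows "inner_derivation q V pr L D"
proof -
  have Din: "D a \<in> V L" if "a \<in> l1" for a using D that unfolding module_derivation_def by blast
  have Dadd: "D (\<lambda>u. a u + b u) = D a + D b" if "a \<in> l1" "b \<in> l1" for a b
    using D that unfolding module_derivation_def by blast
  have Dmul: "D (conv a b) = al L a (D b) + ar L (D a) b" if "a \<in> l1" "b \<in> l1" for a b
    using D that unfolding module_derivation_def al_def ar_def by blast
  obtain C where C: "\<And>a. a \<in> l1 \<Longrightarrow> nv L (D a) \<le> C * l1norm a"
    using D unfolding module_derivation_def by blast
  obtain C0 where C0: "C0 > 0" "\<And>x. x \<in> V L \<Longrightarrow> RN L x \<le> C0 * nv L x"
    using norm_level[of L] by (auto simp: norm_level_def)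
  have DN: "RN L (D a) \<le> (C0 * C) * l1norm a" if a: "a \<in> l1" for a
    using order_trans[OF C0(2)[OF Din[OF a]] mult_left_mono[OF C[OF a], of C0]] C0(1) by (simp add: mult.assoc)
  note LL = order_refl[of L] and d = delta_l1(1)
  let ?d = "delta :: 's \<Rightarrow> 's \<Rightarrow> complex"
  \<comment> \<open>The predual level, which exists because \<open>0 < n\<close>.\<close>
  define j where "j = L - 1"
  have j: "j < L" "Suc j = L" using n by (auto simp: j_def)
  define c where "c g = ar L (D (?d g)) (?d (star g))" for g
  have c_in: "c g \<in> V L" for g unfolding c_def by (rule act(2)[OF LL d Din[OF d]])
  have cocycle: "cj L g (c t) + c g = c (g * t)" for g t
  proof -
    define x y where "x = D (?d g)" and "y = D (?d t)"
    have xy: "x \<in> V L" "y \<in> V L" using Din[OF d] by (auto simp: x_def y_def)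
    have gy: "al L (?d g) y \<in> V L" and xt: "ar L x (?d t) \<in> V L" using act(1,2)[OF LL d] xy by auto
    have "D (?d (g * t)) = al L (?d g) y + ar L x (?d t)"
      using Dmul[OF d d, of g t] by (simp add: conv_delta_delta x_def y_def)
    then have "c (g * t) = ar L (al L (?d g) y) (?d (star t * star g)) + ar L (ar L x (?d t)) (?d (star t * star g))"
      using act(4)[OF LL d gy xt] by (simp add: c_def star_mult[OF inv])
    also have "ar L (al L (?d g) y) (?d (star t * star g)) = ar L (ar L (al L (?d g) y) (?d (star t))) (?d (star g))"
      using ar_ar[OF LL gy] by simp
    also have "\<dots> = cj L g (c t)" using ar_al[OF LL xy(2)] by (simp add: cj_def c_def y_def)
    \<comment> \<open>The idempotent \<open>t * star t\<close> stands next to \<open>x\<close> and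
      acts trivially.\<close>
    also have "ar L (ar L x (?d t)) (?d (star t * star g)) = ar L x (?d ((t * star t) * star g))"
      using ar_ar[OF LL xy(1)] by (simp add: mult.assoc)
    also have "\<dots> = ar L (ar L x (?d (t * star t))) (?d (star g))" using ar_ar[OF LL xy(1)] by simp
    also have "\<dots> = c g" using ar_idem[OF LL xy(1) star_idems(1)[OF inv]] by (simp add: c_def x_def)
    finally show ?thesis by simp
  qed
  have c_bd: "RN L (c g) \<le> 2 * (C0 * C)" for g
    using act(8)[OF LL d Din[OF d], of g "star g"] DN[OF d, of g] by (simp add: c_def delta_l1(2))
  interpret dual_pair "V j" scr "RN j" "V L" "RN L" "\<lambda>\<phi> x. Re (pr j \<phi> x)"
    using dual_pair_level[OF j(1)] j(2) by simp
  have jL: "j \<le> L" using j by simp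
  obtain y where y: "y \<in> V L" "\<And>g. cj L g y + c g = y"
  proof (rule affine_fixed_point[of "cj L" "cj j" star c "2 * (C0 * C)"])
    show "approx_mean (V L) (RN L) (cj L)" using approx_mean_even[of n] n by simp
    show "Re (pr j (cj L g \<phi>) x) = Re (pr j \<phi> (cj j (star g) x))" if "\<phi> \<in> V L" "x \<in> V j" for g \<phi> x
      using pr_cj[OF j(1)] that j(2) by simp
  qed (use c_in cocycle c_bd cj_in cj_add RN_cj jL in auto)
  \<comment> \<open>The fixed point equation multiplied on the right by \<open>delta g\<close>,
    where \<open>star g * g\<close> acts trivially. The order of the terms makes \<open>- y\<close>
    the implementing element.\<close>
  have D_delta: "D (?d g) = ar L y (?d g) - al L (?d g) y" for g
  proof -
    have in': "al L (?d g) y \<in> V L" "cj L g y \<in> V L" using act(1)[OF LL d y(1)] cj_in[OF LL y(1)] by auto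
    have "ar L y (?d g) = ar L (cj L g y) (?d g) + ar L (c g) (?d g)"
      using y(2)[of g] act(4)[OF LL d in'(2) c_in, of g g] by simp
    also have "ar L (cj L g y) (?d g) = al L (?d g) y"
      unfolding cj_def using ar_ar[OF LL in'(1)] ar_idem[OF LL in'(1) star_idems(2)[OF inv]] by simp
    also have "ar L (c g) (?d g) = D (?d g)"
      unfolding c_def using ar_ar[OF LL Din[OF d]] ar_idem[OF LL Din[OF d] star_idems(2)[OF inv]] by simp
    finally show ?thesis by (simp add: algebra_simps)
  qed
  \<comment> \<open>The deviation of \<open>D\<close> from the inner derivation given by
    \<open>- y\<close>. It vanishes on point masses, and \<open>\<Delta>_bd\<close> extends this to
    \<open>l1\<close>.\<close>
  define \<Delta> where "\<Delta> f = D f + al L f y - ar L y f" for f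
  have \<Delta>_in: "\<Delta> f \<in> V L" if "f \<in> l1" for f
    unfolding \<Delta>_def using act(1,2)[OF LL that y(1)] Din[OF that] W.add_in W.diff_in by blast
  have \<Delta>_add: "\<Delta> (\<lambda>u. f u + g u) = \<Delta> f + \<Delta> g" if "f \<in> l1" "g \<in> l1" for f g
    unfolding \<Delta>_def using Dadd[OF that] act_add_alg[OF that LL y(1)] by simp
  have \<Delta>_delta: "\<Delta> (\<lambda>u. a * ?d s u) = 0" for a s
  proof -
    have "\<Delta> (\<lambda>u. a * ?d s u) = sm a (D (?d s)) + sm a (al L (?d s) y) - sm a (ar L y (?d s))"
      unfolding \<Delta>_def using derivation_scale[OF D d] act_scale_alg[OF d LL y(1)] by simp
    also have "sm a (D (?d s)) + sm a (al L (?d s) y) = sm a (ar L y (?d s))"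
      unfolding sm_plus[OF LL Din[OF d] act(1)[OF LL d y(1)], symmetric] by (simp add: D_delta)
    finally show ?thesis by simp
  qed
  have \<Delta>_bd: "RN L (\<Delta> f) \<le> (C0 * C + 4 * RN L y) * l1norm f" if f: "f \<in> l1" for f
  proof -
    note A = act[OF LL f y(1)]
    have "RN L (\<Delta> f) \<le> RN L (D f) + RN L (al L f y) + RN L (ar L y f)"
      unfolding \<Delta>_def using W.N_diff[OF W.add_in[OF Din[OF f] A(1)] A(2)] W.N_add[OF Din[OF f] A(1)] by simp
    then show ?thesis using DN[OF f] A(7,8) by (simp add: algebra_simps)
  qed
  have \<Delta>_zero: "\<Delta> f = 0" if f: "f \<in> l1" for f
  proof (rule norm_eq_0D[OF \<Delta>_in[OF f]], rule field_le_epsilon)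
    fix \<epsilon> :: real assume \<epsilon>: "0 < \<epsilon>"
    define B where "B = \<bar>C0 * C + 4 * RN L y\<bar> + 1"
    have B: "0 < B" "C0 * C + 4 * RN L y \<le> B" by (auto simp: B_def)
    obtain A where A: "finite A" "l1norm (\<lambda>u. f u - (if u \<in> A then f u else 0)) < \<epsilon> / B"
      using l1_tail_small[OF f, of "\<epsilon> / B"] \<epsilon> B by auto
    let ?f = "\<lambda>u. if u \<in> A then f u else 0"
    have "?f \<in> l1 \<and> \<Delta> ?f = 0"
    proof (rule finite_support_induct[OF A(1)])
      show "(\<lambda>_. 0) \<in> l1 \<and> \<Delta> (\<lambda>_. 0) = 0" using l1_zero(1) \<Delta>_add[OF l1_zero(1) l1_zero(1)] by simp
      fix g a s assume g: "g \<in> l1" and "g \<in> l1 \<and> \<Delta> g = 0"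
      then show "(\<lambda>u. g u + a * ?d s u) \<in> l1 \<and> \<Delta> (\<lambda>u. g u + a * ?d s u) = 0"
        using l1_add(1)[OF g l1_scale(1)[OF d]] \<Delta>_add[OF g l1_scale(1)[OF d]] \<Delta>_delta by simp
    qed
    then have fA: "?f \<in> l1" "\<Delta> ?f = 0" by auto
    let ?r = "\<lambda>u. f u - ?f u"
    have r: "?r \<in> l1" by (rule l1_diff(1)[OF f fA(1)])
    have "\<Delta> f = \<Delta> ?r" using \<Delta>_add[OF fA(1) r] fA(2) by simp
    then have "RN L (\<Delta> f) \<le> (C0 * C + 4 * RN L y) * l1norm ?r" using \<Delta>_bd[OF r] by simp
    also have "\<dots> \<le> B * (\<epsilon> / B)" using A(2) B l1norm_nonneg[of ?r] by (intro mult_mono) auto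
    also have "\<dots> = \<epsilon>" using B by simp
    finally show "RN L (\<Delta> f) \<le> 0 + \<epsilon>" by simp
  qed
  show ?thesis
    unfolding inner_derivation_def al_def[symmetric] ar_def[symmetric]
  proof (intro bexI[of _ "- y"] ballI)
    show "- y \<in> V L" by (rule W.minus_in[OF y(1)])
    fix f :: "'s \<Rightarrow> complex" assume f: "f \<in> l1"
    have "al L f (- y) = - al L f y" "ar L (- y) f = - ar L y f"
      using act(5,6)[OF LL f y(1), of "- 1"] sm_minus_one[OF LL y(1)] act(1,2)[OF LL f y(1)]
      by (simp_all add: sm_minus_one[OF LL])
    then show "D f = al L f (- y) - ar L (- y) f"
      using \<Delta>_zero[OF f] by (simp add: \<Delta>_def algebra_simps eq_diff_eq add_eq_0_iff)
  qed
qed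

end

theorem mainTheorem1:
  fixes n :: nat
    and q :: "('s::semigroup_mult \<Rightarrow> complex) \<Rightarrow> 'v::ab_group_add"
    and sm :: "complex \<Rightarrow> 'v \<Rightarrow> 'v"
    and V :: "nat \<Rightarrow> 'v set"
    and pr :: "nat \<Rightarrow> 'v \<Rightarrow> 'v \<Rightarrow> complex"
    and nv :: "nat \<Rightarrow> 'v \<Rightarrow> real"
  assumes "inverse_semigroup TYPE('s)"
    and "n \<ge> 1"
    and "dual_tower (2 * n) q sm V pr nv"
  shows "weakly_module_amenable (2 * n) q V pr nv"
proof -
  interpret quotient_tower "2 * n" q sm V pr nv
    using assms by unfold_locales
  show ?thesis
    unfolding weakly_module_amenable_def
    using commutative[of "2 * n"] derivation_inner[of _ n] assms(2) by auto
qed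

end
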